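(* For every $\varepsilon>0$ there exists a constant $K(\varepsilon)>0$, depending only on $\varepsilon$, such that for every complex-valued potential $q\in L^1(\mathbb{R}_+)$, $$S_\varepsilon(H_q)=\sum_{\lambda\in\sigma_d(H_q)}\frac{\operatorname{dist}(\lambda,\mathbb{R}_+)}{|\lambda|^{(1-\varepsilon)/2}}\le K(\varepsilon)\,\|q\|_1^{1+\varepsilon},\qquad \|q\|_1=\int_0^\infty|q(x)|\,dx.$$
   Context: For a complex-valued $q\in L^1(\mathbb{R}_+)$, $H_q=-\frac{d^2}{dx^2}+q$ acts on $L^2(\mathbb{R}_+)$ with Dirichlet boundary condition at $0$. $\sigma_d(H_q)$ denotes the discrete spectrum, i.e. the eigenvalues of finite algebraic multiplicity in $\mathbb{C}\setminus\mathbb{R}_+$; in sums over $\sigma_d(H_q)$ each eigenvalue is repeated according to its algebraic multiplicity (rank of the Riesz projection). *)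

theory Defs
  imports "HOL-Analysis.Analysis" "HOL-Library.Function_Algebras"
begin

text \<open>Functions on the half-line are represented as maps real => complex; only
  their values on (0,oo) matter (domain elements are normalised to vanish on (-oo,0]).\<close>

definition cscale :: "complex \<Rightarrow> (real \<Rightarrow> complex) \<Rightarrow> (real \<Rightarrow> complex)" where
  "cscale c f = (\<lambda>x. c * f x)"

definition L2_half :: "(real \<Rightarrow> complex) \<Rightarrow> bool" where
  "L2_half f \<longleftrightarrow> f measurable_on {0<..} \<and> (\<lambda>x. (norm (f x))^2) integrable_on {0<..}"

definition L1_norm :: "(real \<Rightarrow> complex) \<Rightarrow> real" where
  "L1_norm q = integral {0<..} (\<lambda>x. norm (q x))"

text \<open>schr_op q f u: f lies in the domain of H_q = -d^2/dx^2 + q on L^2(R_+) with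
  Dirichlet condition f(0) = 0 (maximal domain: f, f' locally absolutely continuous,
  f and -f''+qf in L^2), and H_q f = u almost everywhere on (0,oo).\<close>
definition schr_op :: "(real \<Rightarrow> complex) \<Rightarrow> (real \<Rightarrow> complex) \<Rightarrow> (real \<Rightarrow> complex) \<Rightarrow> bool" where
  "schr_op q f u \<longleftrightarrow>
     (\<forall>x\<le>0. f x = 0) \<and>
     (\<exists>c h. (\<forall>x\<ge>0. h absolutely_integrable_on {0..x}) \<and>
            (\<forall>x\<ge>0. f x = integral {0..x} (\<lambda>t. c + integral {0..t} h)) \<and>
            negligible {x. 0 < x \<and> u x \<noteq> - h x + q x * f x}) \<and>
     L2_half f \<and> L2_half u"

fun gen_ker :: "(real \<Rightarrow> complex) \<Rightarrow> complex \<Rightarrow> nat \<Rightarrow> (real \<Rightarrow> complex) set" where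
  "gen_ker q z 0 = {(\<lambda>x. 0)}"
| "gen_ker q z (Suc k) = {f. \<exists>g\<in>gen_ker q z k. schr_op q f (\<lambda>x. z * f x + g x)}"

text \<open>Root space (range of the Riesz projection for an isolated eigenvalue of finite type).\<close>
definition root_space :: "(real \<Rightarrow> complex) \<Rightarrow> complex \<Rightarrow> (real \<Rightarrow> complex) set" where
  "root_space q z = (\<Union>k. gen_ker q z k)"

definition alg_mult :: "(real \<Rightarrow> complex) \<Rightarrow> complex \<Rightarrow> nat" where
  "alg_mult q z = vector_space.dim cscale (root_space q z)"

definition disc_spec :: "(real \<Rightarrow> complex) \<Rightarrow> complex set" where
  "disc_spec q = {z. z \<notin> complex_of_real ` {0..} \<and>
      gen_ker q z 1 \<noteq> {(\<lambda>x. 0)} \<and>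
      (\<exists>B. finite B \<and> B \<subseteq> root_space q z \<and> module.span cscale B = root_space q z)}"

end

theory Submission
  imports Defs "HOL-Complex_Analysis.Complex_Analysis"
begin

text \<open>
  For Im k > 0 let psi(k) be the Jost solution at energy k^2, normalised as exp(ikx) at infinity.
  Its value F(k) at x = 0 is holomorphic in k and |F(k) - 1| is at most exp(Q/|k|) - 1, where Q is
  the norm of q. The Lagrange identity, applied along a chain of generalised eigenfunctions
  for k0^2, shows that F vanishes at k0 at least to the order of the algebraic multiplicity. Since
  dist(k^2, R+) is at most 2 |k| Im k, it remains to bound the sum of Im k |k|^eps over the zeros.

  Scale to Q = 1. On the part of the upper half-plane with |k| > d there is a function Phi of size
  ln(1/d) at 3i with Re Phi at least 1/|k|, so F exp(-Phi) is bounded by 1 and does not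
  nearly vanish at 3i. Transporting this to the half-plane and dividing out Blaschke factors
  bounds the sum of Im k over the zeros with |k| at least 2d by a constant times 1 + ln(1/d). Summing over
  dyadic shells, the weight |k|^eps absorbs the logarithm.
\<close>

section \<open>Absolutely continuous functions on the half-line\<close>

text \<open>The obstacle is the origin. Near k = 0 the only control on F is exp(Q/|k|), so the
  Blaschke argument for bounded functions on the half-plane does not apply outright. Cutting out a
  disc of radius d costs ln(1/d), and the positive power of |k| pays for it; the constant built here
  grows like 1/eps^2 as eps tends to 0. In terms of k the denominator |lambda|^((1-eps)/2) is
  |k|^(1-eps), and the homogeneity of Im k |k|^eps under k -> Q k is the origin of the factor
  Q^(1+eps). Only one inequality between multiplicities is needed: the dimension of the root space
  is at most the order of the zero of F. This is why Jordan chains, the Lagrange identity and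
  uniqueness for the Cauchy problem suffice, and no resolvent, Riesz projection or determinant
  appears. As q is merely integrable, f'' exists only as a density, so all calculus is carried out
  with indefinite Lebesgue integrals. Of the functions in the domain nothing is known at infinity
  except that f and H_q f are square integrable.\<close>

lemma sigma_finite_lebesgue: "sigma_finite_measure (lebesgue :: 'a::euclidean_space measure)"
proof
  obtain A :: "'a set set" where A: "countable A" "A \<subseteq> sets lborel" "\<Union>A = space lborel" "\<forall>a\<in>A. emeasure lborel a \<noteq> \<infinity>"
    using lborel.sigma_finite_countable by blast
  show "\<exists>A::'a set set. countable A \<and> A \<subseteq> sets lebesgue \<and> \<Union> A = space lebesgue \<and> (\<forall>a\<in>A. emeasure lebesgue a \<noteq> \<infinity>)"
    using A by (intro exI[of _ A]) (auto simp: subset_eq)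
qed

lemma AE_lebesgue_neq:
  "AE t in lebesgue. t \<noteq> (x::'a::euclidean_space)"
  using AE_lborel_singleton AE_completion by blast

text \<open>Integration by parts is Fubini's theorem for the product a(s) b(t), split along the diagonal.\<close>

lemma integral_triangle_split:
  fixes a b :: "real \<Rightarrow> 'a::{real_normed_field,euclidean_space}"
  assumes a: "integrable lebesgue a" and b: "integrable lebesgue b"
  shows "(LINT s|lebesgue. a s * (LINT t:{..s}|lebesgue. b t)) + (LINT t|lebesgue. (LINT s:{..t}|lebesgue. a s) * b t)
     = (LINT s|lebesgue. a s) * (LINT t|lebesgue. b t)"
proof -
  \<comment> \<open>Fubini is used for the completed measure, because the densities supplied by the
    domain of H_q are only Lebesgue measurable.\<close>
  interpret pair_sigma_finite "lebesgue :: real measure" "lebesgue :: real measure"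
    by (intro pair_sigma_finite.intro sigma_finite_lebesgue)
  have [measurable]: "a \<in> borel_measurable lebesgue" "b \<in> borel_measurable lebesgue"
    using a b by auto
  have id[measurable]: "(\<lambda>x::real. x) \<in> lebesgue \<rightarrow>\<^sub>M borel"
    by (simp add: measurable_completion)
  have meas: "Measurable.pred (lebesgue \<Otimes>\<^sub>M lebesgue) (\<lambda>p::real\<times>real. fst p \<le> snd p)"
    by measurable
  define h where "h = (\<lambda>s t. if s \<le> t then a s * b t else 0)"
  have hm[measurable]: "case_prod h \<in> borel_measurable (lebesgue \<Otimes>\<^sub>M lebesgue)"
    unfolding h_def case_prod_beta
    by (intro measurable_If meas) measurable
  have hb: "norm (h s t) \<le> norm (a s) * norm (b t)" for s t
    by (simp add: h_def norm_mult)
  have hi: "integrable (lebesgue \<Otimes>\<^sub>M lebesgue) (case_prod h)"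
  proof (rule Bochner_Integration.integrable_bound)
    show "integrable (lebesgue \<Otimes>\<^sub>M lebesgue) (case_prod (\<lambda>s t. norm (a s) * norm (b t)))"
      by (rule Fubini_integrable) (use a b in auto)
  qed (use hb in auto)
  have e1: "(LINT s|lebesgue. h s t) = (LINT s:{..t}|lebesgue. a s) * b t" for t
  proof -
    have "(LINT s|lebesgue. h s t) = (LINT s|lebesgue. (indicat_real {..t} s *\<^sub>R a s) * b t)"
      by (intro Bochner_Integration.integral_cong) (auto simp: h_def indicator_def)
    then show ?thesis by (simp only: set_lebesgue_integral_def integral_mult_left_zero)
  qed
  have e2: "(LINT t|lebesgue. h s t) = a s * (LINT t|lebesgue. b t) - a s * (LINT t:{..s}|lebesgue. b t)" for s
  proof -
    have bi: "integrable lebesgue (\<lambda>t. indicat_real {..s} t *\<^sub>R b t)"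
      by (rule integrable_mult_indicator) (use b in auto)
    have "(LINT t|lebesgue. h s t) = (LINT t|lebesgue. a s * b t - a s * (indicat_real {..s} t *\<^sub>R b t))"
    proof (rule integral_cong_AE)
      \<comment> \<open>At t = s both closed conditions hold and the pointwise identity can fail,
        but a single point is null.\<close>
      show "AE t in lebesgue. h s t = a s * b t - a s * (indicat_real {..s} t *\<^sub>R b t)"
        using AE_lebesgue_neq[of s] by eventually_elim (auto simp: h_def indicator_def)
    qed (use hm b in \<open>auto\<close>)
    also have "\<dots> = a s * (LINT t|lebesgue. b t) - a s * (LINT t:{..s}|lebesgue. b t)"
      unfolding set_lebesgue_integral_def
      by (subst Bochner_Integration.integral_diff) (use bi b in \<open>auto simp only: integral_mult_right_zero integrable_mult_right\<close>)
    finally show ?thesis .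
  qed
  have i1: "integrable lebesgue (\<lambda>s. a s * (LINT t|lebesgue. b t) - a s * (LINT t:{..s}|lebesgue. b t))"
    using integrable_fst[OF hi] by (simp add: e2)
  have i2: "integrable lebesgue (\<lambda>s. a s * (LINT t|lebesgue. b t))" using a by simp
  have i3: "integrable lebesgue (\<lambda>s. a s * (LINT t:{..s}|lebesgue. b t))"
    using Bochner_Integration.integrable_diff[OF i2 i1] by simp
  have "(LINT t|lebesgue. (LINT s:{..t}|lebesgue. a s) * b t) = (LINT s|lebesgue. a s * (LINT t|lebesgue. b t) - a s * (LINT t:{..s}|lebesgue. b t))"
    using Fubini_integral[OF hi] by (simp add: e1 e2)
  also have "\<dots> = (LINT s|lebesgue. a s) * (LINT t|lebesgue. b t) - (LINT s|lebesgue. a s * (LINT t:{..s}|lebesgue. b t))"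
    using i2 i3 by simp
  finally show ?thesis by simp
qed

text \<open>Local absolute continuity on [0,oo) in integral form: \<open>a\<close> is a density,
  determined only up to null sets, and no pointwise differentiability is asserted. Values at
  negative arguments are left free.\<close>

definition ac_deriv :: "(real \<Rightarrow> 'a::{real_normed_field,euclidean_space}) \<Rightarrow> (real \<Rightarrow> 'a) \<Rightarrow> bool" where
  "ac_deriv F a \<longleftrightarrow> (\<forall>x\<ge>0. set_integrable lebesgue {0..x} a \<and> F x = F 0 + (LINT t:{0..x}|lebesgue. a t))"

lemma ac_deriv_integrable: "ac_deriv F a \<Longrightarrow> set_integrable lebesgue {0..x} a"
  by (cases "x \<ge> 0") (auto simp: ac_deriv_def set_integrable_def)

lemma ac_deriv_eq: "ac_deriv F a \<Longrightarrow> x \<ge> 0 \<Longrightarrow> F x = F 0 + (LINT t:{0..x}|lebesgue. a t)"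
  unfolding ac_deriv_def by blast

lemma ac_deriv_continuous: assumes "ac_deriv F a" shows "continuous_on {0..x} F"
proof -
  have i: "a absolutely_integrable_on {0..y}" for y using ac_deriv_integrable[OF assms] .
  have "continuous_on {0..x} (\<lambda>y. F 0 + integral {0..y} a)"
    by (intro continuous_intros indefinite_integral_continuous_1 set_lebesgue_integral_eq_integral(1)[OF i])
  moreover have "F y = F 0 + integral {0..y} a" if "y \<in> {0..x}" for y
    using ac_deriv_eq[OF assms, of y] that set_lebesgue_integral_eq_integral(2)[OF i[of y]] by simp
  ultimately show ?thesis using continuous_on_eq[of "{0..x}" "\<lambda>y. F 0 + integral {0..y} a" F] by metis
qed

lemma set_integrable_continuous_mult:
  fixes a F :: "real \<Rightarrow> 'a::{real_normed_field,euclidean_space}"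
  assumes "continuous_on {x..y} F" "set_integrable lebesgue {x..y} a"
  shows "set_integrable lebesgue {x..y} (\<lambda>t. F t * a t)"
proof (rule absolutely_integrable_bounded_measurable_product[where h="(*)"])
  show "F \<in> borel_measurable (lebesgue_on {x..y})"
    by (intro continuous_imp_measurable_on_sets_lebesgue assms) auto
  show "bounded (F ` {x..y})"
    using assms(1) compact_continuous_image compact_imp_bounded by blast
  show "bilinear ((*) :: 'a \<Rightarrow> 'a \<Rightarrow> 'a)"
    by (simp add: bilinear_conv_bounded_bilinear bounded_bilinear_mult)
qed (use assms in auto)

lemma ac_deriv_mult:
  assumes F: "ac_deriv F a" and G: "ac_deriv G b"
  shows "ac_deriv (\<lambda>x. F x * G x) (\<lambda>x. a x * G x + F x * b x)"
  unfolding ac_deriv_def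
proof (intro allI impI conjI)
  fix x :: real assume x: "x \<ge> 0"
  have i1: "set_integrable lebesgue {0..x} (\<lambda>t. a t * G t)"
    using set_integrable_continuous_mult[OF ac_deriv_continuous[OF G] ac_deriv_integrable[OF F]] by (simp add: mult.commute)
  have i2: "set_integrable lebesgue {0..x} (\<lambda>t. F t * b t)"
    using set_integrable_continuous_mult[OF ac_deriv_continuous[OF F] ac_deriv_integrable[OF G]] by (simp add: mult.commute)
  show "set_integrable lebesgue {0..x} (\<lambda>t. a t * G t + F t * b t)" using i1 i2 by (rule set_integral_add)
  \<comment> \<open>After cutting off to [0,x] both densities are integrable over the line, and the
    inner integrals of \<open>integral_triangle_split\<close> become increments of \<open>G\<close>
    and \<open>F\<close> from 0.\<close>
  define a' where "a' = (\<lambda>t. indicat_real {0..x} t *\<^sub>R a t)"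
  define b' where "b' = (\<lambda>t. indicat_real {0..x} t *\<^sub>R b t)"
  have ia: "integrable lebesgue a'" and ib: "integrable lebesgue b'"
    using ac_deriv_integrable[OF F, of x] ac_deriv_integrable[OF G, of x] by (auto simp: a'_def b'_def set_integrable_def)
  define A where "A = (LINT t:{0..x}|lebesgue. a t)"
  define B where "B = (LINT t:{0..x}|lebesgue. b t)"
  have AA: "integral\<^sup>L lebesgue a' = A" and BB: "integral\<^sup>L lebesgue b' = B"
    by (simp_all add: A_def B_def a'_def b'_def set_lebesgue_integral_def)
  have c1: "(LINT t:{..s}|lebesgue. b' t) = G s - G 0" if "s \<in> {0..x}" for s
  proof -
    have "(LINT t:{..s}|lebesgue. b' t) = (LINT t:{0..s}|lebesgue. b t)"
      unfolding set_lebesgue_integral_def b'_def using that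
      by (intro Bochner_Integration.integral_cong) (auto simp: indicator_def)
    then show ?thesis using ac_deriv_eq[OF G, of s] that by simp
  qed
  have c2: "(LINT t:{..s}|lebesgue. a' t) = F s - F 0" if "s \<in> {0..x}" for s
  proof -
    have "(LINT t:{..s}|lebesgue. a' t) = (LINT t:{0..s}|lebesgue. a t)"
      unfolding set_lebesgue_integral_def a'_def using that
      by (intro Bochner_Integration.integral_cong) (auto simp: indicator_def)
    then show ?thesis using ac_deriv_eq[OF F, of s] that by simp
  qed
  have "(LINT s|lebesgue. a' s * (LINT t:{..s}|lebesgue. b' t)) = (LINT s:{0..x}|lebesgue. a s * G s - a s * G 0)"
    unfolding set_lebesgue_integral_def[where M=lebesgue and A="{0..x}"]
    by (intro Bochner_Integration.integral_cong) (auto simp: a'_def c1 indicator_def algebra_simps)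
  also have "\<dots> = (LINT s:{0..x}|lebesgue. a s * G s) - A * G 0"
    unfolding A_def by (subst set_integral_diff) (use i1 ac_deriv_integrable[OF F] in auto)
  finally have d1: "(LINT s|lebesgue. a' s * (LINT t:{..s}|lebesgue. b' t)) = (LINT s:{0..x}|lebesgue. a s * G s) - A * G 0" .
  have "(LINT s|lebesgue. (LINT t:{..s}|lebesgue. a' t) * b' s) = (LINT s:{0..x}|lebesgue. F s * b s - F 0 * b s)"
    unfolding set_lebesgue_integral_def[where M=lebesgue and A="{0..x}"]
    by (intro Bochner_Integration.integral_cong) (auto simp: b'_def c2 indicator_def algebra_simps)
  also have "\<dots> = (LINT s:{0..x}|lebesgue. F s * b s) - F 0 * B"
    unfolding B_def by (subst set_integral_diff) (use i2 ac_deriv_integrable[OF G] in auto)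
  finally have d2: "(LINT s|lebesgue. (LINT t:{..s}|lebesgue. a' t) * b' s) = (LINT s:{0..x}|lebesgue. F s * b s) - F 0 * B" .
  have "(LINT s:{0..x}|lebesgue. a s * G s) + (LINT s:{0..x}|lebesgue. F s * b s) = A * B + A * G 0 + F 0 * B"
    using integral_triangle_split[OF ia ib] unfolding d1 d2 AA BB by (simp add: algebra_simps)
  moreover have "F x = F 0 + A" "G x = G 0 + B"
    unfolding A_def B_def using ac_deriv_eq F G x by blast+
  ultimately show "F x * G x = F 0 * G 0 + (LINT t:{0..x}|lebesgue. a t * G t + F t * b t)"
    by (subst set_integral_add[OF i1 i2]) (auto simp: algebra_simps)
qed

lemma ac_deriv_add:
  assumes "ac_deriv F a" "ac_deriv G b" shows "ac_deriv (\<lambda>x. F x + G x) (\<lambda>x. a x + b x)"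
  unfolding ac_deriv_def
proof (intro allI impI conjI)
  fix x :: real assume x: "x \<ge> 0"
  have i: "set_integrable lebesgue {0..x} a" "set_integrable lebesgue {0..x} b"
    using assms ac_deriv_integrable by blast+
  then show "set_integrable lebesgue {0..x} (\<lambda>x. a x + b x)" by (rule set_integral_add)
  show "F x + G x = F 0 + G 0 + (LINT t:{0..x}|lebesgue. a t + b t)"
    unfolding set_integral_add(2)[OF i] ac_deriv_eq[OF assms(1) x] ac_deriv_eq[OF assms(2) x] by simp
qed

lemma ac_deriv_diff:
  assumes "ac_deriv F a" "ac_deriv G b" shows "ac_deriv (\<lambda>x. F x - G x) (\<lambda>x. a x - b x)"
  unfolding ac_deriv_def
proof (intro allI impI conjI)
  fix x :: real assume x: "x \<ge> 0"
  have i: "set_integrable lebesgue {0..x} a" "set_integrable lebesgue {0..x} b"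
    using assms ac_deriv_integrable by blast+
  then show "set_integrable lebesgue {0..x} (\<lambda>x. a x - b x)" by (rule set_integral_diff)
  show "F x - G x = F 0 - G 0 + (LINT t:{0..x}|lebesgue. a t - b t)"
    unfolding set_integral_diff(2)[OF i] ac_deriv_eq[OF assms(1) x] ac_deriv_eq[OF assms(2) x] by simp
qed

lemma ac_deriv_cmult:
  assumes "ac_deriv F a" shows "ac_deriv (\<lambda>x. c * F x) (\<lambda>x. c * a x)"
  unfolding ac_deriv_def
proof (intro allI impI conjI)
  fix x :: real assume x: "x \<ge> 0"
  show "set_integrable lebesgue {0..x} (\<lambda>x. c * a x)"
    using ac_deriv_integrable[OF assms] by (rule set_integrable_mult_right)
  show "c * F x = c * F 0 + (LINT t:{0..x}|lebesgue. c * a t)"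
    unfolding set_integral_mult_right ac_deriv_eq[OF assms x] by (simp add: distrib_left)
qed

lemma ac_deriv_cong:
  assumes "ac_deriv F a" "\<And>x. x \<ge> 0 \<Longrightarrow> F x = G x" "\<And>x. x \<ge> 0 \<Longrightarrow> a x = b x" shows "ac_deriv G b"
proof -
  have "set_integrable lebesgue {0..x} a = set_integrable lebesgue {0..x} b"
     "(LINT t:{0..x}|lebesgue. a t) = (LINT t:{0..x}|lebesgue. b t)" for x
    unfolding set_lebesgue_integral_def set_integrable_def
    by (intro Bochner_Integration.integrable_cong Bochner_Integration.integral_cong; use assms in \<open>force simp: indicator_def\<close>)+
  then show ?thesis using assms(1,2) unfolding ac_deriv_def by (metis order_refl)
qed

lemma ac_deriv_const: "ac_deriv (\<lambda>x. c) (\<lambda>x. 0)"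
  by (simp add: ac_deriv_def set_integrable_def)

lemma ac_deriv_C1:
  assumes "\<And>t. (F has_vector_derivative a t) (at t)" "continuous_on UNIV a"
  shows "ac_deriv F a"
  unfolding ac_deriv_def
proof (intro allI impI conjI)
  fix x :: real assume x: "x \<ge> 0"
  have c: "continuous_on {0..x} a" using assms(2) continuous_on_subset by blast
  show i: "set_integrable lebesgue {0..x} a"
    using absolutely_integrable_continuous_real[OF c] .
  have "(a has_integral (F x - F 0)) {0..x}"
    by (rule fundamental_theorem_of_calculus[OF x has_vector_derivative_at_within[OF assms(1)]])
  then show "F x = F 0 + (LINT t:{0..x}|lebesgue. a t)"
    unfolding set_lebesgue_integral_eq_integral(2)[OF i] by (simp add: integral_unique)
qed

lemma ac_deriv_power: "ac_deriv F a \<Longrightarrow> ac_deriv (\<lambda>x. F x ^ n) (\<lambda>x. of_nat n * F x ^ (n - 1) * a x)"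
proof (induction n)
  case 0 then show ?case by (simp add: ac_deriv_const)
next
  case (Suc n)
  show ?case
    by (rule ac_deriv_cong[OF ac_deriv_mult[OF Suc.prems Suc.IH[OF Suc.prems]]])
       (cases n; auto simp: algebra_simps)+
qed

text \<open>With P the primitive of \<open>p\<close>, feeding the bound Y P^n / n! back into the
  inequality improves it to Y P^(n+1) / (n+1)!, since P^(n+1) has density (n+1) P^n p. These bounds
  tend to 0. Working with P allows \<open>p\<close> to be unbounded.\<close>

lemma gronwall_zero:
  fixes y p :: "real \<Rightarrow> real"
  assumes y: "\<And>x. continuous_on {0..x} y" "\<And>x. x \<ge> 0 \<Longrightarrow> y x \<ge> 0"
    and p: "\<And>x. set_integrable lebesgue {0..x} p" "\<And>x. x \<ge> 0 \<Longrightarrow> p x \<ge> 0"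
    and le: "\<And>x. x \<ge> 0 \<Longrightarrow> y x \<le> (LINT t:{0..x}|lebesgue. p t * y t)"
    and x: "x \<ge> 0"
  shows "y x = 0"
proof -
  define P where "P = (\<lambda>x. LINT t:{0..x}|lebesgue. p t)"
  have P0: "P 0 = 0"
    unfolding P_def set_lebesgue_integral_eq_integral(2)[OF p(1)[of 0]] by simp
  have P: "ac_deriv P p"
    unfolding ac_deriv_def P0 using p by (auto simp: P_def)
  obtain Y where Y: "\<And>t. t \<in> {0..x} \<Longrightarrow> y t \<le> Y"
  proof -
    have "bounded (y ` {0..x})"
      using y(1) compact_continuous_image compact_imp_bounded by blast
    then obtain B where "\<And>t. t \<in> {0..x} \<Longrightarrow> norm (y t) \<le> B" unfolding bounded_iff by blast
    then show ?thesis using that[of B] by fastforce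
  qed
  have "\<forall>t\<in>{0..x}. y t \<le> Y * P t ^ n / fact n" for n
  proof (induction n)
    case 0 then show ?case using Y by simp
  next
    case (Suc n)
    show ?case
    proof
      fix t assume t: "t \<in> {0..x}"
      have i: "set_integrable lebesgue {0..t} (\<lambda>s. p s * y s)"
        using set_integrable_continuous_mult[OF y(1) p(1)] by (simp add: mult.commute)
      have j: "set_integrable lebesgue {0..t} (\<lambda>s. of_nat (Suc n) * P s ^ n * p s)"
        using ac_deriv_integrable[OF ac_deriv_power[OF P, of "Suc n"]] by simp
      have P': "P t ^ Suc n = (LINT s:{0..t}|lebesgue. of_nat (Suc n) * P s ^ n * p s)"
        using ac_deriv_eq[OF ac_deriv_power[OF P, of "Suc n"], of t] t P0 by simp
      have "y t \<le> (LINT s:{0..t}|lebesgue. p s * y s)" using le t by simp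
      also have "\<dots> \<le> (LINT s:{0..t}|lebesgue. (Y / fact (Suc n)) * (of_nat (Suc n) * P s ^ n * p s))"
      proof (rule set_integral_mono[OF i])
        show "set_integrable lebesgue {0..t} (\<lambda>s. (Y / fact (Suc n)) * (of_nat (Suc n) * P s ^ n * p s))"
          using j by (rule set_integrable_mult_right)
        fix s assume s: "s \<in> {0..t}"
        have "p s * y s \<le> p s * (Y * P s ^ n / fact n)"
          using Suc.IH s t p(2) by (intro mult_left_mono) auto
        also have "\<dots> = (Y / fact (Suc n)) * (of_nat (Suc n) * P s ^ n * p s)"
          by (simp add: field_simps del: of_nat_Suc)
        finally show "p s * y s \<le> (Y / fact (Suc n)) * (of_nat (Suc n) * P s ^ n * p s)" .
      qed
      also have "\<dots> = Y * P t ^ Suc n / fact (Suc n)"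
        unfolding P' set_integral_mult_right by simp
      finally show "y t \<le> Y * P t ^ Suc n / fact (Suc n)" .
    qed
  qed
  then have "y x \<le> Y * (P x ^ n / fact n)" for n using x by simp
  moreover have "(\<lambda>n. Y * (P x ^ n / fact n)) \<longlonglongrightarrow> Y * 0"
    using summable_LIMSEQ_zero[OF summable_exp[of "P x"]]
    by (intro tendsto_intros) (simp add: field_simps)
  ultimately have "y x \<le> Y * 0" by (intro LIMSEQ_le_const) auto
  then show ?thesis using y(2)[OF x] by simp
qed

section \<open>Zeros of holomorphic functions in the upper half-plane\<close>

abbreviation upper :: "complex set" where "upper \<equiv> {w. Im w > 0}"

lemma open_upper: "open upper"
  by (simp add: open_halfspace_Im_gt)

section \<open>Blaschke factors and the division of zeros in the upper half-plane\<close>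

definition blaschke_factor :: "complex \<Rightarrow> complex \<Rightarrow> complex" where
  "blaschke_factor a w = (w - a) / (w - cnj a)"

lemma upper_diff_cnj: "Im a > 0 \<Longrightarrow> Im w > 0 \<Longrightarrow> w - cnj a \<noteq> 0"
  by (auto simp: complex_eq_iff)

text \<open>Exact form of the defect from 1. Its sign gives contractivity; its size at a fixed point
  is what later converts a product of factors into a sum of imaginary parts.\<close>

lemma norm_blaschke_factor_square:
  assumes "Im a > 0" "Im w > 0"
  shows "norm (blaschke_factor a w) ^ 2 = 1 - 4 * Im a * Im w / norm (w - cnj a) ^ 2"
proof -
  have "norm (w - a) ^ 2 = norm (w - cnj a) ^ 2 - 4 * Im a * Im w"
    by (simp only: cmod_power2) (simp add: power2_eq_square algebra_simps)
  moreover have "norm (w - cnj a) \<noteq> 0" using upper_diff_cnj assms by simp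
  ultimately show ?thesis
    unfolding blaschke_factor_def norm_divide power_divide by (simp add: diff_divide_distrib)
qed

lemma norm_blaschke_factor_less_1:
  assumes "Im a > 0" "Im w > 0" shows "norm (blaschke_factor a w) < 1"
proof -
  have "norm (blaschke_factor a w) ^ 2 < 1 ^ 2"
    unfolding norm_blaschke_factor_square[OF assms] using assms upper_diff_cnj[OF assms] by simp
  then show ?thesis by (rule power_less_imp_less_base) simp
qed

text \<open>The Schwarz lemma on the disc, pulled over by the Moebius map \<open>C\<close> that
  sends 0 to \<open>a\<close>; its inverse is \<open>blaschke_factor a\<close>.\<close>

lemma Schwarz_Pick_upper:
  assumes hol: "h holomorphic_on upper" and le: "\<And>w. Im w > 0 \<Longrightarrow> norm (h w) \<le> 1"
    and a: "Im a > 0" "h a = 0" and w: "Im w > 0"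
  shows "norm (h w) \<le> norm (blaschke_factor a w)"
proof (rule field_le_mult_one_interval)
  \<comment> \<open>The Schwarz lemma asks for a strict bound by 1, so \<open>h\<close> is first
    scaled by c < 1; c is arbitrary.\<close>
  fix c :: real assume c: "0 < c" "c < 1"
  define C where "C = (\<lambda>z. (a - cnj a * z) / (1 - z))"
  have CI: "Im (C z) > 0" if "z \<in> ball 0 1" for z
  proof -
    have nz: "1 - z \<noteq> 0" using that by auto
    have "C z = (a - cnj a * z) * cnj (1 - z) / of_real (norm (1 - z) ^ 2)"
      unfolding C_def by (subst complex_div_cnj) (simp only: of_real_power)
    then have "Im (C z) = Im ((a - cnj a * z) * cnj (1 - z)) / norm (1 - z) ^ 2"
      by (simp only: Im_divide_of_real)
    moreover have "Im ((a - cnj a * z) * cnj (1 - z)) = Im a * (1 - norm z ^ 2)"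
      unfolding cmod_power2 by (simp add: algebra_simps power2_eq_square)
    moreover have "norm z ^ 2 < 1" using that by (simp add: abs_square_less_1)
    ultimately show ?thesis using a nz by simp
  qed
  have Chol: "C holomorphic_on ball 0 1"
    unfolding C_def by (intro holomorphic_intros) auto
  define f where "f = (\<lambda>z. of_real c * h (C z))"
  have "f holomorphic_on ball 0 1"
    unfolding f_def using CI
    by (intro holomorphic_intros holomorphic_on_compose_gen[OF Chol hol, unfolded o_def]) auto
  moreover have "f 0 = 0" by (simp add: f_def C_def a)
  moreover have "norm (f z) < 1" if "norm z < 1" for z
  proof -
    have "norm (f z) \<le> c * 1" unfolding f_def norm_mult using c le[OF CI[of z]] that
      by (intro mult_mono) auto
    then show ?thesis using c by simp
  qed
  moreover have "norm (blaschke_factor a w) < 1" by (rule norm_blaschke_factor_less_1) fact+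
  ultimately have "norm (f (blaschke_factor a w)) \<le> norm (blaschke_factor a w)"
    by (rule Schwarz_Lemma(1))
  moreover have "C (blaschke_factor a w) = w"
  proof -
    have nz: "w - cnj a \<noteq> 0" "a - cnj a \<noteq> 0" using upper_diff_cnj a w by blast+
    have "1 - blaschke_factor a w = (a - cnj a) / (w - cnj a)"
      using nz(1) by (simp add: blaschke_factor_def field_simps)
    moreover have "a - cnj a * blaschke_factor a w = w * (a - cnj a) / (w - cnj a)"
      using nz(1) by (simp add: blaschke_factor_def field_simps)
    ultimately show ?thesis using nz by (simp add: C_def)
  qed
  ultimately show "c * norm (h w) \<le> norm (blaschke_factor a w)"
    using c by (simp add: f_def norm_mult)
qed

text \<open>The quotient has a removable singularity at \<open>a\<close>. Away from \<open>a\<close>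
  its bound by 1 is the Schwarz-Pick inequality, and at \<open>a\<close> the bound follows by
  continuity.\<close>

lemma Blaschke_factor_upper:
  assumes hol: "h holomorphic_on upper" and le: "\<And>w. Im w > 0 \<Longrightarrow> norm (h w) \<le> 1"
    and a: "Im a > 0" "h a = 0"
  obtains g where "g holomorphic_on upper" "\<And>w. Im w > 0 \<Longrightarrow> norm (g w) \<le> 1"
    "\<And>w. Im w > 0 \<Longrightarrow> h w = blaschke_factor a w * g w"
proof
  define g where "g = (\<lambda>w. (if w = a then deriv h a else (h w - h a) / (w - a)) * (w - cnj a))"
  show ghol: "g holomorphic_on upper"
    unfolding g_def using a interior_open[OF open_upper]
    by (intro holomorphic_intros pole_lemma hol) auto
  show eq: "h w = blaschke_factor a w * g w" if "Im w > 0" for w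
    using upper_diff_cnj[OF a(1) that] a by (simp add: blaschke_factor_def g_def)
  have ne: "norm (g w) \<le> 1" if w: "Im w > 0" "w \<noteq> a" for w
  proof -
    have "norm (blaschke_factor a w) > 0" using w upper_diff_cnj[OF a(1) w(1)] by (simp add: blaschke_factor_def)
    moreover have "norm (blaschke_factor a w) * norm (g w) \<le> norm (blaschke_factor a w)"
      using Schwarz_Pick_upper[OF hol le a w(1)] eq[OF w(1)] by (simp add: norm_mult)
    ultimately show ?thesis by simp
  qed
  show "norm (g w) \<le> 1" if w: "Im w > 0" for w
  proof (cases "w = a")
    case True
    have "isCont g a"
      using holomorphic_on_imp_continuous_on[OF ghol] a open_upper
      by (simp add: continuous_on_eq_continuous_at)
    then have "(\<lambda>z. norm (g z)) \<midarrow>a\<rightarrow> norm (g a)"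
      by (intro tendsto_norm) (simp add: isCont_def)
    moreover have "\<forall>\<^sub>F z in at a. norm (g z) \<le> 1"
      using eventually_at_in_open[OF open_upper, of a] a
      by (auto elim!: eventually_mono intro: ne)
    ultimately show ?thesis using True
      by (intro tendsto_upperbound[of _ _ "at a"]) auto
  qed (use ne w in auto)
qed

lemma bigo_vanish:
  assumes "isCont h a" "h \<in> O[at a](\<lambda>w. (w - a) ^ Suc m)"
  shows "h (a::complex) = (0::complex)"
proof -
  have "((\<lambda>w. (w - a) ^ Suc m / 1) \<longlongrightarrow> 0) (at a)" by (auto intro!: tendsto_eq_intros)
  then have "(\<lambda>w. (w - a) ^ Suc m) \<in> o[at a](\<lambda>w. 1)" by (intro smalloI_tendsto) auto
  then have "h \<in> o[at a](\<lambda>w. 1)" by (rule landau_o.big_small_trans[OF assms(2)])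
  then have "h \<midarrow>a\<rightarrow> 0" using smalloD_tendsto by fastforce
  then show ?thesis using assms(1) LIM_unique by (auto simp: isCont_def)
qed

text \<open>A zero of order at least \<open>n a\<close> is expressed by a Landau symbol: this makes
  sense also if \<open>h\<close> vanishes identically, and it passes easily through products and
  changes of variable. One factor is divided out at a time, by induction on the total
  multiplicity.\<close>

lemma Blaschke_bound_upper:
  assumes "h holomorphic_on upper" "\<And>w. Im w > 0 \<Longrightarrow> norm (h w) \<le> 1"
    and A: "finite A" "A \<subseteq> upper" and "\<And>a. a \<in> A \<Longrightarrow> h \<in> O[at a](\<lambda>w. (w - a) ^ n a)"
    and w: "Im w > 0"
  shows "norm (h w) \<le> (\<Prod>a\<in>A. norm (blaschke_factor a w) ^ n a)"
  using assms(1,2,5)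
proof (induction "\<Sum>a\<in>A. n a" arbitrary: h n)
  case 0
  then have "n a = 0" if "a \<in> A" for a using A that by simp
  then show ?case using 0 w by simp
next
  case (Suc N)
  then have "\<exists>a\<in>A. n a \<noteq> 0" using A by (metis sum.neutral Zero_not_Suc)
  then obtain a m where a: "a \<in> A" "n a = Suc m" using not0_implies_Suc by blast
  have Ia: "Im a > 0" using a A by auto
  have "isCont h a"
    using holomorphic_on_imp_continuous_on[OF Suc.prems(1)] Ia open_upper
    by (simp add: continuous_on_eq_continuous_at)
  then have ha: "h a = 0" using bigo_vanish Suc.prems(3)[OF a(1)] a(2) by metis
  obtain g where g: "g holomorphic_on upper" "\<And>w. Im w > 0 \<Longrightarrow> norm (g w) \<le> 1"
    "\<And>w. Im w > 0 \<Longrightarrow> h w = blaschke_factor a w * g w"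
    using Blaschke_factor_upper[OF Suc.prems(1,2) Ia ha] by blast
  define n' where "n' = n(a := m)"
  \<comment> \<open>The quotient is recovered from \<open>h\<close> only off \<open>a\<close>, which
    is enough because Landau symbols at \<open>b\<close> ignore the point itself when
    \<open>b = a\<close>.\<close>
  have geq: "\<forall>\<^sub>F w in at b. h w * ((w - cnj a) / (w - a)) = g w" if b: "b \<in> A" for b
  proof -
    have "\<forall>\<^sub>F w in at b. w \<in> upper \<and> w \<noteq> b" "\<forall>\<^sub>F w in at b. w \<noteq> a"
      using eventually_at_in_open[OF open_upper, of b] b A eventually_neq_at_within[of a b UNIV] by auto
    then show ?thesis
    proof eventually_elim
      case (elim w)
      then show ?case using g(3)[of w] upper_diff_cnj[OF Ia, of w] by (simp add: blaschke_factor_def)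
    qed
  qed
  \<comment> \<open>At \<open>a\<close> the factor 1/(w - a) lowers the order by one; at any other
    point of \<open>A\<close> the divided factor has a bounded inverse and the order is
    kept.\<close>
  have gO: "g \<in> O[at b](\<lambda>w. (w - b) ^ n' b)" if b: "b \<in> A" for b
  proof (cases "b = a")
    case True
    have 1: "(\<lambda>w. w - cnj a) \<in> O[at a](\<lambda>w. 1)"
      by (rule bigoI_tendsto[where c="a - cnj a"]) (auto intro!: tendsto_eq_intros)
    have "(\<lambda>w. h w * ((w - cnj a) / (w - a))) \<in> O[at a](\<lambda>w. (w - a) ^ Suc m * (1 / (w - a)))"
      using Suc.prems(3)[OF a(1)] a(2) 1
      by (intro landau_o.big.mult landau_o.big.divide_right) (auto simp: eventually_at_filter)
    also have "(\<lambda>w. (w - a) ^ Suc m * (1 / (w - a))) \<in> \<Theta>[at a](\<lambda>w. (w - a) ^ m)"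
      by (intro bigthetaI_cong) (auto simp: eventually_at_filter)
    finally show ?thesis using landau_o.big.in_cong[OF geq[OF b]] True by (simp add: n'_def)
  next
    case False
    have 1: "(\<lambda>w. (w - cnj a) / (w - a)) \<in> O[at b](\<lambda>w. 1)"
      by (rule bigoI_tendsto[where c="(b - cnj a) / (b - a)"]) (use False in \<open>auto intro!: tendsto_eq_intros\<close>)
    have "(\<lambda>w. h w * ((w - cnj a) / (w - a))) \<in> O[at b](\<lambda>w. (w - b) ^ n b * 1)"
      by (intro landau_o.big.mult Suc.prems(3) b 1)
    then show ?thesis using landau_o.big.in_cong[OF geq[OF b]] False by (simp add: n'_def)
  qed
  have "sum n A = n a + sum n (A - {a})" "sum n' A = n' a + sum n' (A - {a})"
    using A a by (simp_all add: sum.remove)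
  moreover have "sum n' (A - {a}) = sum n (A - {a})" by (intro sum.cong) (auto simp: n'_def)
  ultimately have N: "N = sum n' A" using Suc.hyps(2) a by (simp add: n'_def)
  have "norm (g w) \<le> (\<Prod>a\<in>A. norm (blaschke_factor a w) ^ n' a)"
    by (rule Suc.hyps(1)[OF N g(1,2) gO])
  also have "\<dots> = norm (blaschke_factor a w) ^ m * (\<Prod>a\<in>A - {a}. norm (blaschke_factor a w) ^ n' a)"
    using A a by (simp add: prod.remove n'_def)
  also have "(\<Prod>a\<in>A - {a}. norm (blaschke_factor a w) ^ n' a) = (\<Prod>a\<in>A - {a}. norm (blaschke_factor a w) ^ n a)"
    by (intro prod.cong) (auto simp: n'_def)
  finally have "norm (blaschke_factor a w) * norm (g w) \<le> norm (blaschke_factor a w) * (norm (blaschke_factor a w) ^ m * (\<Prod>a\<in>A - {a}. norm (blaschke_factor a w) ^ n a))"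
    by (intro mult_left_mono) auto
  also have "\<dots> = (\<Prod>a\<in>A. norm (blaschke_factor a w) ^ n a)"
    using A a by (simp add: prod.remove)
  finally show ?case using g(3)[OF w] by (simp add: norm_mult)
qed

text \<open>The Joukowski map takes the part of the upper half-plane outside the disc of radius d onto
  the whole upper half-plane; joukowski_inv is its inverse there.\<close>

definition joukowski :: "real \<Rightarrow> complex \<Rightarrow> complex" where
  "joukowski d w = w + of_real (d\<^sup>2) / w"

definition joukowski_inv :: "real \<Rightarrow> complex \<Rightarrow> complex" where
  "joukowski_inv d z = (z + \<i> * csqrt (of_real (4 * d\<^sup>2) - z\<^sup>2)) / 2"

lemma Im_joukowski: "Im (joukowski d w) = Im w * (1 - (d / norm w)\<^sup>2)"
  by (simp add: joukowski_def Im_divide cmod_power2 power_divide right_diff_distrib)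

lemma Im_joukowski_pos:
  assumes "Im w > 0" "norm w > d" "d > 0" shows "Im (joukowski d w) > 0"
proof -
  have "d / norm w < 1" "d / norm w \<ge> 0" using assms by (auto simp: divide_less_eq)
  then have "(d / norm w)\<^sup>2 < 1" by (simp add: power_less_one_iff)
  then show ?thesis using assms(1) by (simp add: Im_joukowski)
qed

text \<open>Two points with the same image are equal or have product d^2, and the second is
  impossible when both moduli exceed d.\<close>

lemma joukowski_inj:
  assumes "norm w > d" "norm v > d" "d \<ge> 0" "joukowski d w = joukowski d v" shows "w = v"
proof (rule ccontr)
  assume ne: "w \<noteq> v"
  have nz: "w \<noteq> 0" "v \<noteq> 0" using assms by auto
  have "(w - v) * (w * v - of_real (d\<^sup>2)) = 0"
    using assms(4) nz by (simp add: joukowski_def field_simps power2_eq_square)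
  then have "w * v = of_real (d\<^sup>2)" using ne by simp
  then have "norm w * norm v = d\<^sup>2" by (metis norm_mult norm_of_real abs_of_nonneg zero_le_power2)
  moreover have "norm w * norm v > d * d" using assms by (intro mult_strict_mono) auto
  ultimately show False by (simp add: power2_eq_square)
qed

lemma Re_csqrt_pos:
  assumes "w \<notin> \<real>\<^sub>\<le>\<^sub>0" shows "Re (csqrt w) > 0"
proof -
  have "Re (csqrt w) \<noteq> 0"
  proof
    assume "Re (csqrt w) = 0"
    then have "(csqrt w)\<^sup>2 \<in> \<real>\<^sub>\<le>\<^sub>0" by (simp add: complex_nonpos_Reals_iff power2_eq_square del: power2_csqrt)
    then show False using assms by simp
  qed
  then show ?thesis using csqrt_principal[of w] by linarith
qed

text \<open>The preimages of z are the roots of w^2 - z w + d^2 = 0, whose product is d^2. Taking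
  the root of 4 d^2 - z^2 rather than of z^2 - 4 d^2 keeps the principal branch off its cut for Im z
  > 0, and its positive real part, multiplied by i, selects the root in the upper half-plane. That
  this root lies outside the disc is then forced by \<open>Im_joukowski\<close>.\<close>

lemma
  assumes d: "d > 0" and z: "Im z > 0"
  shows csqrt_arg_notin: "of_real (4 * d\<^sup>2) - z\<^sup>2 \<notin> \<real>\<^sub>\<le>\<^sub>0"
    and Im_joukowski_inv: "Im (joukowski_inv d z) > 0"
    and joukowski_joukowski_inv: "joukowski d (joukowski_inv d z) = z"
    and norm_joukowski_inv: "norm (joukowski_inv d z) > d"
proof -
  define s where "s = csqrt (of_real (4 * d\<^sup>2) - z\<^sup>2)"
  show n: "of_real (4 * d\<^sup>2) - z\<^sup>2 \<notin> \<real>\<^sub>\<le>\<^sub>0"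
  proof
    assume "of_real (4 * d\<^sup>2) - z\<^sup>2 \<in> \<real>\<^sub>\<le>\<^sub>0"
    then have "Im (z\<^sup>2) = 0" "Re (z\<^sup>2) \<ge> 4 * d\<^sup>2" by (auto simp: complex_nonpos_Reals_iff)
    then have "Re z = 0" "(Re z)\<^sup>2 - (Im z)\<^sup>2 \<ge> 4 * d\<^sup>2" using z by (auto simp: power2_eq_square)
    moreover have "(Im z)\<^sup>2 > 0" "d\<^sup>2 > 0" using z d by simp_all
    ultimately show False by simp
  qed
  have s2: "s\<^sup>2 = of_real (4 * d\<^sup>2) - z\<^sup>2" by (simp add: s_def)
  have "Re s > 0" unfolding s_def by (rule Re_csqrt_pos[OF n])
  then show I: "Im (joukowski_inv d z) > 0" unfolding joukowski_inv_def s_def[symmetric] using z by simp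
  then have nz: "joukowski_inv d z \<noteq> 0" by auto
  have T: "joukowski_inv d z = (z + \<i> * s) / 2" by (simp only: joukowski_inv_def s_def)
  have "joukowski_inv d z * ((z - \<i> * s) / 2) = of_real (d\<^sup>2)"
    unfolding T using s2 by (simp add: field_simps power2_eq_square)
  then have "of_real (d\<^sup>2) / joukowski_inv d z = (z - \<i> * s) / 2" using nz by (simp add: field_simps)
  then show J: "joukowski d (joukowski_inv d z) = z" unfolding joukowski_def
    by (simp add: T field_simps)
  show "norm (joukowski_inv d z) > d"
  proof (rule ccontr)
    assume "\<not> norm (joukowski_inv d z) > d"
    then have "d / norm (joukowski_inv d z) \<ge> 1" using nz by (simp add: field_simps)
    then have "Im (joukowski_inv d z) * (1 - (d / norm (joukowski_inv d z))\<^sup>2) \<le> 0"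
      using I by (simp add: mult_le_0_iff)
    then show False using z J Im_joukowski[of d "joukowski_inv d z"] by simp
  qed
qed

lemma joukowski_inv_joukowski:
  assumes "Im a > 0" "norm a > d" "d > 0" shows "joukowski_inv d (joukowski d a) = a"
  using joukowski_inj[of d "joukowski_inv d (joukowski d a)" a] norm_joukowski_inv[OF assms(3) Im_joukowski_pos[OF assms]] joukowski_joukowski_inv[OF assms(3) Im_joukowski_pos[OF assms]] assms
  by simp

lemma joukowski_inv_holomorphic: "d > 0 \<Longrightarrow> joukowski_inv d holomorphic_on upper"
  unfolding joukowski_inv_def using csqrt_arg_notin by (intro holomorphic_intros) auto

section \<open>A harmonic majorant of 1/|w| outside a small disc\<close>

text \<open>For u of argument p in the right half-plane, |u| times the real part of (ln u + c)/u is
  (ln |u| + c) cos p + p sin p. The term p sin p compensates for the loss of cos p near the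
  imaginary axis; on [0, pi/2] the derivative t cos t is nonnegative.\<close>

lemma cos_plus_x_sin_ge_1:
  assumes "\<bar>x\<bar> \<le> pi / 2" shows "cos x + x * sin x \<ge> (1::real)"
proof -
  have *: "cos y + y * sin y \<ge> 1" if y: "0 \<le> y" "y \<le> pi/2" for y :: real
  proof -
    have "cos 0 + 0 * sin 0 \<le> cos y + y * sin y"
    proof (rule DERIV_nonneg_imp_nondecreasing[OF y(1), of "\<lambda>y. cos y + y * sin y"])
      fix t assume t: "0 \<le> t" "t \<le> y"
      have "((\<lambda>y. cos y + y * sin y) has_real_derivative t * cos t) (at t)"
        by (auto intro!: derivative_eq_intros)
      moreover have "t * cos t \<ge> 0" using t y by (intro mult_nonneg_nonneg cos_ge_zero) auto
      ultimately show "\<exists>D. ((\<lambda>y. cos y + y * sin y) has_real_derivative D) (at t) \<and> 0 \<le> D" by blast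
    qed
    then show ?thesis by simp
  qed
  show ?thesis using *[of "\<bar>x\<bar>"] assms by (cases "x \<ge> 0") auto
qed

text \<open>With w = i u this is (ln u + c) / u, whose real part dominates 1/|w| wherever |w| is at least d,
  while it is only of size ln (1/d) at points of modulus of order 1. Here i/w alone would not do:
  its real part vanishes on the real axis.\<close>

definition Phi :: "real \<Rightarrow> complex \<Rightarrow> complex" where
  "Phi d w = (\<i> / w) * (Ln (- \<i> * w) + of_real (ln (1 / d) + 1))"

lemma Phi_holomorphic: "Phi d holomorphic_on upper"
  unfolding Phi_def
  by (intro holomorphic_intros) (auto simp: complex_nonpos_Reals_iff)

lemma Re_Phi:
  assumes d: "d > 0" and w: "Im w > 0" "norm w \<ge> d"
  shows "Re (Phi d w) \<ge> 1 / norm w"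
proof -
  define u where "u = - \<i> * w"
  have u: "Re u > 0" "u \<noteq> 0" "norm u = norm w" using w by (auto simp: u_def norm_mult)
  define p where "p = Im (Ln u)"
  have p: "\<bar>p\<bar> < pi / 2" unfolding p_def using u Re_Ln_pos_lt by blast
  have ue: "u = of_real (norm u) * (cos p + \<i> * sin p)"
  proof -
    have "u = of_real (exp (Re (Ln u))) * cis p"
      using exp_eq_polar[of "Ln u"] u(2) by (simp add: p_def)
    also have "exp (Re (Ln u)) = norm u" using u(2) by simp
    finally show ?thesis by (simp add: complex_eq_iff)
  qed
  have iw: "\<i> / w = 1 / u" using u(2) by (simp add: u_def divide_simps)
  have iu: "1 / u = (cos p - \<i> * sin p) / of_real (norm u)"
  proof -
    have "(cos p + \<i> * sin p) * (cos p - \<i> * sin p) = of_real ((sin p)\<^sup>2 + (cos p)\<^sup>2)"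
      by (simp add: algebra_simps power2_eq_square del: sin_cos_squared_add sin_cos_squared_add2 sin_cos_squared_add3)
    then have "(cos p + \<i> * sin p) * (cos p - \<i> * sin p) = 1" by (simp only: sin_cos_squared_add of_real_1)
    then have "u * ((cos p - \<i> * sin p) / of_real (norm u)) = 1"
      using u(2) by (subst ue) simp
    then show ?thesis using u by (simp add: field_simps)
  qed
  have ln: "Ln u = of_real (ln (norm u)) + \<i> * p"
    using u by (simp add: complex_eq_iff p_def)
  \<comment> \<open>This is ln(|w|/d) + 1, so the hypothesis |w| >= d is exactly what makes it at
    least 1.\<close>
  define c where "c = ln (norm u) + (ln (1 / d) + 1)"
  have c: "c \<ge> 1" using d u(3) ln_mono[OF w(2) d] by (simp add: c_def ln_div)
  have "Phi d w = (cos p - \<i> * sin p) * (of_real c + \<i> * p) / of_real (norm u)"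
    unfolding Phi_def u_def[symmetric] iw iu ln by (simp add: c_def add_ac)
  then have "Re (Phi d w) = (c * cos p + p * sin p) / norm u"
    by (simp add: Re_divide_of_real algebra_simps)
  moreover have "cos p \<ge> 0" using p by (intro cos_ge_zero) auto
  then have "c * cos p + p * sin p \<ge> 1"
    using cos_plus_x_sin_ge_1[of p] p mult_right_mono[OF c, of "cos p"] by linarith
  ultimately show ?thesis using u by (simp add: divide_right_mono)
qed


section \<open>Zeros outside a disc\<close>

text \<open>Differentiability of the inverse map bounds its increment linearly, so the order of a
  zero is not lowered. The left inverse property of \<open>joukowski\<close> keeps the inverse map
  from hitting \<open>a\<close> at nearby points other than the image of \<open>a\<close>.\<close>

lemma bigo_compose_joukowski_inv:
  assumes d: "d > 0" and F: "F \<in> O[at a](\<lambda>w. (w - a) ^ n)" and a: "Im a > 0" "norm a > d"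
  shows "(\<lambda>z. F (joukowski_inv d z)) \<in> O[at (joukowski d a)](\<lambda>z. (z - joukowski d a) ^ n)"
proof -
  have IJ: "Im (joukowski d a) > 0"
    using Im_joukowski_pos a d by blast
  have TJ: "joukowski_inv d (joukowski d a) = a" using joukowski_inv_joukowski a d by blast
  have cont: "isCont (joukowski_inv d) (joukowski d a)"
    using holomorphic_on_imp_continuous_on[OF joukowski_inv_holomorphic[OF d]] IJ open_upper
    by (simp add: continuous_on_eq_continuous_at)
  have ev: "\<forall>\<^sub>F z in at (joukowski d a). Im z > 0 \<and> z \<noteq> joukowski d a"
    using eventually_at_in_open[OF open_upper, of "joukowski d a"] IJ by simp
  have "filterlim (joukowski_inv d) (at a) (at (joukowski d a))"
    unfolding filterlim_at
  proof
    show "\<forall>\<^sub>F z in at (joukowski d a). joukowski_inv d z \<in> UNIV \<and> joukowski_inv d z \<noteq> a"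
      using ev by eventually_elim (use joukowski_joukowski_inv[OF d] in auto)
    show "joukowski_inv d \<midarrow>joukowski d a\<rightarrow> a" using cont TJ by (simp add: isCont_def)
  qed
  from landau_o.big.compose[OF F this]
  have 1: "(\<lambda>z. F (joukowski_inv d z)) \<in> O[at (joukowski d a)](\<lambda>z. (joukowski_inv d z - a) ^ n)" .
  have "joukowski_inv d field_differentiable at (joukowski d a)"
    using joukowski_inv_holomorphic[OF d] IJ open_upper holomorphic_on_imp_differentiable_at by blast
  then obtain D where "((\<lambda>z. (joukowski_inv d z - a) / (z - joukowski d a)) \<longlongrightarrow> D) (at (joukowski d a))"
    unfolding field_differentiable_def has_field_derivative_iff TJ by blast
  then have "(\<lambda>z. joukowski_inv d z - a) \<in> O[at (joukowski d a)](\<lambda>z. z - joukowski d a)"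
    by (rule bigoI_tendsto) (auto simp: eventually_at_filter)
  then have "(\<lambda>z. (joukowski_inv d z - a) ^ n) \<in> O[at (joukowski d a)](\<lambda>z. (z - joukowski d a) ^ n)"
    by (rule landau_o.big_power)
  with 1 show ?thesis by (rule landau_o.big_trans)
qed

text \<open>A zero forces 2 <= exp(1/|a|), that is |a| <= 1/ln 2, and ln 2 >= 2/3. All zeros thus
  lie in a fixed disc, on which the Blaschke factors can be estimated uniformly.\<close>

lemma exp_minus_1_zero_bound:
  assumes "norm (F - 1) \<le> exp (1 / norm a) - 1" "F = (0::complex)" "a \<noteq> (0::complex)"
  shows "norm a \<le> 3 / 2"
proof -
  have "2 \<le> exp (1 / norm a)" using assms by simp
  then have "ln 2 \<le> 1 / norm a" by (metis ln_exp ln_le_cancel_iff exp_gt_zero zero_less_numeral)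
  then have "2 / 3 \<le> 1 / norm a" using ln2_ge_two_thirds by linarith
  then show ?thesis using assms by (simp add: field_simps)
qed

lemma ln_3_le: "ln (3::real) \<le> 2"
proof -
  have "ln (1 + (2::real)) \<le> 2" by (intro ln_add_one_self_le_self) simp
  then show ?thesis by simp
qed

text \<open>This makes 3i a usable base point: there |F - 1| <= exp(1/3) - 1 <= 1/2. The bound
  follows from e <= 3 <= 27/8.\<close>

lemma exp_third_le: "exp (1 / 3 :: real) \<le> 3 / 2"
proof (rule power_le_imp_le_base[of _ 2])
  have "exp (1 / 3 :: real) ^ Suc 2 = exp 1" by (simp flip: exp_of_nat_mult)
  then show "exp (1 / 3 :: real) ^ Suc 2 \<le> (3 / 2) ^ Suc 2" using exp_le by (simp add: power_divide)
qed simp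

text \<open>A Jensen-type comparison at the image \<open>z0\<close> of 3i: each zero shrinks |G(z0)|
  by a factor exp(-Im a / 8), while |G(z0)| is at least a constant times a power of d.\<close>

lemma zeros_outside_disc:
  assumes hol: "F holomorphic_on upper" and le: "\<And>w. Im w > 0 \<Longrightarrow> norm (F w - 1) \<le> exp (1 / norm w) - 1"
    and A: "finite A" "A \<subseteq> upper" "\<And>a. a \<in> A \<Longrightarrow> F a = 0"
      "\<And>a. a \<in> A \<Longrightarrow> F \<in> O[at a](\<lambda>w. (w - a) ^ n a)"
    and d: "0 < d" "d \<le> 1" and far: "\<And>a. a \<in> A \<Longrightarrow> norm a \<ge> 2 * d"
  shows "(\<Sum>a\<in>A. real (n a) * Im a) \<le> 24 + 8 * ln (1 / d)"
proof -
  define G where "G = (\<lambda>z. F (joukowski_inv d z) * exp (- Phi d (joukowski_inv d z)))"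
  define z0 where "z0 = joukowski d (3 * \<i>)"
  have TI: "joukowski_inv d ` upper \<subseteq> upper" using Im_joukowski_inv[OF d(1)] by auto
  have E: "(\<lambda>z. exp (- Phi d (joukowski_inv d z))) holomorphic_on upper"
    using holomorphic_on_compose_gen[OF joukowski_inv_holomorphic[OF d(1)] Phi_holomorphic TI, of d, unfolded o_def]
    by (intro holomorphic_intros)
  have Ghol: "G holomorphic_on upper"
    unfolding G_def using holomorphic_on_compose_gen[OF joukowski_inv_holomorphic[OF d(1)] hol TI, unfolded o_def] E
    by (rule holomorphic_on_mult)
  have Gle: "norm (G z) \<le> 1" if z: "Im z > 0" for z
  proof -
    define w where "w = joukowski_inv d z"
    have w: "Im w > 0" "norm w \<ge> d" unfolding w_def using Im_joukowski_inv norm_joukowski_inv d z less_imp_le by blast+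
    have "norm (F w) \<le> norm (F w - 1) + norm (1::complex)" by (metis norm_triangle_ineq diff_add_cancel)
    then have "norm (F w) \<le> exp (1 / norm w)" using le[OF w(1)] by simp
    also have "\<dots> \<le> exp (Re (Phi d w))" using Re_Phi[OF d(1) w] by simp
    finally have "norm (F w) * exp (- Re (Phi d w)) \<le> exp (Re (Phi d w)) * exp (- Re (Phi d w))"
      by (intro mult_right_mono) auto
    also have "\<dots> = 1" by (simp flip: exp_add)
    finally show ?thesis by (simp add: G_def w_def norm_mult)
  qed
  have aD: "Im a > 0" "norm a > d" "norm a \<le> 3 / 2" "Im (joukowski d a) \<ge> 3 / 4 * Im a" "norm (joukowski d a) \<le> 2" if a: "a \<in> A" for a
  proof -
    show I: "Im a > 0" using A a by auto
    show D: "norm a > d" using far[OF a] d by simp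
    show N: "norm a \<le> 3 / 2" using exp_minus_1_zero_bound[OF le[OF I] A(3)[OF a]] d D norm_not_less_zero[of a] by (metis less_asym norm_zero)
    have "norm a > 0" using D d by linarith
    \<comment> \<open>The gap between the radii d and 2d is spent here: it ensures that the
      Joukowski map keeps at least 3/4 of the imaginary part of each zero.\<close>
    then have q: "d / norm a \<le> 1 / 2" using far[OF a] by (simp add: divide_le_eq)
    then have "(d / norm a)\<^sup>2 \<le> (1 / 2)\<^sup>2" using d by (intro power_mono) auto
    then have "Im a * (1 - (d / norm a)\<^sup>2) \<ge> Im a * (3 / 4)" using I by (intro mult_left_mono) (auto simp: power_divide)
    then show "Im (joukowski d a) \<ge> 3 / 4 * Im a" by (simp add: Im_joukowski)
    have "norm (joukowski d a) \<le> norm a + d\<^sup>2 / norm a" unfolding joukowski_def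
      by (rule order_trans[OF norm_triangle_ineq]) (simp add: norm_divide norm_power)
    also have "d\<^sup>2 / norm a = d * (d / norm a)" by (simp add: power2_eq_square)
    also have "\<dots> \<le> 1 * (1 / 2)" using q d by (intro mult_mono) auto
    finally show "norm (joukowski d a) \<le> 2" using N by simp
  qed
  have inj: "inj_on (joukowski d) A"
    by (rule inj_onI, rule joukowski_inj[of d]) (use aD(2) d in auto)
  have TJ: "joukowski_inv d (joukowski d a) = a" if "Im a > 0" "norm a > d" for a using joukowski_inv_joukowski that d by blast
  have Iz0: "Im z0 \<ge> 8 / 3"
    using d by (simp add: z0_def Im_joukowski norm_mult power_divide) (simp add: power_le_one)
  have nz0: "norm z0 \<le> 10 / 3"
  proof -
    have "norm z0 \<le> 3 + d\<^sup>2 / 3" unfolding z0_def joukowski_def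
      by (rule order_trans[OF norm_triangle_ineq]) (simp add: norm_divide norm_power norm_mult)
    moreover have "d\<^sup>2 \<le> 1" using d by (simp add: power_le_one)
    ultimately show ?thesis by simp
  qed
  have Tz0: "joukowski_inv d z0 = 3 * \<i>" unfolding z0_def using d by (intro TJ) (auto simp: norm_mult)
  \<comment> \<open>The distance of z0 from the conjugate of the image of a is at most 10/3 + 2 =
    16/3, with square at most 32, and 4 * (3/4 Im a) * (8/3) = 8 Im a. The defect of the squared
    modulus is therefore at least Im a / 4, which a square root halves.\<close>
  have factor: "norm (blaschke_factor (joukowski d a) z0) \<le> exp (- (Im a / 8))" if a: "a \<in> A" for a
  proof (rule power_le_imp_le_base[of _ 1])
    have IJ: "Im (joukowski d a) > 0" "Im z0 > 0" using aD[OF a] Iz0 by auto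
    have "norm (z0 - cnj (joukowski d a)) \<le> norm z0 + norm (joukowski d a)"
      using norm_triangle_ineq4[of z0 "cnj (joukowski d a)"] by simp
    then have "norm (z0 - cnj (joukowski d a)) \<le> 16 / 3" using nz0 aD[OF a] by simp
    then have n2: "norm (z0 - cnj (joukowski d a)) ^ 2 \<le> (16 / 3)\<^sup>2" by (intro power_mono) auto
    have "Im (joukowski d a) * Im z0 \<ge> (3 / 4 * Im a) * (8 / 3)"
      using aD[OF a] Iz0 by (intro mult_mono) auto
    then have "Im a * 8 \<le> 4 * Im (joukowski d a) * Im z0" by (simp add: mult.commute)
    moreover have "Im a * norm (z0 - cnj (joukowski d a)) ^ 2 \<le> Im a * 32"
      using n2 aD[OF a] by (intro mult_left_mono) (auto simp: power_divide)
    ultimately have "Im a / 4 \<le> 4 * Im (joukowski d a) * Im z0 / norm (z0 - cnj (joukowski d a)) ^ 2"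
      using upper_diff_cnj[OF IJ] by (simp add: field_simps)
    then have "norm (blaschke_factor (joukowski d a) z0) ^ 2 \<le> 1 + (- (Im a / 4))"
      unfolding norm_blaschke_factor_square[OF IJ] by simp
    also have "\<dots> \<le> exp (- (Im a / 4))" by (rule exp_ge_add_one_self)
    also have "\<dots> = exp (- (Im a / 8)) ^ 2" by (simp flip: exp_of_nat_mult)
    finally show "norm (blaschke_factor (joukowski d a) z0) ^ Suc 1 \<le> exp (- (Im a / 8)) ^ Suc 1" by (simp add: numeral_2_eq_2)
  qed simp
  have "norm (G z0) \<le> (\<Prod>b\<in>joukowski d ` A. norm (blaschke_factor b z0) ^ n (joukowski_inv d b))"
  proof (rule Blaschke_bound_upper[OF Ghol Gle])
    show "joukowski d ` A \<subseteq> upper" using aD by force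
    fix b assume "b \<in> joukowski d ` A"
    then obtain a where a: "a \<in> A" "b = joukowski d a" by auto
    have "isCont (\<lambda>z. exp (- Phi d (joukowski_inv d z))) b"
      using holomorphic_on_imp_continuous_on[OF E] open_upper aD[OF a(1)] a(2)
      by (simp add: continuous_on_eq_continuous_at)
    then have "(\<lambda>z. exp (- Phi d (joukowski_inv d z))) \<in> O[at b](\<lambda>z. 1)"
      by (intro bigoI_tendsto[where c="exp (- Phi d (joukowski_inv d b))"]) (auto simp: isCont_def)
    from landau_o.big.mult[OF bigo_compose_joukowski_inv[OF d(1) A(4)[OF a(1)] aD(1,2)[OF a(1)], folded a(2)] this]
    show "G \<in> O[at b](\<lambda>z. (z - b) ^ n (joukowski_inv d b))"
      unfolding G_def a(2) TJ[OF aD(1,2)[OF a(1)]] by simp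
  qed (use A Iz0 in auto)
  also have "\<dots> = (\<Prod>a\<in>A. norm (blaschke_factor (joukowski d a) z0) ^ n a)"
    by (subst prod.reindex[OF inj]) (auto intro!: prod.cong simp: TJ aD)
  also have "\<dots> \<le> (\<Prod>a\<in>A. exp (- (Im a / 8)) ^ n a)"
    by (intro prod_mono conjI power_mono factor) auto
  also have "\<dots> = exp (- (\<Sum>a\<in>A. real (n a) * Im a) / 8)"
    by (simp add: exp_sum A sum_divide_distrib flip: exp_of_nat_mult sum_negf)
  finally have up: "norm (G z0) \<le> exp (- (\<Sum>a\<in>A. real (n a) * Im a) / 8)" .
  have "norm (1::complex) \<le> norm (F (3 * \<i>)) + norm (1 - F (3 * \<i>))"
    by (metis norm_triangle_ineq add.commute diff_add_cancel)
  \<comment> \<open>Lower bound for |G(z0)|: F is at least 1/2 in modulus at 3i, and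
    \<open>Phi\<close> is real there.\<close>
  then have "norm (F (3 * \<i>)) \<ge> 1 / 2"
    using le[of "3 * \<i>"] exp_third_le by (simp add: norm_minus_commute norm_mult)
  moreover have "Re (Phi d (3 * \<i>)) = (ln 3 + (ln (1 / d) + 1)) / 3"
  proof -
    have "- \<i> * (3 * \<i>) = of_real 3" by (simp add: complex_eq_iff)
    then have "Phi d (3 * \<i>) = of_real ((ln 3 + (ln (1 / d) + 1)) / 3)"
      unfolding Phi_def by (simp only: Ln_of_real[of 3]) (simp add: Ln_of_real)
    then show ?thesis by (simp only: Re_complex_of_real)
  qed
  ultimately have "1 / 2 * exp (- ((ln 3 + (ln (1 / d) + 1)) / 3)) \<le> norm (G z0)"
    unfolding G_def Tz0 norm_mult norm_exp_eq_Re by (intro mult_mono) auto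
  moreover have "1 / 2 * exp (- ((ln 3 + (ln (1 / d) + 1)) / 3)) = exp (- ln 2 - (ln 3 + (ln (1 / d) + 1)) / 3)"
    using exp_add[of "- ln 2 :: real" "- ((ln 3 + (ln (1 / d) + 1)) / 3)"] by (simp add: exp_minus)
  ultimately have "exp (- ln 2 - (ln 3 + (ln (1 / d) + 1)) / 3) \<le> norm (G z0)" by simp
  then have "exp (- ln 2 - (ln 3 + (ln (1 / d) + 1)) / 3) \<le> exp (- (\<Sum>a\<in>A. real (n a) * Im a) / 8)"
    using up by (rule order_trans)
  \<comment> \<open>Multiplying by 8 and using ln 2 <= 1 and ln 3 <= 2 gives 16 + (8/3) ln(1/d),
    within the generous bound claimed.\<close>
  then have "- ln 2 - (ln 3 + (ln (1 / d) + 1)) / 3 \<le> - (\<Sum>a\<in>A. real (n a) * Im a) / 8"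
    by (simp only: exp_le_cancel_iff)
  moreover have "ln 2 \<le> (1::real)" using ln_add_one_self_le_self[of "1::real"] by simp
  moreover have "ln (1 / d) \<ge> 0" using d by (intro ln_ge_zero) simp
  ultimately show ?thesis using ln_3_le by (simp add: field_simps)
qed


section \<open>Summation over dyadic shells\<close>

text \<open>\<open>A\<close> is any finite family of zeros and \<open>n\<close> any lower bound for
  their orders, so the same estimate serves for a single zero and for a whole spectrum. As
  \<open>n a\<close> may be 0, the vanishing of F at \<open>a\<close>, which confines
  \<open>a\<close> to a disc, is a separate clause.\<close>

definition zero_config :: "real \<Rightarrow> (complex \<Rightarrow> complex) \<Rightarrow> complex set \<Rightarrow> (complex \<Rightarrow> nat) \<Rightarrow> bool" where
  "zero_config Q F A n \<longleftrightarrow> Q > 0 \<and> F holomorphic_on upper \<and>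
     (\<forall>w. Im w > 0 \<longrightarrow> norm (F w - 1) \<le> exp (Q / norm w) - 1) \<and>
     finite A \<and> A \<subseteq> upper \<and> (\<forall>a\<in>A. F a = 0 \<and> F \<in> O[at a](\<lambda>w. (w - a) ^ n a))"

lemma zeros_weighted_sum:
  assumes eps: "\<epsilon> > 0"
  shows "\<exists>K>0. \<forall>Q F A n. zero_config Q F A n \<longrightarrow>
     (\<Sum>a\<in>A. real (n a) * Im a * norm a powr \<epsilon>) \<le> K * Q powr (1 + \<epsilon>)"
proof -
  \<comment> \<open>Shell j has |a| <= 2 * 2^(-j); with d = 2^(-j-1) and ln 2 <= 1 the bound 24 + 8
    ln(1/d) becomes at most 32 + 8 j.\<close>
  define c :: "nat \<Rightarrow> real" where "c = (\<lambda>j. (2 * (1 / 2) ^ j) powr \<epsilon> * (32 + 8 * real j))"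
  define r :: real where "r = (1 / 2) powr \<epsilon>"
  have r: "0 < r" "r < 1" unfolding r_def using eps powr_less_mono2[of \<epsilon> "1/2" 1] by auto
  have c_eq: "c j = 2 powr \<epsilon> * (32 * r ^ j + 8 * (real j * r ^ j))" for j
  proof -
    have "((1 / 2 :: real) ^ j) powr \<epsilon> = r ^ j"
      unfolding r_def by (simp add: powr_powr mult.commute flip: powr_realpow)
    then show ?thesis unfolding c_def by (simp add: powr_mult algebra_simps)
  qed
  \<comment> \<open>The termwise derivative of the geometric series has coefficients j + 1;
    subtracting the series itself leaves j.\<close>
  have sr: "summable (\<lambda>j. real j * r ^ j)"
  proof -
    have "summable (\<lambda>j. diffs (\<lambda>_. 1) j * r ^ j)"
      by (rule termdiff_converges[of _ 1]) (use r in \<open>auto intro: summable_geometric\<close>)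
    then have "summable (\<lambda>j. real (Suc j) * r ^ j - r ^ j)"
      using r by (intro summable_diff) (auto simp: diffs_def intro: summable_geometric)
    then show ?thesis by (simp add: algebra_simps)
  qed
  have sc: "summable c"
    unfolding c_eq[abs_def] using r by (intro summable_mult summable_add sr summable_geometric) auto
  have c0: "c j > 0" for j unfolding c_def by (intro mult_pos_pos) auto
  define K where "K = suminf c"
  have K: "K > 0" unfolding K_def using sc c0 by (intro suminf_pos)
  have unit: "(\<Sum>a\<in>A. real (n a) * Im a * norm a powr \<epsilon>) \<le> K"
    if hol: "F holomorphic_on upper" and le: "\<And>w. Im w > 0 \<Longrightarrow> norm (F w - 1) \<le> exp (1 / norm w) - 1"
    and A: "finite A" "A \<subseteq> upper" "\<And>a. a \<in> A \<Longrightarrow> F a = 0"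
      "\<And>a. a \<in> A \<Longrightarrow> F \<in> O[at a](\<lambda>w. (w - a) ^ n a)" for F A and n :: "complex \<Rightarrow> nat"
  proof -
    \<comment> \<open>The index of the shell containing a. Minimality gives |a| < 2 * 2^(-s) for s >
      0; shell 0 has no predecessor, and there |a| <= 3/2 replaces it.\<close>
    define s where "s = (\<lambda>a::complex. LEAST j. (1 / 2) ^ j \<le> norm a)"
    have s: "(1 / 2) ^ s a \<le> norm a" "norm a \<le> 2 * (1 / 2) ^ s a" if a: "a \<in> A" for a
    proof -
      have I: "Im a > 0" using A a by auto
      then have a0: "norm a > 0" by auto
      then obtain j where "(1 / 2) ^ j < norm a" using real_arch_pow_inv[of "norm a" "1 / 2"] by auto
      then have "(1 / 2) ^ j \<le> norm a" by simp
      then show "(1 / 2) ^ s a \<le> norm a" unfolding s_def by (rule LeastI)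
      show "norm a \<le> 2 * (1 / 2) ^ s a"
      proof (cases "s a")
        case 0
        then show ?thesis using exp_minus_1_zero_bound[OF le[OF I] A(3)[OF a]] a0 by auto
      next
        case (Suc j)
        then have "\<not> (1 / 2) ^ j \<le> norm a" unfolding s_def using not_less_Least[of j] by (metis lessI)
        then show ?thesis by (simp add: Suc)
      qed
    qed
    have shell: "(\<Sum>a | a \<in> A \<and> s a = j. real (n a) * Im a * norm a powr \<epsilon>) \<le> c j" for j
    proof -
      let ?B = "{a. a \<in> A \<and> s a = j}"
      let ?d = "(1 / 2) ^ Suc j :: real"
      have "ln (1 / ?d) = real (Suc j) * ln 2"
        by (simp add: power_divide ln_realpow flip: power_Suc del: power_Suc)
      also have "\<dots> \<le> real (Suc j) * 1"
        using ln_add_one_self_le_self[of "1::real"] by (intro mult_left_mono) auto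
      finally have ld: "ln (1 / ?d) \<le> real j + 1" by simp
      have "(\<Sum>a\<in>?B. real (n a) * Im a) \<le> 24 + 8 * ln (1 / ?d)"
        by (rule zeros_outside_disc[OF hol le]) (use A s(1) power_le_one[of "1 / 2 :: real" "Suc j"] in auto)
      also have "\<dots> \<le> 32 + 8 * real j" using ld by simp
      finally have 1: "(\<Sum>a\<in>?B. real (n a) * Im a) \<le> 32 + 8 * real j" .
      have "(\<Sum>a\<in>?B. real (n a) * Im a * norm a powr \<epsilon>) \<le> (\<Sum>a\<in>?B. real (n a) * Im a * (2 * (1 / 2) ^ j) powr \<epsilon>)"
        using A s(2) eps by (intro sum_mono mult_left_mono powr_mono2) auto
      also have "\<dots> = (2 * (1 / 2) ^ j) powr \<epsilon> * (\<Sum>a\<in>?B. real (n a) * Im a)"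
        by (simp add: sum_distrib_left mult_ac)
      also have "\<dots> \<le> c j" unfolding c_def using 1 by (intro mult_left_mono) auto
      finally show ?thesis .
    qed
    have "(\<Sum>a\<in>A. real (n a) * Im a * norm a powr \<epsilon>) = (\<Sum>j\<in>s ` A. \<Sum>a | a \<in> A \<and> s a = j. real (n a) * Im a * norm a powr \<epsilon>)"
      using A(1) by (intro sum.image_gen)
    also have "\<dots> \<le> (\<Sum>j\<in>s ` A. c j)" by (intro sum_mono shell)
    also have "\<dots> \<le> K" unfolding K_def using A(1) c0 less_imp_le by (intro sum_le_suminf sc) blast+
    finally show ?thesis .
  qed
  show ?thesis
  proof (intro exI[of _ K] conjI K allI impI)
    fix F :: "complex \<Rightarrow> complex" and A and n :: "complex \<Rightarrow> nat" and Q :: real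
    assume "zero_config Q F A n"
    then have Q: "Q > 0" and hol: "F holomorphic_on upper"
      and le: "\<And>w. Im w > 0 \<Longrightarrow> norm (F w - 1) \<le> exp (Q / norm w) - 1"
      and A: "finite A" "A \<subseteq> upper" "\<And>a. a \<in> A \<Longrightarrow> F a = 0"
        "\<And>a. a \<in> A \<Longrightarrow> F \<in> O[at a](\<lambda>w. (w - a) ^ n a)"
      unfolding zero_config_def by auto
    \<comment> \<open>Replacing F by F(Q w) normalises the exponent to 1/|w| and divides the zeros
      by Q.\<close>
    define q where "q = complex_of_real Q"
    have q: "q \<noteq> 0" using Q by (simp add: q_def)
    have Iq: "Im (q * w) = Q * Im w" for w by (simp add: q_def)
    have inj: "inj_on (\<lambda>a. a / q) A" using q by (auto simp: inj_on_def)
    have "(\<Sum>b\<in>(\<lambda>a. a / q) ` A. real (n (q * b)) * Im b * norm b powr \<epsilon>) \<le> K"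
    proof (rule unit[where F = "\<lambda>w. F (q * w)"])
      have "(\<lambda>w. q * w) ` upper \<subseteq> upper" unfolding image_subset_iff mem_Collect_eq Iq using Q by simp
      then show "(\<lambda>w. F (q * w)) holomorphic_on upper"
        using holomorphic_on_compose_gen[OF _ hol, of "\<lambda>w. q * w" upper]
        by (auto simp: o_def intro: holomorphic_intros)
      show "norm (F (q * w) - 1) \<le> exp (1 / norm w) - 1" if "Im w > 0" for w
        using le[of "q * w"] that Q by (simp add: Iq norm_mult) (simp add: q_def)
      show "(\<lambda>a. a / q) ` A \<subseteq> upper" using A(2) Q by (auto simp: q_def Im_divide_of_real)
      fix b assume "b \<in> (\<lambda>a. a / q) ` A"
      then obtain a where a12: "a \<in> A" "b = a / q" by blast
      moreover have "a = q * b" unfolding a12(2) using q by simp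
      ultimately have a: "a \<in> A" "b = a / q" "a = q * b" by blast+
      show "F (q * b) = 0" using A(3)[OF a(1)] a(3) by metis
      have "filterlim (\<lambda>w. q * w) (at a) (at b)"
        unfolding filterlim_at a(3)
        by (intro conjI tendsto_intros) (use q in \<open>auto simp: eventually_at_filter\<close>)
      from landau_o.big.compose[OF A(4)[OF a(1)] this]
      have "(\<lambda>w. F (q * w)) \<in> O[at b](\<lambda>w. (q * w - a) ^ n a)" .
      also have "(\<lambda>w. (q * w - a) ^ n a) = (\<lambda>w. q ^ n a * (w - b) ^ n a)"
        by (simp add: a(3) flip: power_mult_distrib right_diff_distrib)
      finally show "(\<lambda>w. F (q * w)) \<in> O[at b](\<lambda>w. (w - b) ^ n (q * b))"
        using q a(3) by simp
    qed (use A in auto)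
    also have "(\<Sum>b\<in>(\<lambda>a. a / q) ` A. real (n (q * b)) * Im b * norm b powr \<epsilon>)
       = (\<Sum>a\<in>A. real (n a) * Im a * norm a powr \<epsilon> / Q powr (1 + \<epsilon>))"
    proof (subst sum.reindex[OF inj], rule sum.cong[OF refl])
      fix a assume "a \<in> A"
      show "((\<lambda>b. real (n (q * b)) * Im b * norm b powr \<epsilon>) \<circ> (\<lambda>a. a / q)) a = real (n a) * Im a * norm a powr \<epsilon> / Q powr (1 + \<epsilon>)"
        using q Q by (simp add: q_def Im_divide_of_real norm_divide powr_divide powr_add)
    qed
    also have "\<dots> = (\<Sum>a\<in>A. real (n a) * Im a * norm a powr \<epsilon>) / Q powr (1 + \<epsilon>)"
      by (rule sum_divide_distrib[symmetric])
    finally show "(\<Sum>a\<in>A. real (n a) * Im a * norm a powr \<epsilon>) \<le> K * Q powr (1 + \<epsilon>)"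
      using Q by (simp add: divide_le_eq)
  qed
qed

section \<open>Parameter and tail integrals\<close>

text \<open>Cauchy's inequality on discs of radius r/2 bounds the derivative in the parameter by 2 G
  / r, hence also the difference quotients, and dominated convergence moves the limit under the
  integral. No domination of the derivative has to be assumed.\<close>

lemma holomorphic_on_integral:
  fixes f :: "complex \<Rightarrow> 'a \<Rightarrow> complex"
  assumes S: "open S"
    and hol: "\<And>t. t \<in> space M \<Longrightarrow> (\<lambda>k. f k t) holomorphic_on S"
    and meas: "\<And>k. k \<in> S \<Longrightarrow> f k \<in> borel_measurable M"
    and dom: "\<And>k. k \<in> S \<Longrightarrow> \<exists>r>0. \<exists>G. cball k r \<subseteq> S \<and> integrable M G \<and> (\<forall>z\<in>cball k r. \<forall>t\<in>space M. norm (f z t) \<le> G t)"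
  shows "(\<lambda>k. LINT t|M. f k t) holomorphic_on S"
proof -
  have int: "integrable M (f k)" if kS: "k \<in> S" for k
  proof -
    obtain r G where r: "r > 0" "integrable M G" and G: "\<forall>z\<in>cball k r. \<forall>t\<in>space M. norm (f z t) \<le> G t"
      using dom[OF kS] by blast
    have "norm (f k t) \<le> norm (G t)" if "t \<in> space M" for t
      using G that r(1) order_trans[OF _ abs_ge_self] by (metis centre_in_cball less_imp_le real_norm_def)
    then show ?thesis
      by (intro Bochner_Integration.integrable_bound[OF r(2) meas[OF kS]] AE_I2)
  qed
  have "(\<lambda>k. LINT t|M. f k t) field_differentiable at k" if k: "k \<in> S" for k
  proof -
    obtain r G where r: "r > 0" "cball k r \<subseteq> S" and G: "integrable M G" "\<And>z t. z \<in> cball k r \<Longrightarrow> t \<in> space M \<Longrightarrow> norm (f z t) \<le> G t"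
      using dom[OF k] by blast
    define D where "D = (\<lambda>t. deriv (\<lambda>z. f z t) k)"
    have quot: "norm ((f z t - f k t) / (z - k)) \<le> 2 / r * G t" if z: "z \<in> ball k (r / 2)" "z \<noteq> k" and t: "t \<in> space M" for z t
    proof -
      have d: "norm (deriv (\<lambda>z. f z t) w) \<le> 2 / r * G t" if w: "w \<in> ball k (r / 2)" for w
      proof -
        have sub: "cball w (r / 2) \<subseteq> cball k r"
          using w by (simp add: cball_subset_cball_iff dist_commute)
        then have h: "(\<lambda>z. f z t) holomorphic_on cball w (r / 2)"
          using holomorphic_on_subset[OF hol[OF t]] r by blast
        have "norm ((deriv ^^ 1) (\<lambda>z. f z t) w) \<le> fact 1 * G t / (r / 2) ^ 1"
        proof (rule Cauchy_inequality)
          show "(\<lambda>z. f z t) holomorphic_on ball w (r / 2)" using h ball_subset_cball holomorphic_on_subset by blast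
          show "continuous_on (cball w (r / 2)) (\<lambda>z. f z t)" using h by (rule holomorphic_on_imp_continuous_on)
          show "norm (f x t) \<le> G t" if "norm (w - x) = r / 2" for x
            using G(2)[of x t] t sub that by (auto simp: dist_norm)
        qed (use r in auto)
        then show ?thesis by (simp add: field_simps)
      qed
      have der: "((\<lambda>z. f z t) has_field_derivative deriv (\<lambda>z. f z t) w) (at w within ball k (r / 2))" if w: "w \<in> ball k (r / 2)" for w
      proof -
        have "w \<in> S" using w r by (auto simp: subset_eq dist_norm)
        then show ?thesis using hol[OF t] S holomorphic_derivI by blast
      qed
      have "norm (f z t - f k t) \<le> 2 / r * G t * norm (z - k)"
        by (rule field_differentiable_bound[OF convex_ball der d]) (use z r in auto)
      then show ?thesis using z by (simp add: norm_divide divide_le_eq)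
    qed
    have lim: "((\<lambda>z. (f z t - f k t) / (z - k)) \<longlongrightarrow> D t) (at k)" if "t \<in> space M" for t
      using holomorphic_derivI[OF hol[OF that] S k] by (simp add: D_def has_field_derivative_iff)
    have "((\<lambda>z. ((LINT t|M. f z t) - (LINT t|M. f k t)) / (z - k)) \<longlongrightarrow> (LINT t|M. D t)) (at k)"
      unfolding tendsto_at_iff_sequentially
    proof (intro allI impI)
      fix X assume X: "\<forall>i. X i \<in> UNIV - {k}" "X \<longlonglongrightarrow> k"
      have "\<forall>\<^sub>F i in sequentially. X i \<in> ball k (r / 2)"
        using tendstoD[OF X(2), of "r / 2"] r by (simp add: dist_commute)
      then obtain N where N: "\<And>i. i \<ge> N \<Longrightarrow> X i \<in> ball k (r / 2)" unfolding eventually_sequentially by blast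
      \<comment> \<open>Initial terms are dropped, so that the domination of the quotients holds
        along the entire sequence.\<close>
      define Y where "Y = (\<lambda>i. X (i + N))"
      have Y: "Y i \<in> ball k (r / 2)" "Y i \<noteq> k" "Y i \<in> S" for i
        using N[of "i + N"] X r by (auto simp: Y_def subset_eq)
      have Yk: "Y \<longlonglongrightarrow> k" unfolding Y_def by (rule LIMSEQ_ignore_initial_segment[OF X(2)])
      have pt: "(\<lambda>i. (f (Y i) t - f k t) / (Y i - k)) \<longlonglongrightarrow> D t" if "t \<in> space M" for t
        using lim[OF that] Y(2) Yk unfolding tendsto_at_iff_sequentially o_def by auto
      have m: "(\<lambda>t. (f (Y i) t - f k t) / (Y i - k)) \<in> borel_measurable M" for i
        using meas[OF Y(3)[of i]] meas[OF k] by measurable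
      have "(\<lambda>i. LINT t|M. (f (Y i) t - f k t) / (Y i - k)) \<longlonglongrightarrow> (LINT t|M. D t)"
      proof (rule integral_dominated_convergence[where w="\<lambda>t. 2 / r * G t"])
        \<comment> \<open>Measurability of the derivative in t comes from its being a pointwise
          limit of measurable quotients.\<close>
        show "D \<in> borel_measurable M" by (rule borel_measurable_LIMSEQ_metric[OF m pt])
      qed (use m pt quot Y G in auto)
      then have "(\<lambda>i. ((LINT t|M. f (Y i) t) - (LINT t|M. f k t)) / (Y i - k)) \<longlonglongrightarrow> (LINT t|M. D t)"
        using int[OF Y(3)] int[OF k] by simp
      then have "(\<lambda>i. ((LINT t|M. f (X (i + N)) t) - (LINT t|M. f k t)) / (X (i + N) - k)) \<longlonglongrightarrow> (LINT t|M. D t)"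
        by (simp add: Y_def)
      then show "((\<lambda>z. ((LINT t|M. f z t) - (LINT t|M. f k t)) / (z - k)) \<circ> X) \<longlonglongrightarrow> (LINT t|M. D t)"
        unfolding o_def by (rule LIMSEQ_offset)
    qed
    then show ?thesis unfolding field_differentiable_def has_field_derivative_iff by blast
  qed
  then show ?thesis using S by (simp add: holomorphic_on_open field_differentiable_def)
qed

section \<open>Integrals over the half-lines [x,oo)\<close>

definition tail_int :: "(real \<Rightarrow> 'a::{banach,second_countable_topology}) \<Rightarrow> real \<Rightarrow> 'a" where
  "tail_int g x = (LINT t:{x..}|lebesgue. g t)"

lemma integrable_tail:
  fixes g :: "real \<Rightarrow> 'a::{banach,second_countable_topology}"
  assumes "integrable lebesgue g" shows "integrable lebesgue (\<lambda>t. indicat_real {x..} t *\<^sub>R g t)"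
  using assms by (intro integrable_mult_indicator) auto

lemma tail_int_split:
  assumes g: "integrable lebesgue g" and xy: "x \<le> y"
  shows "tail_int g x = (LINT t:{x..y}|lebesgue. g t) + tail_int g y"
proof -
  have i: "integrable lebesgue (\<lambda>t. indicat_real A t *\<^sub>R g t)" if "A \<in> sets lebesgue" for A
    using that g by (intro integrable_mult_indicator) auto
  have "tail_int g x = (LINT t|lebesgue. indicat_real {x..y} t *\<^sub>R g t + indicat_real {y..} t *\<^sub>R g t)"
    unfolding tail_int_def set_lebesgue_integral_def
  proof (rule integral_cong_AE)
    show "AE t in lebesgue. indicat_real {x..} t *\<^sub>R g t = indicat_real {x..y} t *\<^sub>R g t + indicat_real {y..} t *\<^sub>R g t"
      using AE_lebesgue_neq[of y] by eventually_elim (use xy in \<open>auto simp: indicator_def\<close>)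
  qed (use i in \<open>auto intro!: borel_measurable_integrable\<close>)
  then show ?thesis by (simp add: tail_int_def set_lebesgue_integral_def i)
qed

lemma ac_deriv_tail_int:
  fixes g :: "real \<Rightarrow> 'a::{real_normed_field,euclidean_space}"
  assumes g: "integrable lebesgue g" shows "ac_deriv (tail_int g) (\<lambda>t. - g t)"
  unfolding ac_deriv_def
proof (intro allI impI conjI)
  fix x :: real assume x: "x \<ge> 0"
  show "set_integrable lebesgue {0..x} (\<lambda>t. - g t)"
    using g unfolding set_integrable_def by (intro integrable_mult_indicator) auto
  show "tail_int g x = tail_int g 0 + (LINT t:{0..x}|lebesgue. - g t)"
    using tail_int_split[OF g x] by (simp add: set_lebesgue_integral_def)
qed

lemma tail_int_continuous:
  assumes g: "integrable lebesgue g" shows "continuous_on UNIV (tail_int g)"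
proof -
  have "(\<lambda>n. tail_int g (X n)) \<longlonglongrightarrow> tail_int g x" if X: "X \<longlonglongrightarrow> x" for X x
    unfolding tail_int_def set_lebesgue_integral_def
  proof (rule integral_dominated_convergence[where w="\<lambda>t. norm (g t)"])
    show "AE t in lebesgue. (\<lambda>n. indicat_real {X n..} t *\<^sub>R g t) \<longlonglongrightarrow> indicat_real {x..} t *\<^sub>R g t"
      using AE_lebesgue_neq[of x]
    proof eventually_elim
      case (elim t)
      have "\<forall>\<^sub>F n in sequentially. indicat_real {X n..} t = indicat_real {x..} t"
      proof (cases "t < x")
        case True then show ?thesis using order_tendstoD(1)[OF X True] by (auto elim!: eventually_mono simp: indicator_def)
      next
        case False
        then have "x < t" using elim by simp
        then show ?thesis using order_tendstoD(2)[OF X \<open>x < t\<close>] by (auto elim!: eventually_mono simp: indicator_def)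
      qed
      then show ?case by (intro tendsto_scaleR tendsto_const tendsto_eventually)
    qed
  qed (use g borel_measurable_integrable[OF integrable_tail[OF g]] in \<open>auto simp: indicator_scaleR_eq_if\<close>)
  then show ?thesis by (simp add: continuous_on_eq_continuous_at continuous_at_sequentially o_def)
qed

lemma tail_int_tendsto_0:
  assumes g: "integrable lebesgue g" shows "(\<lambda>n. tail_int g (real n)) \<longlonglongrightarrow> 0"
proof -
  have "(\<lambda>n. LINT t|lebesgue. indicat_real {real n..} t *\<^sub>R g t) \<longlonglongrightarrow> (LINT t|lebesgue. (0::real) *\<^sub>R g t)"
  proof (rule integral_dominated_convergence[where w="\<lambda>t. norm (g t)"])
    show "AE t in lebesgue. (\<lambda>n. indicat_real {real n..} t *\<^sub>R g t) \<longlonglongrightarrow> (0::real) *\<^sub>R g t"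
    proof (intro AE_I2 tendsto_scaleR tendsto_const tendsto_eventually)
      fix t :: real
      obtain N where "t < real N" using reals_Archimedean2 by blast
      then have "indicat_real {real n..} t = 0" if "n \<ge> N" for n
        using that by (simp add: indicator_def)
      then show "\<forall>\<^sub>F n in sequentially. indicat_real {real n..} t = 0" unfolding eventually_sequentially by blast
    qed
  qed (use g borel_measurable_integrable[OF integrable_tail[OF g]] in \<open>auto simp: indicator_scaleR_eq_if\<close>)
  then show ?thesis by (simp add: tail_int_def set_lebesgue_integral_def)
qed

lemma norm_tail_int_le:
  assumes "integrable lebesgue g" "integrable lebesgue G" "\<And>t. t \<ge> x \<Longrightarrow> norm (g t) \<le> G t"
  shows "norm (tail_int g x) \<le> tail_int G x"
proof -
  have "norm (tail_int g x) \<le> (LINT t|lebesgue. norm (indicat_real {x..} t *\<^sub>R g t))"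
    unfolding tail_int_def set_lebesgue_integral_def by (rule integral_norm_bound)
  also have "\<dots> \<le> (LINT t|lebesgue. indicat_real {x..} t *\<^sub>R G t)"
    by (intro Bochner_Integration.integral_mono integrable_norm integrable_tail assms)
       (auto simp: indicator_def intro: assms(3))
  finally show ?thesis by (simp add: tail_int_def set_lebesgue_integral_def)
qed

lemma ac_deriv_zero_const: "ac_deriv F (\<lambda>x. 0) \<Longrightarrow> x \<ge> 0 \<Longrightarrow> F x = F 0"
  using ac_deriv_eq[of F "\<lambda>x. 0" x] by simp

lemma integrable_mult_bounded:
  fixes F g :: "real \<Rightarrow> 'a::{real_normed_field,euclidean_space}"
  assumes "integrable lebesgue g" "F \<in> borel_measurable lebesgue" "\<And>t. g t \<noteq> 0 \<Longrightarrow> norm (F t) \<le> B"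
  shows "integrable lebesgue (\<lambda>t. F t * g t)"
proof (rule Bochner_Integration.integrable_bound[of _ "\<lambda>t. B * norm (g t)"])
  show "AE t in lebesgue. norm (F t * g t) \<le> norm (B * norm (g t))"
  proof (intro AE_I2)
    fix t show "norm (F t * g t) \<le> norm (B * norm (g t))"
    proof (cases "g t = 0")
      case False
      then have "norm (F t) * norm (g t) \<le> B * norm (g t)" using assms(3) by (intro mult_right_mono) auto
      then show ?thesis by (simp add: norm_mult)
    qed simp
  qed
qed (use assms in auto)

lemma continuous_measurable_lebesgue: "continuous_on UNIV F \<Longrightarrow> F \<in> borel_measurable lebesgue"
  by (intro measurable_completion) (simp add: borel_measurable_continuous_onI)

text \<open>The tail to the power n + 1 and n + 1 times the left-hand tail integral have the same
  density, so their difference is constant, and both vanish at infinity. This identity produces the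
  factorials in the Neumann series.\<close>

lemma tail_int_power:
  fixes g :: "real \<Rightarrow> real"
  assumes g: "integrable lebesgue g" and x: "x \<ge> 0"
  shows "tail_int (\<lambda>t. tail_int g t ^ n * g t) x = tail_int g x ^ Suc n / real (Suc n)"
    and "integrable lebesgue (\<lambda>t. tail_int g t ^ n * g t)"
proof -
  have bd: "norm (tail_int g t) \<le> (LINT t|lebesgue. norm (g t))" for t
  proof -
    have "norm (tail_int g t) \<le> tail_int (\<lambda>t. norm (g t)) t" by (rule norm_tail_int_le) (use g in auto)
    also have "\<dots> \<le> (LINT t|lebesgue. norm (g t))"
      unfolding tail_int_def set_lebesgue_integral_def
      by (rule Bochner_Integration.integral_mono[OF integrable_tail]) (use g in \<open>auto simp: indicator_def\<close>)
    finally show ?thesis .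
  qed
  show i: "integrable lebesgue (\<lambda>t. tail_int g t ^ n * g t)"
  proof (rule integrable_mult_bounded[OF g])
    show "(\<lambda>t. tail_int g t ^ n) \<in> borel_measurable lebesgue"
      by (intro continuous_measurable_lebesgue continuous_intros tail_int_continuous g)
    show "norm (tail_int g t ^ n) \<le> (LINT t|lebesgue. norm (g t)) ^ n" for t
      unfolding norm_power by (intro power_mono bd) auto
  qed
  have "ac_deriv (\<lambda>x. tail_int g x ^ Suc n - real (Suc n) * tail_int (\<lambda>t. tail_int g t ^ n * g t) x) (\<lambda>x. 0)"
    by (rule ac_deriv_cong[OF ac_deriv_diff[OF ac_deriv_power[OF ac_deriv_tail_int[OF g], of "Suc n"] ac_deriv_cmult[OF ac_deriv_tail_int[OF i], of "real (Suc n)"]]])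
       (auto simp del: of_nat_Suc)
  then have c: "tail_int g x ^ Suc n - real (Suc n) * tail_int (\<lambda>t. tail_int g t ^ n * g t) x
     = tail_int g 0 ^ Suc n - real (Suc n) * tail_int (\<lambda>t. tail_int g t ^ n * g t) 0" if "x \<ge> 0" for x
    using ac_deriv_zero_const that by blast
  have "(\<lambda>j. tail_int g (real j) ^ Suc n - real (Suc n) * tail_int (\<lambda>t. tail_int g t ^ n * g t) (real j)) \<longlonglongrightarrow> 0 ^ Suc n - real (Suc n) * 0"
    by (intro tendsto_intros tail_int_tendsto_0 g i)
  then have "tail_int g 0 ^ Suc n - real (Suc n) * tail_int (\<lambda>t. tail_int g t ^ n * g t) 0 = 0"
    unfolding c[OF of_nat_0_le_iff] by (simp add: LIMSEQ_const_iff)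
  then show "tail_int (\<lambda>t. tail_int g t ^ n * g t) x = tail_int g x ^ Suc n / real (Suc n)"
    using c[OF x] by (simp add: field_simps)
qed

section \<open>The Jost solution\<close>

lemma tail_int_cmult: "tail_int (\<lambda>t. c * g t) x = c * tail_int g x"
  for c :: "'a::{real_normed_field,euclidean_space}"
  by (simp add: tail_int_def)

lemma tail_int_add_diff:
  fixes g h :: "real \<Rightarrow> 'a::{banach,second_countable_topology}"
  assumes "integrable lebesgue g" "integrable lebesgue h"
  shows "tail_int (\<lambda>t. g t + h t) x = tail_int g x + tail_int h x"
    and "tail_int (\<lambda>t. g t - h t) x = tail_int g x - tail_int h x"
  using integrable_tail[OF assms(1)] integrable_tail[OF assms(2)]
  by (simp_all add: tail_int_def set_lebesgue_integral_def scaleR_add_right scaleR_diff_right)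

text \<open>Extension by zero lets the integrals over the half-line be taken over the whole line,
  without restrictions on the measure.\<close>

locale half_line_potential =
  fixes q :: "real \<Rightarrow> complex"
  assumes q_int: "integrable lebesgue q" and q_zero: "t \<le> 0 \<Longrightarrow> q t = 0"
begin

definition q_tail :: "real \<Rightarrow> real" where "q_tail = tail_int (\<lambda>t. norm (q t))"

lemma qn_int: "integrable lebesgue (\<lambda>t. norm (q t))" using q_int by simp

lemma q_tail_nonneg: "q_tail x \<ge> 0"
  unfolding q_tail_def tail_int_def set_lebesgue_integral_def by (intro integral_nonneg_AE) auto

lemma q_tail_le: "q_tail x \<le> q_tail 0"
proof -
  have "(LINT t|lebesgue. indicat_real {x..} t *\<^sub>R norm (q t)) \<le> (LINT t|lebesgue. indicat_real {0..} t *\<^sub>R norm (q t))"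
  proof (intro Bochner_Integration.integral_mono integrable_tail qn_int)
    fix t show "indicat_real {x..} t *\<^sub>R norm (q t) \<le> indicat_real {0..} t *\<^sub>R norm (q t)"
      using q_zero[of t] by (auto simp: indicator_def)
  qed
  then show ?thesis by (simp add: q_tail_def tail_int_def set_lebesgue_integral_def)
qed

definition pwave :: "complex \<Rightarrow> real \<Rightarrow> complex" where "pwave k x = exp (\<i> * k * of_real x)"

lemma pwave_add: "pwave k (x + y) = pwave k x * pwave k y" by (simp add: pwave_def distrib_left exp_add)
lemma pwave_nz: "pwave k x \<noteq> 0" by (simp add: pwave_def)
lemma pwave_minus: "pwave k (- x) = 1 / pwave k x" by (simp add: pwave_def exp_minus field_simps)
lemma norm_pwave: "norm (pwave k x) = exp (- Im k * x)" by (simp add: pwave_def)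
lemma pwave_cont: "continuous_on UNIV (pwave k)" unfolding pwave_def by (intro continuous_intros)
lemma pwave_cont': "continuous_on A (\<lambda>x. pwave k (- x))" unfolding pwave_def by (intro continuous_intros)
lemma pwave_0: "pwave k 0 = 1" by (simp add: pwave_def)

text \<open>The terms of the Neumann series of m(x) = 1 + 1/(2ik) * (integral of (exp (2ik(t-x)) - 1) q(t) m(t) over t > x),
  the Volterra equation for m(x) = exp(-ikx) psi(x). The kernel is split so that x enters only
  through smooth factors and the endpoints of tail integrals.\<close>

fun jost_term :: "complex \<Rightarrow> nat \<Rightarrow> real \<Rightarrow> complex" where
  "jost_term k 0 x = 1"
| "jost_term k (Suc n) x = (pwave k (- x) ^ 2 * tail_int (\<lambda>t. (pwave k t ^ 2 * jost_term k n t) * q t) x - tail_int (\<lambda>t. jost_term k n t * q t) x) / (2 * \<i> * k)"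

lemma norm_pwave_le_1: "Im k \<ge> 0 \<Longrightarrow> x \<ge> 0 \<Longrightarrow> norm (pwave k x) \<le> 1"
  by (simp add: norm_pwave)

lemma q_weight_integrable:
  assumes k: "Im k > 0" and c: "m \<in> borel_measurable lebesgue" and B: "\<And>x. x \<ge> 0 \<Longrightarrow> norm (m x) \<le> B"
  shows "integrable lebesgue (\<lambda>t. m t * q t)" "integrable lebesgue (\<lambda>t. (pwave k t ^ 2 * m t) * q t)"
proof -
  have pos: "t > 0" if "q t \<noteq> 0" for t using q_zero[of t] that by linarith
  show "integrable lebesgue (\<lambda>t. m t * q t)"
    by (rule integrable_mult_bounded[OF q_int c, of B]) (use pos B less_imp_le in blast)
  show "integrable lebesgue (\<lambda>t. (pwave k t ^ 2 * m t) * q t)"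
  proof (rule integrable_mult_bounded[OF q_int, of _ B])
    show "(\<lambda>t. pwave k t ^ 2 * m t) \<in> borel_measurable lebesgue"
      using c continuous_measurable_lebesgue[OF pwave_cont[of k]] by measurable
    fix t assume "q t \<noteq> 0"
    then have t: "t \<ge> 0" using pos[of t] by simp
    have "norm (pwave k t ^ 2) * norm (m t) \<le> 1 * B"
      unfolding norm_power using norm_pwave_le_1[of k t] k t B[OF t] by (intro mult_mono power_le_one) auto
    then show "norm (pwave k t ^ 2 * m t) \<le> B" by (simp add: norm_mult)
  qed
qed

text \<open>The factor \<open>pwave k (- x) ^ 2\<close> grows with x and cannot be estimated alone.
  Merged with \<open>pwave k t ^ 2\<close> it gives the kernel exp(2ik(t - x)) - 1, of modulus at
  most 2 for t >= x; this 2 cancels the one in the denominator 2ik.\<close>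

lemma Volterra_bound:
  assumes k: "Im k > 0" and c: "m \<in> borel_measurable lebesgue" and B: "\<And>x. x \<ge> 0 \<Longrightarrow> norm (m x) \<le> B"
    and G: "integrable lebesgue (\<lambda>t. G t * norm (q t))" "\<And>t. t \<ge> 0 \<Longrightarrow> norm (m t) \<le> G t" and x: "x \<ge> 0"
  shows "norm ((pwave k (- x) ^ 2 * tail_int (\<lambda>t. (pwave k t ^ 2 * m t) * q t) x - tail_int (\<lambda>t. m t * q t) x) / (2 * \<i> * k))
    \<le> tail_int (\<lambda>t. G t * norm (q t)) x / norm k"
proof -
  note i = q_weight_integrable[OF k c B]
  have "pwave k (- x) ^ 2 * tail_int (\<lambda>t. (pwave k t ^ 2 * m t) * q t) x - tail_int (\<lambda>t. m t * q t) x
    = tail_int (\<lambda>t. pwave k (- x) ^ 2 * ((pwave k t ^ 2 * m t) * q t) - m t * q t) x"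
    using i by (subst tail_int_add_diff) (auto simp: tail_int_cmult)
  also have "norm \<dots> \<le> tail_int (\<lambda>t. 2 * (G t * norm (q t))) x"
  proof (rule norm_tail_int_le)
    fix t assume t: "x \<le> t"
    have eq: "pwave k (- x) ^ 2 * ((pwave k t ^ 2 * m t) * q t) - m t * q t = (pwave k (t - x) ^ 2 - 1) * (m t * q t)"
      using pwave_add[of k t "- x"] by (simp add: algebra_simps power_mult_distrib)
    have "norm (pwave k (t - x) ^ 2 - 1) \<le> norm (pwave k (t - x) ^ 2) + norm (1::complex)" by (rule norm_triangle_ineq4)
    also have "\<dots> \<le> 1 + 1" unfolding norm_power using norm_pwave_le_1[of k "t - x"] k t by (intro add_mono power_le_one) auto
    finally have "norm (pwave k (t - x) ^ 2 - 1) * (norm (m t) * norm (q t)) \<le> 2 * (G t * norm (q t))"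
      using G(2)[of t] order_trans[OF norm_ge_zero G(2)[of t]] x t by (intro mult_mono) auto
    then show "norm (pwave k (- x) ^ 2 * ((pwave k t ^ 2 * m t) * q t) - m t * q t) \<le> 2 * (G t * norm (q t))"
      unfolding eq norm_mult .
  qed (use i G in auto)
  also have "\<dots> = 2 * tail_int (\<lambda>t. G t * norm (q t)) x" by (rule tail_int_cmult)
  finally have "norm (pwave k (- x) ^ 2 * tail_int (\<lambda>t. (pwave k t ^ 2 * m t) * q t) x - tail_int (\<lambda>t. m t * q t) x) \<le> 2 * tail_int (\<lambda>t. G t * norm (q t)) x" .
  moreover have "norm k > 0" using k by auto
  ultimately show ?thesis by (simp add: norm_divide norm_mult divide_simps)
qed

text \<open>Iteration of \<open>Volterra_bound\<close>, with \<open>tail_int_power\<close> supplying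
  the next factorial. Continuity is carried along in the same induction because the next term needs
  the measurability of this one.\<close>

lemma jost_term_props:
  assumes k: "Im k > 0"
  shows "continuous_on UNIV (jost_term k n)" "\<And>x. x \<ge> 0 \<Longrightarrow> norm (jost_term k n x) \<le> (q_tail x / norm k) ^ n / fact n"
proof -
  have "continuous_on UNIV (jost_term k n) \<and> (\<forall>x\<ge>0. norm (jost_term k n x) \<le> (q_tail x / norm k) ^ n / fact n)"
  proof (induction n)
    case 0
    have "jost_term k 0 = (\<lambda>x. 1)" by auto
    then show ?case by simp
  next
    case (Suc n)
    have B: "norm (jost_term k n x) \<le> (q_tail 0 / norm k) ^ n / fact n" if x: "x \<ge> 0" for x
    proof -
      have "norm (jost_term k n x) \<le> (q_tail x / norm k) ^ n / fact n" using Suc x by blast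
      also have "\<dots> \<le> (q_tail 0 / norm k) ^ n / fact n"
        using q_tail_le[of x] q_tail_nonneg[of x] by (intro divide_right_mono power_mono) auto
      finally show ?thesis .
    qed
    have m: "jost_term k n \<in> borel_measurable lebesgue" using Suc continuous_measurable_lebesgue by blast
    note i = q_weight_integrable[OF k m B]
    have "jost_term k (Suc n) = (\<lambda>x. (pwave k (- x) ^ 2 * tail_int (\<lambda>t. (pwave k t ^ 2 * jost_term k n t) * q t) x - tail_int (\<lambda>t. jost_term k n t * q t) x) / (2 * \<i> * k))"
      by auto
    then have "continuous_on UNIV (jost_term k (Suc n))"
      using k by (auto intro!: continuous_intros tail_int_continuous i pwave_cont')
    moreover have "norm (jost_term k (Suc n) x) \<le> (q_tail x / norm k) ^ Suc n / fact (Suc n)" if x: "x \<ge> 0" for x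
    proof -
      have eq: "(\<lambda>t. (q_tail t / norm k) ^ n / fact n * norm (q t)) = (\<lambda>t. (1 / (norm k ^ n * fact n)) * (q_tail t ^ n * norm (q t)))"
        by (auto simp: field_simps)
      have "integrable lebesgue (\<lambda>t. (q_tail t / norm k) ^ n / fact n * norm (q t))"
        unfolding eq using tail_int_power(2)[OF qn_int x] by (auto simp: q_tail_def)
      from Volterra_bound[OF k m B this _ x] Suc
      have "norm (jost_term k (Suc n) x) \<le> tail_int (\<lambda>t. (q_tail t / norm k) ^ n / fact n * norm (q t)) x / norm k" by auto
      also have "tail_int (\<lambda>t. (q_tail t / norm k) ^ n / fact n * norm (q t)) x = (1 / (norm k ^ n * fact n)) * (q_tail x ^ Suc n / real (Suc n))"
        unfolding eq tail_int_cmult using tail_int_power(1)[OF qn_int x] by (simp add: q_tail_def)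
      also have "\<dots> / norm k = (q_tail x / norm k) ^ Suc n / fact (Suc n)"
        by (simp add: power_divide field_simps del: of_nat_Suc)
      finally show ?thesis .
    qed
    ultimately show ?case by blast
  qed
  then show "continuous_on UNIV (jost_term k n)" "\<And>x. x \<ge> 0 \<Longrightarrow> norm (jost_term k n x) \<le> (q_tail x / norm k) ^ n / fact n" by auto
qed

lemma jost_term_bound0:
  assumes "Im k > 0" "x \<ge> 0" shows "norm (jost_term k n x) \<le> (q_tail 0 / norm k) ^ n / fact n"
  using q_tail_le[of x] q_tail_nonneg[of x]
  by (intro order_trans[OF jost_term_props(2)[OF assms]] divide_right_mono power_mono) auto

lemma jost_term_measurable: "Im k > 0 \<Longrightarrow> jost_term k n \<in> borel_measurable lebesgue"
  using jost_term_props(1) continuous_measurable_lebesgue by blast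

lemma exists_cball_upper:
  assumes k: "Im k > 0"
  obtains r c where "r > 0" "cball k r \<subseteq> upper" "c > 0" "\<And>z. z \<in> cball k r \<Longrightarrow> norm z \<ge> c \<and> Im z \<ge> c"
proof
  show "Im k / 2 > 0" "Im k / 2 > 0" using k by auto
  have *: "Im z \<ge> Im k / 2" if "z \<in> cball k (Im k / 2)" for z
    using that abs_Im_le_cmod[of "k - z"] by (auto simp: dist_norm)
  then show "cball k (Im k / 2) \<subseteq> upper" using k by force
  show "norm z \<ge> Im k / 2 \<and> Im z \<ge> Im k / 2" if "z \<in> cball k (Im k / 2)" for z
    using *[OF that] abs_Im_le_cmod[of z] by auto
qed

lemma pwave_holomorphic: "(\<lambda>k. pwave k x) holomorphic_on A"
  unfolding pwave_def by (intro holomorphic_intros)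

lemma jost_term_holomorphic: "x \<ge> 0 \<Longrightarrow> (\<lambda>k. jost_term k n x) holomorphic_on upper"
proof (induction n arbitrary: x)
  case (Suc n)
  \<comment> \<open>Both tail integrals in the recursion have this form, with weight W equal to
    \<open>pwave\<close> squared or to 1.\<close>
  have gen: "(\<lambda>k. tail_int (\<lambda>t. (W k t * jost_term k n t) * q t) x) holomorphic_on upper"
    if Wh: "\<And>t. (\<lambda>k. W k t) holomorphic_on upper" and Wm: "\<And>k. W k \<in> borel_measurable lebesgue"
      and W1: "\<And>k t. Im k > 0 \<Longrightarrow> t \<ge> 0 \<Longrightarrow> norm (W k t) \<le> 1" for W
    unfolding tail_int_def set_lebesgue_integral_def
  proof (rule holomorphic_on_integral[OF open_upper])
    fix t show "(\<lambda>k. indicat_real {x..} t *\<^sub>R ((W k t * jost_term k n t) * q t)) holomorphic_on upper"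
    proof (cases "t \<ge> 0")
      case True then show ?thesis unfolding scaleR_conv_of_real by (intro holomorphic_intros Wh Suc.IH)
    next
      case False then show ?thesis using q_zero[of t] by simp
    qed
  next
    fix k assume "k \<in> upper"
    then have k: "Im k > 0" by simp
    show "(\<lambda>t. indicat_real {x..} t *\<^sub>R ((W k t * jost_term k n t) * q t)) \<in> borel_measurable lebesgue"
      using Wm[of k] jost_term_measurable[OF k, of n] borel_measurable_integrable[OF q_int]
      by (intro borel_measurable_scaleR borel_measurable_indicator borel_measurable_times) auto
    obtain r c where r: "r > 0" "cball k r \<subseteq> upper" "c > 0" "\<And>z. z \<in> cball k r \<Longrightarrow> norm z \<ge> c \<and> Im z \<ge> c"
      using exists_cball_upper[OF k] by metis
    have "norm (indicat_real {x..} t *\<^sub>R ((W z t * jost_term z n t) * q t)) \<le> (q_tail 0 / c) ^ n / fact n * norm (q t)" if z: "z \<in> cball k r" for z t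
    proof (cases "t \<ge> 0")
      case True
      have Iz: "Im z > 0" using r z by auto
      have "norm (jost_term z n t) \<le> (q_tail 0 / norm z) ^ n / fact n" using jost_term_bound0[OF Iz True] .
      also have "\<dots> \<le> (q_tail 0 / c) ^ n / fact n"
        using q_tail_nonneg[of 0] r(3) r(4)[OF z] by (intro divide_right_mono power_mono frac_le) auto
      finally have "norm (W z t) * norm (jost_term z n t) * norm (q t) \<le> 1 * ((q_tail 0 / c) ^ n / fact n) * norm (q t)"
        using W1[OF Iz True] by (intro mult_right_mono mult_mono) auto
      then show ?thesis by (auto simp: indicator_def norm_mult intro: order_trans[rotated])
    next
      case False then show ?thesis using q_zero[of t] by simp
    qed
    then show "\<exists>r>0. \<exists>G. cball k r \<subseteq> upper \<and> integrable lebesgue G \<and> (\<forall>z\<in>cball k r. \<forall>t\<in>space lebesgue. norm (indicat_real {x..} t *\<^sub>R ((W z t * jost_term z n t) * q t)) \<le> G t)"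
      using r qn_int by (intro exI[of _ r] conjI exI[of _ "\<lambda>t. (q_tail 0 / c) ^ n / fact n * norm (q t)"]) auto
  qed
  have 1: "(\<lambda>k. tail_int (\<lambda>t. (pwave k t ^ 2 * jost_term k n t) * q t) x) holomorphic_on upper"
    by (rule gen) (use pwave_holomorphic norm_pwave_le_1 in \<open>auto intro!: holomorphic_intros continuous_measurable_lebesgue continuous_on_power pwave_cont power_le_one simp: norm_power\<close>)
  have 2: "(\<lambda>k. tail_int (\<lambda>t. (1 * jost_term k n t) * q t) x) holomorphic_on upper"
    by (rule gen) (auto intro!: holomorphic_intros)
  have "(\<lambda>k. jost_term k (Suc n) x) = (\<lambda>k. (pwave k (- x) ^ 2 * tail_int (\<lambda>t. (pwave k t ^ 2 * jost_term k n t) * q t) x - tail_int (\<lambda>t. (1 * jost_term k n t) * q t) x) / (2 * \<i> * k))"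
    by auto
  then show ?case
    by (simp only:) (intro holomorphic_intros 1 2 pwave_holomorphic; force)
qed simp

section \<open>Summation of the Neumann series and the Volterra equation\<close>

text \<open>This is m(x) = exp(-ikx) psi(x). The convergence bounds are available only for x >= 0;
  the value 0 elsewhere makes it a measurable function on the whole line.\<close>

definition jost_factor :: "complex \<Rightarrow> real \<Rightarrow> complex" where "jost_factor k x = (if x \<ge> 0 then \<Sum>n. jost_term k n x else 0)"

lemma jost_factor_sums:
  assumes "Im k > 0" "x \<ge> 0"
  shows "(\<lambda>n. jost_term k n x) sums jost_factor k x"
    and "norm (jost_factor k x) \<le> exp (q_tail x / norm k)"
    and "norm (jost_factor k x - 1) \<le> exp (q_tail x / norm k) - 1"
    and "\<And>N. norm (\<Sum>n<N. jost_term k n x) \<le> exp (q_tail 0 / norm k)"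
proof -
  have e: "(\<lambda>n. (y :: real) ^ n / fact n) sums exp y" for y
    using exp_converges[of y] by (simp add: divide_inverse mult.commute)
  note b = jost_term_props(2)[OF assms]
  have sn: "summable (\<lambda>n. norm (jost_term k n x))"
    by (rule summable_comparison_test'[OF sums_summable[OF e]]) (use b in simp)
  show s: "(\<lambda>n. jost_term k n x) sums jost_factor k x"
    using summable_sums[OF summable_norm_cancel[OF sn]] assms(2) by (simp add: jost_factor_def)
  show "norm (jost_factor k x) \<le> exp (q_tail x / norm k)"
    unfolding sums_unique[OF s] sums_unique[OF e] by (intro order_trans[OF summable_norm[OF sn]] suminf_le sn sums_summable[OF e] b)
  have sn': "summable (\<lambda>n. norm (jost_term k (Suc n) x))"
    using sn summable_Suc_iff[of "\<lambda>n. norm (jost_term k n x)"] by blast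
  have e': "summable (\<lambda>n. (q_tail x / norm k) ^ Suc n / fact (Suc n))"
    using sums_summable[OF e] summable_Suc_iff[of "\<lambda>n. (q_tail x / norm k) ^ n / fact n"] by blast
  have "norm (jost_factor k x - 1) = norm (\<Sum>n. jost_term k (Suc n) x)"
    using suminf_split_head[OF sums_summable[OF s]] sums_unique[OF s] by simp
  also have "\<dots> \<le> (\<Sum>n. norm (jost_term k (Suc n) x))" using sn' by (rule summable_norm)
  also have "\<dots> \<le> (\<Sum>n. (q_tail x / norm k) ^ Suc n / fact (Suc n))"
    by (rule suminf_le[OF b sn' e'])
  also have "\<dots> = exp (q_tail x / norm k) - 1"
    using suminf_split_head[OF sums_summable[OF e[of "q_tail x / norm k"]]] sums_unique[OF e[of "q_tail x / norm k"]] by simp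
  finally show "norm (jost_factor k x - 1) \<le> exp (q_tail x / norm k) - 1" .
  show "norm (\<Sum>n<N. jost_term k n x) \<le> exp (q_tail 0 / norm k)" for N
  proof -
    have "norm (\<Sum>n<N. jost_term k n x) \<le> (\<Sum>n<N. (q_tail 0 / norm k) ^ n / fact n)"
      by (rule sum_norm_le) (use jost_term_bound0 assms in blast)
    also have "\<dots> \<le> exp (q_tail 0 / norm k)"
      unfolding sums_unique[OF e[of "q_tail 0 / norm k"]] using q_tail_nonneg[of 0] by (intro sum_le_suminf sums_summable[OF e]) auto
    finally show ?thesis .
  qed
qed

lemma jost_factor_measurable:
  assumes k: "Im k > 0" shows "jost_factor k \<in> borel_measurable lebesgue"
proof (rule borel_measurable_LIMSEQ_metric)
  show "(\<lambda>t. indicat_real {0..} t *\<^sub>R (\<Sum>n<N. jost_term k n t)) \<in> borel_measurable lebesgue" for N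
    by (intro borel_measurable_scaleR borel_measurable_indicator borel_measurable_sum jost_term_measurable k) auto
  show "(\<lambda>N. indicat_real {0..} t *\<^sub>R (\<Sum>n<N. jost_term k n t)) \<longlonglongrightarrow> jost_factor k t" for t
    using jost_factor_sums(1)[OF k, of t] by (cases "t \<ge> 0") (auto simp: sums_def jost_factor_def)
qed

lemma jost_factor_bound: "Im k > 0 \<Longrightarrow> x \<ge> 0 \<Longrightarrow> norm (jost_factor k x) \<le> exp (q_tail 0 / norm k)"
  by (rule order_trans[OF jost_factor_sums(2)]) (auto intro: divide_right_mono q_tail_le)

lemma jost_factor_integrable:
  assumes "Im k > 0"
  shows "integrable lebesgue (\<lambda>t. jost_factor k t * q t)" "integrable lebesgue (\<lambda>t. (pwave k t ^ 2 * jost_factor k t) * q t)"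
  using q_weight_integrable[OF assms jost_factor_measurable[OF assms] jost_factor_bound[OF assms]] by blast+

text \<open>The partial sums satisfy the equation with index N on the right and N + 1 on the left.
  They are bounded uniformly in N by exp(Q/|k|), so dominated convergence against |q| passes to the
  limit.\<close>

lemma jost_factor_eq:
  assumes k: "Im k > 0" and x: "x \<ge> 0"
  shows "jost_factor k x = 1 + (pwave k (- x) ^ 2 * tail_int (\<lambda>t. (pwave k t ^ 2 * jost_factor k t) * q t) x - tail_int (\<lambda>t. jost_factor k t * q t) x) / (2 * \<i> * k)"
proof -
  define S where "S = (\<lambda>N t. \<Sum>n<N. jost_term k n t)"
  have Sm: "S N \<in> borel_measurable lebesgue" for N
    unfolding S_def by (intro borel_measurable_sum jost_term_measurable k)
  have Sb: "norm (S N t) \<le> exp (q_tail 0 / norm k)" if "t \<ge> 0" for N t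
    unfolding S_def using jost_factor_sums(4)[OF k that] .
  have step: "(\<Sum>n<N. jost_term k (Suc n) x) = (pwave k (- x) ^ 2 * tail_int (\<lambda>t. (pwave k t ^ 2 * S N t) * q t) x - tail_int (\<lambda>t. S N t * q t) x) / (2 * \<i> * k)" for N
  proof (induction N)
    case 0
    then show ?case by (simp add: S_def tail_int_def)
  next
    case (Suc N)
    note i = q_weight_integrable[OF k Sm Sb, of N]
    note j = q_weight_integrable[OF k jost_term_measurable[OF k] jost_term_bound0[OF k], of N]
    have "tail_int (\<lambda>t. S (Suc N) t * q t) x = tail_int (\<lambda>t. S N t * q t) x + tail_int (\<lambda>t. jost_term k N t * q t) x"
      using tail_int_add_diff(1)[OF i(1) j(1), of x] by (simp add: S_def distrib_right)
    moreover have "tail_int (\<lambda>t. (pwave k t ^ 2 * S (Suc N) t) * q t) x = tail_int (\<lambda>t. (pwave k t ^ 2 * S N t) * q t) x + tail_int (\<lambda>t. (pwave k t ^ 2 * jost_term k N t) * q t) x"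
      using tail_int_add_diff(1)[OF i(2) j(2), of x] by (simp add: S_def distrib_right distrib_left)
    ultimately show ?case using Suc by (simp add: diff_divide_distrib add_divide_distrib algebra_simps)
  qed
  have lim: "(\<lambda>N. tail_int (\<lambda>t. (W t * S N t) * q t) x) \<longlonglongrightarrow> tail_int (\<lambda>t. (W t * jost_factor k t) * q t) x"
    if Wm: "W \<in> borel_measurable lebesgue" and W1: "\<And>t. t \<ge> 0 \<Longrightarrow> norm (W t) \<le> 1" for W
    unfolding tail_int_def set_lebesgue_integral_def
  proof (rule integral_dominated_convergence[where w="\<lambda>t. exp (q_tail 0 / norm k) * norm (q t)"])
    show "(\<lambda>t. indicat_real {x..} t *\<^sub>R (W t * jost_factor k t * q t)) \<in> borel_measurable lebesgue"
      using Wm jost_factor_measurable[OF k] borel_measurable_integrable[OF q_int]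
      by (intro borel_measurable_scaleR borel_measurable_indicator borel_measurable_times) auto
    show "(\<lambda>t. indicat_real {x..} t *\<^sub>R (W t * S N t * q t)) \<in> borel_measurable lebesgue" for N
      using Wm Sm borel_measurable_integrable[OF q_int]
      by (intro borel_measurable_scaleR borel_measurable_indicator borel_measurable_times) auto
    show "AE t in lebesgue. (\<lambda>N. indicat_real {x..} t *\<^sub>R (W t * S N t * q t)) \<longlonglongrightarrow> indicat_real {x..} t *\<^sub>R (W t * jost_factor k t * q t)"
    proof (intro AE_I2)
      fix t show "(\<lambda>N. indicat_real {x..} t *\<^sub>R (W t * S N t * q t)) \<longlonglongrightarrow> indicat_real {x..} t *\<^sub>R (W t * jost_factor k t * q t)"
      proof (cases "t \<ge> x")
        case True
        have "(\<lambda>N. S N t) \<longlonglongrightarrow> jost_factor k t" using jost_factor_sums(1)[OF k, of t] True x by (simp add: S_def sums_def)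
        then show ?thesis by (intro tendsto_intros)
      qed simp
    qed
    show "AE t in lebesgue. norm (indicat_real {x..} t *\<^sub>R (W t * S N t * q t)) \<le> exp (q_tail 0 / norm k) * norm (q t)" for N
    proof (intro AE_I2)
      fix t show "norm (indicat_real {x..} t *\<^sub>R (W t * S N t * q t)) \<le> exp (q_tail 0 / norm k) * norm (q t)"
      proof (cases "t \<ge> x")
        case True
        have "norm (W t) * norm (S N t) * norm (q t) \<le> 1 * exp (q_tail 0 / norm k) * norm (q t)"
          using True x W1 Sb by (intro mult_right_mono mult_mono) auto
        then show ?thesis using True by (simp add: norm_mult)
      qed simp
    qed
  qed (use qn_int in simp)
  have l1: "(\<lambda>N. tail_int (\<lambda>t. (pwave k t ^ 2 * S N t) * q t) x) \<longlonglongrightarrow> tail_int (\<lambda>t. (pwave k t ^ 2 * jost_factor k t) * q t) x"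
    by (rule lim) (use norm_pwave_le_1[of k] k in \<open>auto intro!: continuous_measurable_lebesgue continuous_on_power pwave_cont power_le_one simp: norm_power\<close>)
  have l2: "(\<lambda>N. tail_int (\<lambda>t. S N t * q t) x) \<longlonglongrightarrow> tail_int (\<lambda>t. jost_factor k t * q t) x"
    using lim[of "\<lambda>t. 1"] by simp
  have "(\<lambda>N. \<Sum>n<N. jost_term k (Suc n) x) \<longlonglongrightarrow> (pwave k (- x) ^ 2 * tail_int (\<lambda>t. (pwave k t ^ 2 * jost_factor k t) * q t) x - tail_int (\<lambda>t. jost_factor k t * q t) x) / (2 * \<i> * k)"
    unfolding step by (intro tendsto_intros l1 l2) (use k in auto)
  moreover have "(\<lambda>N. \<Sum>n<N. jost_term k (Suc n) x) \<longlonglongrightarrow> jost_factor k x - 1"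
    using sums_split_initial_segment[OF jost_factor_sums(1)[OF k x], of 1] by (simp add: sums_def)
  ultimately show ?thesis using LIMSEQ_unique by fastforce
qed

section \<open>The Jost solution, its derivative and their decay\<close>

definition jost_tail2 :: "complex \<Rightarrow> real \<Rightarrow> complex" where "jost_tail2 k = tail_int (\<lambda>t. (pwave k t ^ 2 * jost_factor k t) * q t)"
definition jost_tail :: "complex \<Rightarrow> real \<Rightarrow> complex" where "jost_tail k = tail_int (\<lambda>t. jost_factor k t * q t)"

text \<open>Written in variation-of-constants form, not as \<open>pwave\<close> times
  \<open>jost_factor\<close>: the cut-off of the latter would destroy continuity on the whole line,
  and here the density can be read off.\<close>

definition jost :: "complex \<Rightarrow> real \<Rightarrow> complex" where
  "jost k x = pwave k x + (1 / (2 * \<i> * k)) * (pwave k (- x) * jost_tail2 k x - pwave k x * jost_tail k x)"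

definition jost_deriv :: "complex \<Rightarrow> real \<Rightarrow> complex" where
  "jost_deriv k x = (\<i> * k) * pwave k x - (1 / 2) * (pwave k (- x) * jost_tail2 k x + pwave k x * jost_tail k x)"

lemma pwave_cancel: "pwave k (- x) * (pwave k x ^ 2 * y) = pwave k x * y" "pwave k x * pwave k (- x) ^ 2 = pwave k (- x)"
  using pwave_nz[of k x] by (simp_all add: pwave_minus field_simps power2_eq_square)

lemma jost_eq:
  assumes k: "Im k > 0" and x: "x \<ge> 0" shows "jost k x = pwave k x * jost_factor k x"
proof -
  have "pwave k x * jost_factor k x = pwave k x + (1 / (2 * \<i> * k)) * ((pwave k x * pwave k (- x) ^ 2) * jost_tail2 k x - pwave k x * jost_tail k x)"
    unfolding jost_factor_eq[OF k x] jost_tail2_def[symmetric] jost_tail_def[symmetric] by (simp add: algebra_simps diff_divide_distrib)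
  then show ?thesis by (simp add: pwave_cancel(2) jost_def)
qed

lemma ac_deriv_pwave: "ac_deriv (pwave k) (\<lambda>t. (\<i> * k) * pwave k t)" "ac_deriv (\<lambda>t. pwave k (- t)) (\<lambda>t. (- \<i> * k) * pwave k (- t))"
proof -
  have *: "ac_deriv (\<lambda>x. exp (c * of_real x)) (\<lambda>x. c * exp (c * of_real x))" for c :: complex
  proof (rule ac_deriv_C1)
    show "((\<lambda>x. exp (c * of_real x)) has_vector_derivative c * exp (c * of_real t)) (at t)" for t :: real
      by (rule has_vector_derivative_real_field) (auto intro!: derivative_eq_intros)
  qed (intro continuous_intros)
  show "ac_deriv (pwave k) (\<lambda>t. (\<i> * k) * pwave k t)" using *[of "\<i> * k"] by (simp add: pwave_def[abs_def])
  show "ac_deriv (\<lambda>t. pwave k (- t)) (\<lambda>t. (- \<i> * k) * pwave k (- t))" using *[of "- \<i> * k"] by (simp add: pwave_def[abs_def])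
qed

text \<open>Variation of constants: differentiating the two tails produces endpoint terms that
  cancel in the first derivative and add up to q psi in the second.\<close>

lemma ac_deriv_jost:
  assumes k: "Im k > 0"
  shows "ac_deriv (jost k) (jost_deriv k)" "ac_deriv (jost_deriv k) (\<lambda>t. (q t - k\<^sup>2) * jost k t)"
proof -
  have A: "ac_deriv (jost_tail2 k) (\<lambda>t. - ((pwave k t ^ 2 * jost_factor k t) * q t))" and B: "ac_deriv (jost_tail k) (\<lambda>t. - (jost_factor k t * q t))"
    unfolding jost_tail2_def jost_tail_def by (intro ac_deriv_tail_int jost_factor_integrable k)+
  note EA = ac_deriv_mult[OF ac_deriv_pwave(2)[of k] A] and EB = ac_deriv_mult[OF ac_deriv_pwave(1)[of k] B]
  have nz: "k \<noteq> 0" using k by auto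
  show "ac_deriv (jost k) (jost_deriv k)"
  proof (rule ac_deriv_cong[OF ac_deriv_add[OF ac_deriv_pwave(1)[of k] ac_deriv_cmult[OF ac_deriv_diff[OF EA EB], of "1 / (2 * \<i> * k)"]]])
    fix x :: real
    have e: "pwave k (- x) * - (pwave k x ^ 2 * jost_factor k x * q x) = pwave k x * - (jost_factor k x * q x)"
      using pwave_cancel(1)[of k x "jost_factor k x * q x"] by (simp add: mult.assoc)
    show "(\<i> * k) * pwave k x + 1 / (2 * \<i> * k) * (((- \<i> * k) * pwave k (- x) * jost_tail2 k x + pwave k (- x) * - (pwave k x ^ 2 * jost_factor k x * q x)) - ((\<i> * k) * pwave k x * jost_tail k x + pwave k x * - (jost_factor k x * q x))) = jost_deriv k x"
      unfolding e using nz by (simp add: jost_deriv_def field_simps)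
  qed (simp add: jost_def)
  show "ac_deriv (jost_deriv k) (\<lambda>t. (q t - k\<^sup>2) * jost k t)"
  proof (rule ac_deriv_cong[OF ac_deriv_diff[OF ac_deriv_cmult[OF ac_deriv_pwave(1)[of k], of "\<i> * k"] ac_deriv_cmult[OF ac_deriv_add[OF EA EB], of "1 / 2"]]])
    fix x :: real assume x: "x \<ge> 0"
    have 1: "pwave k (- x) * - (pwave k x ^ 2 * jost_factor k x * q x) = - (q x * jost k x)"
      using pwave_cancel(1)[of k x "jost_factor k x * q x"] jost_eq[OF k x] by (simp add: mult.assoc mult.left_commute mult.commute)
    have 2: "pwave k x * - (jost_factor k x * q x) = - (q x * jost k x)"
      using jost_eq[OF k x] by (simp add: mult.assoc mult.left_commute mult.commute)
    have 3: "k\<^sup>2 * jost k x = k\<^sup>2 * pwave k x + k / (2 * \<i>) * (pwave k (- x) * jost_tail2 k x - pwave k x * jost_tail k x)"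
      using nz unfolding jost_def by (simp add: field_simps power2_eq_square)
    have 4: "k / (2 * \<i>) = - (\<i> * k) / 2" by (simp add: field_simps)
    show "\<i> * k * ((\<i> * k) * pwave k x) - 1 / 2 * (((- \<i> * k) * pwave k (- x) * jost_tail2 k x + pwave k (- x) * - (pwave k x ^ 2 * jost_factor k x * q x)) + ((\<i> * k) * pwave k x * jost_tail k x + pwave k x * - (jost_factor k x * q x))) = (q x - k\<^sup>2) * jost k x"
      unfolding 1 2 left_diff_distrib 3 4 by (simp add: field_simps power2_eq_square)
  qed (simp add: jost_deriv_def)
qed

lemma norm_jost:
  assumes k: "Im k > 0" and x: "x \<ge> 0" shows "norm (jost k x) \<le> exp (q_tail 0 / norm k) * exp (- Im k * x)"
  using jost_factor_bound[OF k x] by (simp add: jost_eq[OF k x] norm_mult norm_pwave mult.commute)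

text \<open>The growth exp(Im k x) of \<open>pwave k (- x)\<close> is offset by the decay exp(-2 Im
  k x) of the tail carrying \<open>pwave\<close> squared, so the rate of decay is that of psi
  itself.\<close>

lemma norm_jost_deriv:
  assumes k: "Im k > 0" shows "\<exists>C. \<forall>x\<ge>0. norm (jost_deriv k x) \<le> C * exp (- Im k * x)"
proof -
  define M where "M = exp (q_tail 0 / norm k)"
  have "norm (jost_deriv k x) \<le> (norm k + M * q_tail 0) * exp (- Im k * x)" if x: "x \<ge> 0" for x
  proof -
    have "norm (jost_tail2 k x) \<le> tail_int (\<lambda>t. (exp (- Im k * x) ^ 2 * M) * norm (q t)) x"
      unfolding jost_tail2_def
    proof (rule norm_tail_int_le)
      fix t assume t: "x \<le> t"
      have "norm (pwave k t) \<le> exp (- Im k * x)" unfolding norm_pwave using k t by simp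
      then have "norm (pwave k t) ^ 2 * norm (jost_factor k t) * norm (q t) \<le> exp (- Im k * x) ^ 2 * M * norm (q t)"
        unfolding M_def using jost_factor_bound[OF k, of t] x t by (intro mult_right_mono mult_mono power_mono) auto
      then show "norm (pwave k t ^ 2 * jost_factor k t * q t) \<le> exp (- Im k * x) ^ 2 * M * norm (q t)"
        by (simp add: norm_mult norm_power)
    qed (use jost_factor_integrable(2)[OF k] qn_int in auto)
    also have "\<dots> = exp (- Im k * x) ^ 2 * M * q_tail x" unfolding tail_int_cmult q_tail_def ..
    also have "\<dots> \<le> exp (- Im k * x) ^ 2 * M * q_tail 0" using q_tail_le by (intro mult_left_mono) (auto simp: M_def)
    finally have "norm (pwave k (- x)) * norm (jost_tail2 k x) \<le> exp (Im k * x) * (exp (- Im k * x) ^ 2 * M * q_tail 0)"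
      by (intro mult_mono) (auto simp: norm_pwave)
    also have "\<dots> = exp (- Im k * x) * M * q_tail 0"
      by (simp add: power2_eq_square mult.assoc[symmetric] flip: exp_add)
    finally have 1: "norm (pwave k (- x)) * norm (jost_tail2 k x) \<le> exp (- Im k * x) * M * q_tail 0" .
    have "norm (jost_tail k x) \<le> tail_int (\<lambda>t. M * norm (q t)) x"
      unfolding jost_tail_def
    proof (rule norm_tail_int_le)
      fix t assume t: "x \<le> t"
      show "norm (jost_factor k t * q t) \<le> M * norm (q t)"
        unfolding M_def norm_mult using jost_factor_bound[OF k, of t] x t by (intro mult_right_mono) auto
    qed (use jost_factor_integrable(1)[OF k] qn_int in auto)
    also have "\<dots> = M * q_tail x" unfolding tail_int_cmult q_tail_def ..
    also have "\<dots> \<le> M * q_tail 0" using q_tail_le by (intro mult_left_mono) (auto simp: M_def)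
    finally have 2: "norm (pwave k x) * norm (jost_tail k x) \<le> exp (- Im k * x) * (M * q_tail 0)"
      by (intro mult_mono) (auto simp: norm_pwave)
    have "norm (jost_deriv k x) \<le> norm ((\<i> * k) * pwave k x) + norm ((1 / 2) * (pwave k (- x) * jost_tail2 k x + pwave k x * jost_tail k x))"
      unfolding jost_deriv_def by (rule norm_triangle_ineq4)
    also have "norm ((1 / 2) * (pwave k (- x) * jost_tail2 k x + pwave k x * jost_tail k x)) \<le> 1 / 2 * (norm (pwave k (- x)) * norm (jost_tail2 k x) + norm (pwave k x) * norm (jost_tail k x))"
      using norm_triangle_ineq[of "pwave k (- x) * jost_tail2 k x" "pwave k x * jost_tail k x"] by (simp add: norm_mult)
    also have "norm ((\<i> * k) * pwave k x) = norm k * exp (- Im k * x)" by (simp add: norm_mult norm_pwave)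
    finally show ?thesis using 1 2 by (simp add: algebra_simps)
  qed
  then show ?thesis by blast
qed

lemma jost_0: "Im k > 0 \<Longrightarrow> jost k 0 = jost_factor k 0"
  using jost_eq[of k 0] by (simp add: pwave_0)

lemma norm_jost_0: "Im k > 0 \<Longrightarrow> norm (jost k 0 - 1) \<le> exp (q_tail 0 / norm k) - 1"
  using jost_factor_sums(3)[of k 0] by (simp add: jost_0)

lemma jost_0_holomorphic: "(\<lambda>k. jost k 0) holomorphic_on upper"
proof (rule holomorphic_uniform_sequence[OF open_upper])
  show "(\<lambda>k. \<Sum>n<N. jost_term k n 0) holomorphic_on upper" for N
    by (intro holomorphic_on_sum jost_term_holomorphic) auto
  fix k assume "k \<in> upper"
  then obtain r c where r: "r > 0" "cball k r \<subseteq> upper" "c > 0" "\<And>z. z \<in> cball k r \<Longrightarrow> norm z \<ge> c \<and> Im z \<ge> c"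
    using exists_cball_upper[of k] by (metis mem_Collect_eq)
  have s: "summable (\<lambda>n. (q_tail 0 / c) ^ n / fact n)"
    using summable_exp[of "q_tail 0 / c"] by (simp add: field_simps)
  have "uniform_limit (cball k r) (\<lambda>N z. \<Sum>n<N. jost_term z n 0) (\<lambda>z. \<Sum>n. jost_term z n 0) sequentially"
  proof (rule Weierstrass_m_test[OF _ s])
    fix n z assume z: "z \<in> cball k r"
    have "norm (jost_term z n 0) \<le> (q_tail 0 / norm z) ^ n / fact n"
      by (rule jost_term_bound0) (use r z in auto)
    also have "\<dots> \<le> (q_tail 0 / c) ^ n / fact n"
      using q_tail_nonneg[of 0] r(3) r(4)[OF z] by (intro divide_right_mono power_mono frac_le) auto
    finally show "norm (jost_term z n 0) \<le> (q_tail 0 / c) ^ n / fact n" .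
  qed
  moreover have "jost z 0 = (\<Sum>n. jost_term z n 0)" if "z \<in> cball k r" for z
    using jost_0[of z] r(2) that by (auto simp: jost_factor_def)
  ultimately have "uniform_limit (cball k r) (\<lambda>N z. \<Sum>n<N. jost_term z n 0) (\<lambda>z. jost z 0) sequentially"
    unfolding uniform_limit_iff by simp
  then show "\<exists>d>0. cball k d \<subseteq> upper \<and> uniform_limit (cball k d) (\<lambda>N z. \<Sum>n<N. jost_term z n 0) (\<lambda>z. jost z 0) sequentially"
    using r by blast
qed

end

section \<open>The Lagrange identity\<close>

text \<open>Here \<open>c\<close> is the slope f'(0). Making it explicit serves two purposes: it is
  the boundary term of the Lagrange identity, and with the Dirichlet condition it completes the
  Cauchy data of f at 0.\<close>

definition solves :: "(real \<Rightarrow> complex) \<Rightarrow> (real \<Rightarrow> complex) \<Rightarrow> (real \<Rightarrow> complex) \<Rightarrow> complex \<Rightarrow> bool" where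
  "solves q f u c \<longleftrightarrow> (\<forall>x\<le>0. f x = 0) \<and>
     (\<exists>f1 h. ac_deriv f f1 \<and> ac_deriv f1 h \<and> f1 0 = c \<and> (AE x in lebesgue. x > 0 \<longrightarrow> u x = - h x + q x * f x)) \<and>
     L2_half f \<and> L2_half u"

lemma schr_op_solves:
  assumes "schr_op q f u" obtains c where "solves q f u c"
proof -
  obtain c h where f0: "\<forall>x\<le>0. f x = 0" and h: "\<And>x. x \<ge> 0 \<Longrightarrow> h absolutely_integrable_on {0..x}"
    and f: "\<And>x. x \<ge> 0 \<Longrightarrow> f x = integral {0..x} (\<lambda>t. c + integral {0..t} h)"
    and ae: "negligible {x. 0 < x \<and> u x \<noteq> - h x + q x * f x}" and L: "L2_half f" "L2_half u"
    using assms unfolding schr_op_def by blast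
  define f1 where "f1 = (\<lambda>t. c + integral {0..t} h)"
  have 1: "ac_deriv f1 h"
    unfolding ac_deriv_def
  proof (intro allI impI conjI)
    fix x :: real assume x: "x \<ge> 0"
    show "f1 x = f1 0 + (LINT t:{0..x}|lebesgue. h t)"
      unfolding set_lebesgue_integral_eq_integral(2)[OF h[OF x]] by (simp add: f1_def)
  qed (rule h)
  have 2: "ac_deriv f f1"
    unfolding ac_deriv_def
  proof (intro allI impI conjI)
    fix x :: real assume x: "x \<ge> 0"
    show i: "f1 absolutely_integrable_on {0..x}"
      using ac_deriv_continuous[OF 1] by (rule absolutely_integrable_continuous_real)
    show "f x = f 0 + (LINT t:{0..x}|lebesgue. f1 t)"
      unfolding set_lebesgue_integral_eq_integral(2)[OF i] f[OF x] f1_def[symmetric] using f0 by simp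
  qed
  have 3: "AE x in lebesgue. x > 0 \<longrightarrow> u x = - h x + q x * f x"
    using ae unfolding negligible_iff_null_sets by (rule AE_I') auto
  have "f1 0 = c" by (simp add: f1_def)
  then have "solves q f u c" using f0 1 2 3 L unfolding solves_def by blast
  then show thesis by (rule that)
qed

lemma L2_half_iff:
  "L2_half f \<longleftrightarrow> (\<lambda>t. indicat_real {0<..} t *\<^sub>R f t) \<in> borel_measurable lebesgue \<and>
     integrable lebesgue (\<lambda>t. indicat_real {0<..} t *\<^sub>R (norm (f t))\<^sup>2)"
proof -
  have "f measurable_on {0<..} \<longleftrightarrow> (\<lambda>t. indicat_real {0<..} t *\<^sub>R f t) \<in> borel_measurable lebesgue"
    by (subst measurable_on_iff_borel_measurable) (auto simp: borel_measurable_restrict_space_iff)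
  moreover have "(\<lambda>x. (norm (f x))\<^sup>2) integrable_on {0<..} \<longleftrightarrow> integrable lebesgue (\<lambda>t. indicat_real {0<..} t *\<^sub>R (norm (f t))\<^sup>2)"
    using absolutely_integrable_on_iff_nonneg[of "{0<..}" "\<lambda>x. (norm (f x))\<^sup>2"] by (simp add: set_integrable_def)
  ultimately show ?thesis by (simp add: L2_half_def)
qed

lemma L2_half_lin:
  assumes "L2_half f" "L2_half g" shows "L2_half (\<lambda>x. a * f x + b * g x)"
proof -
  note f = assms(1)[unfolded L2_half_iff] and g = assms(2)[unfolded L2_half_iff]
  have eq: "(\<lambda>t. indicat_real {0<..} t *\<^sub>R (a * f t + b * g t)) = (\<lambda>t. a * (indicat_real {0<..} t *\<^sub>R f t) + b * (indicat_real {0<..} t *\<^sub>R g t))"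
    by (auto simp: indicator_def)
  have m: "(\<lambda>t. indicat_real {0<..} t *\<^sub>R (a * f t + b * g t)) \<in> borel_measurable lebesgue"
    unfolding eq using f g by (intro borel_measurable_add borel_measurable_times borel_measurable_const) auto
  have eq2: "(\<lambda>t. indicat_real {0<..} t *\<^sub>R (norm (a * f t + b * g t))\<^sup>2) = (\<lambda>t. (norm (indicat_real {0<..} t *\<^sub>R (a * f t + b * g t)))\<^sup>2)"
    by (auto simp: indicator_def)
  have "integrable lebesgue (\<lambda>t. indicat_real {0<..} t *\<^sub>R (norm (a * f t + b * g t))\<^sup>2)"
  proof (rule Bochner_Integration.integrable_bound)
    show "integrable lebesgue (\<lambda>t. 2 * (norm a)\<^sup>2 * (indicat_real {0<..} t *\<^sub>R (norm (f t))\<^sup>2) + 2 * (norm b)\<^sup>2 * (indicat_real {0<..} t *\<^sub>R (norm (g t))\<^sup>2))"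
      using f g by (intro Bochner_Integration.integrable_add integrable_mult_right) auto
    show "(\<lambda>t. indicat_real {0<..} t *\<^sub>R (norm (a * f t + b * g t))\<^sup>2) \<in> borel_measurable lebesgue"
      unfolding eq2 using m by measurable
    show "AE t in lebesgue. norm (indicat_real {0<..} t *\<^sub>R (norm (a * f t + b * g t))\<^sup>2) \<le> norm (2 * (norm a)\<^sup>2 * (indicat_real {0<..} t *\<^sub>R (norm (f t))\<^sup>2) + 2 * (norm b)\<^sup>2 * (indicat_real {0<..} t *\<^sub>R (norm (g t))\<^sup>2))"
    proof (intro AE_I2)
      fix t
      have "(norm (a * f t + b * g t))\<^sup>2 \<le> (norm a * norm (f t) + norm b * norm (g t))\<^sup>2"
        using norm_triangle_ineq[of "a * f t" "b * g t"] by (intro power_mono) (auto simp: norm_mult)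
      also have "\<dots> \<le> 2 * (norm a)\<^sup>2 * (norm (f t))\<^sup>2 + 2 * (norm b)\<^sup>2 * (norm (g t))\<^sup>2"
        using sum_squares_bound[of "norm a * norm (f t)" "norm b * norm (g t)"] by (simp add: power2_sum power_mult_distrib)
      finally show "norm (indicat_real {0<..} t *\<^sub>R (norm (a * f t + b * g t))\<^sup>2) \<le> norm (2 * (norm a)\<^sup>2 * (indicat_real {0<..} t *\<^sub>R (norm (f t))\<^sup>2) + 2 * (norm b)\<^sup>2 * (indicat_real {0<..} t *\<^sub>R (norm (g t))\<^sup>2))"
        by (auto simp: indicator_def)
    qed
  qed
  then show ?thesis using m by (simp add: L2_half_iff)
qed

lemma solves_lin:
  assumes "solves q f u c" "solves q g v d"
  shows "solves q (\<lambda>x. a * f x + b * g x) (\<lambda>x. a * u x + b * v x) (a * c + b * d)"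
proof -
  obtain f1 h where f: "ac_deriv f f1" "ac_deriv f1 h" "f1 0 = c" "AE x in lebesgue. x > 0 \<longrightarrow> u x = - h x + q x * f x"
    using assms(1) unfolding solves_def by blast
  obtain g1 h' where g: "ac_deriv g g1" "ac_deriv g1 h'" "g1 0 = d" "AE x in lebesgue. x > 0 \<longrightarrow> v x = - h' x + q x * g x"
    using assms(2) unfolding solves_def by blast
  have "AE x in lebesgue. x > 0 \<longrightarrow> a * u x + b * v x = - (a * h x + b * h' x) + q x * (a * f x + b * g x)"
    using f(4) g(4)
  proof eventually_elim
    case (elim x)
    show ?case
    proof
      assume "x > 0"
      then have "u x = - h x + q x * f x" "v x = - h' x + q x * g x" using elim by auto
      then show "a * u x + b * v x = - (a * h x + b * h' x) + q x * (a * f x + b * g x)"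
        by (simp only:) (simp add: algebra_simps)
    qed
  qed
  then show ?thesis
    unfolding solves_def
    using assms ac_deriv_add[OF ac_deriv_cmult[OF f(1), of a] ac_deriv_cmult[OF g(1), of b]] ac_deriv_add[OF ac_deriv_cmult[OF f(2), of a] ac_deriv_cmult[OF g(2), of b]] f(3) g(3)
    by (intro conjI exI[of _ "\<lambda>x. a * f1 x + b * g1 x"] exI[of _ "\<lambda>x. a * h x + b * h' x"] L2_half_lin) (auto simp: solves_def)
qed

lemma solves_cong:
  assumes "solves q f u c" "\<And>x. x > 0 \<Longrightarrow> q x = q' x" shows "solves q' f u c"
  using assms unfolding solves_def by (auto cong: conj_cong imp_cong)

section \<open>Uniqueness for the Cauchy problem at 0\<close>

context half_line_potential
begin

text \<open>With zero Cauchy data, |f| + |f'| satisfies the integral inequality of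
  \<open>gronwall_zero\<close> with weight 1 + |z| + |q|. Hence Dirichlet eigenfunctions at a given
  energy are determined by their slope at 0.\<close>

lemma solves_unique:
  assumes "solves q f (\<lambda>x. z * f x) 0" shows "f = (\<lambda>x. 0)"
proof -
  obtain f1 h where f: "ac_deriv f f1" "ac_deriv f1 h" "f1 0 = 0" and ae: "AE x in lebesgue. x > 0 \<longrightarrow> z * f x = - h x + q x * f x"
    and f0: "\<And>x. x \<le> 0 \<Longrightarrow> f x = 0"
    using assms unfolding solves_def by blast
  define y where "y = (\<lambda>x. norm (f x) + norm (f1 x))"
  define p where "p = (\<lambda>x. 1 + norm z + norm (q x))"
  have ind: "set_integrable lebesgue {0..x} (\<lambda>t. norm (q t))" for x
    using qn_int unfolding set_integrable_def by (intro integrable_mult_indicator) auto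
  have p: "set_integrable lebesgue {0..x} p" for x
    unfolding p_def by (intro set_integral_add(1) ind absolutely_integrable_continuous_real continuous_intros)
  have yc: "continuous_on {0..x} y" for x
    unfolding y_def by (intro continuous_intros ac_deriv_continuous[OF f(1)] ac_deriv_continuous[OF f(2)])
  have "y x = 0" if x: "x \<ge> 0" for x
  proof (rule gronwall_zero[OF yc _ p _ _ x])
    fix x :: real assume x: "x \<ge> 0"
    note i1 = ac_deriv_integrable[OF f(1), of x] and i2 = ac_deriv_integrable[OF f(2), of x]
    have "norm (f x) \<le> (LINT t:{0..x}|lebesgue. norm (f1 t))"
      using ac_deriv_eq[OF f(1) x] f0[of 0] set_integral_norm_bound[OF i1] by simp
    moreover have "norm (f1 x) \<le> (LINT t:{0..x}|lebesgue. norm (h t))"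
      using ac_deriv_eq[OF f(2) x] f(3) set_integral_norm_bound[OF i2] by simp
    ultimately have "y x \<le> (LINT t:{0..x}|lebesgue. norm (f1 t) + norm (h t))"
      unfolding y_def using i1 i2 by (subst set_integral_add) (auto intro: set_integrable_norm)
    also have "\<dots> \<le> (LINT t:{0..x}|lebesgue. p t * y t)"
      unfolding set_lebesgue_integral_def
    proof (rule integral_mono_AE)
      show "integrable lebesgue (\<lambda>t. indicat_real {0..x} t *\<^sub>R (norm (f1 t) + norm (h t)))"
        using set_integral_add(1)[OF set_integrable_norm[OF i1] set_integrable_norm[OF i2]] unfolding set_integrable_def .
      show "integrable lebesgue (\<lambda>t. indicat_real {0..x} t *\<^sub>R (p t * y t))"
        using set_integrable_continuous_mult[OF yc p, of x] unfolding set_integrable_def by (simp add: mult.commute)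
      show "AE t in lebesgue. indicat_real {0..x} t *\<^sub>R (norm (f1 t) + norm (h t)) \<le> indicat_real {0..x} t *\<^sub>R (p t * y t)"
        using ae AE_lebesgue_neq[of 0]
      proof eventually_elim
        case (elim t)
        have "norm (f1 t) + norm (h t) \<le> p t * y t" if t: "t > 0"
        proof -
          have "h t = (q t - z) * f t" using elim t by (simp add: algebra_simps)
          then have "norm (h t) \<le> (norm z + norm (q t)) * norm (f t)"
            using norm_triangle_ineq4[of "q t" z] by (simp add: norm_mult add.commute mult_right_mono)
          moreover have "p t * y t = (norm z + norm (q t)) * norm (f t) + norm (f1 t) + (norm (f t) + (norm z + norm (q t)) * norm (f1 t))"
            by (simp add: p_def y_def algebra_simps)
          ultimately show ?thesis by (smt (verit) mult_nonneg_nonneg norm_ge_zero)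
        qed
        then show ?case using elim(2) by (auto simp: indicator_def)
      qed
    qed
    finally show "y x \<le> (LINT t:{0..x}|lebesgue. p t * y t)" .
  qed (auto simp: y_def p_def)
  then show ?thesis using f0 unfolding y_def by (intro ext) (smt (verit) norm_ge_zero norm_eq_zero)
qed

end

section \<open>Integrability against exponentially decaying functions\<close>

lemma exp_decay_integrable:
  fixes a :: real
  assumes "a > 0" shows "integrable lebesgue (\<lambda>t. indicat_real {0<..} t *\<^sub>R exp (- a * t))"
proof -
  have "(\<lambda>t. exp (- a * t)) integrable_on {0..}" using integrable_on_exp_minus_to_infinity[OF assms] .
  then have "(\<lambda>t. exp (- a * t)) absolutely_integrable_on {0..}"
    by (subst absolutely_integrable_on_iff_nonneg) auto
  then have "set_integrable lebesgue {0<..} (\<lambda>t. exp (- a * t))"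
    by (rule set_integrable_subset) auto
  then show ?thesis by (simp add: set_integrable_def)
qed

lemma L2_half_mult_decay:
  assumes g: "L2_half g" and a: "a > 0" and m: "w \<in> borel_measurable lebesgue"
    and b: "\<And>t. t > 0 \<Longrightarrow> norm (w t) \<le> C * exp (- a * t)"
  shows "integrable lebesgue (\<lambda>t. indicat_real {0<..} t *\<^sub>R (g t * w t))"
proof (rule Bochner_Integration.integrable_bound)
  note g' = g[unfolded L2_half_iff]
  show "integrable lebesgue (\<lambda>t. indicat_real {0<..} t *\<^sub>R (norm (g t))\<^sup>2 + C\<^sup>2 * (indicat_real {0<..} t *\<^sub>R exp (- (2 * a) * t)))"
    using g' a by (intro Bochner_Integration.integrable_add integrable_mult_right exp_decay_integrable) auto
  have eq: "(\<lambda>t. indicat_real {0<..} t *\<^sub>R (g t * w t)) = (\<lambda>t. (indicat_real {0<..} t *\<^sub>R g t) * w t)" by auto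
  show "(\<lambda>t. indicat_real {0<..} t *\<^sub>R (g t * w t)) \<in> borel_measurable lebesgue"
    unfolding eq using g' m by (intro borel_measurable_times) auto
  show "AE t in lebesgue. norm (indicat_real {0<..} t *\<^sub>R (g t * w t)) \<le> norm (indicat_real {0<..} t *\<^sub>R (norm (g t))\<^sup>2 + C\<^sup>2 * (indicat_real {0<..} t *\<^sub>R exp (- (2 * a) * t)))"
  proof (intro AE_I2)
    fix t show "norm (indicat_real {0<..} t *\<^sub>R (g t * w t)) \<le> norm (indicat_real {0<..} t *\<^sub>R (norm (g t))\<^sup>2 + C\<^sup>2 * (indicat_real {0<..} t *\<^sub>R exp (- (2 * a) * t)))"
    proof (cases "t > 0")
      case True
      have "2 * (norm (g t) * norm (w t)) \<le> (norm (g t))\<^sup>2 + (norm (w t))\<^sup>2"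
        using sum_squares_bound[of "norm (g t)" "norm (w t)"] by simp
      moreover have "(norm (w t))\<^sup>2 \<le> (C * exp (- a * t))\<^sup>2" using b[OF True] by (intro power_mono) auto
      moreover have "(C * exp (- a * t))\<^sup>2 = C\<^sup>2 * exp (- (2 * a) * t)"
        by (simp add: power_mult_distrib power2_eq_square flip: exp_add)
      moreover have "norm (g t) * norm (w t) \<ge> 0" by simp
      ultimately have "norm (g t) * norm (w t) \<le> (norm (g t))\<^sup>2 + C\<^sup>2 * exp (- (2 * a) * t)" by linarith
      then show ?thesis using True by (simp add: norm_mult)
    qed simp
  qed
qed


lemma tail_int_antimono:
  fixes g :: "real \<Rightarrow> real"
  assumes g: "integrable lebesgue g" and nn: "\<And>t. g t \<ge> 0" and xy: "x \<le> y"
  shows "tail_int g y \<le> tail_int g x"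
  unfolding tail_int_def set_lebesgue_integral_def
  by (intro Bochner_Integration.integral_mono integrable_tail g) (use nn xy in \<open>auto simp: indicator_def\<close>)

lemma not_integrable_if_bounded_below:
  fixes g :: "real \<Rightarrow> 'a::{banach,second_countable_topology}"
  assumes g: "integrable lebesgue g" and X: "\<And>x::real. x \<ge> X \<Longrightarrow> norm (g x) \<ge> 1"
  shows False
proof -
  have gn: "integrable lebesgue (\<lambda>t. norm (g t))" using g by simp
  have "\<forall>\<^sub>F n in sequentially. tail_int (\<lambda>t. norm (g t)) (real n) < 1"
    using order_tendstoD(2)[OF tail_int_tendsto_0[OF gn]] by simp
  then obtain N where N: "\<And>n. n \<ge> N \<Longrightarrow> tail_int (\<lambda>t. norm (g t)) (real n) < 1"
    unfolding eventually_sequentially by blast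
  obtain m where m: "X < real m" using reals_Archimedean2 by blast
  define n where "n = max N m"
  have "(LINT t|lebesgue. indicat_real {real n..real n + 1} t) \<le> tail_int (\<lambda>t. norm (g t)) (real n)"
    unfolding tail_int_def set_lebesgue_integral_def
  proof (rule Bochner_Integration.integral_mono[OF _ integrable_tail[OF gn]])
    show "integrable lebesgue (indicat_real {real n..real n + 1})"
      by (subst integrable_indicator_iff) auto
    fix t show "indicat_real {real n..real n + 1} t \<le> indicat_real {real n..} t *\<^sub>R norm (g t)"
      using X[of t] m by (auto simp: indicator_def n_def)
  qed
  moreover have "(LINT t|lebesgue. indicat_real {real n..real n + 1} t) = 1" by simp
  ultimately show False using N[of n] by (simp add: n_def)
qed

context half_line_potential
begin

lemma jost_continuous:
  assumes k: "Im k > 0" shows "continuous_on UNIV (jost k)" "continuous_on UNIV (jost_deriv k)"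
  unfolding jost_def jost_deriv_def jost_tail2_def jost_tail_def
  by (intro continuous_intros tail_int_continuous jost_factor_integrable[OF k] pwave_cont pwave_cont'; simp)+

text \<open>Bilinear, without complex conjugation: for complex q the differential expression is
  symmetric for this form and not for the inner product.\<close>

definition pairing :: "complex \<Rightarrow> (real \<Rightarrow> complex) \<Rightarrow> complex" where
  "pairing k g = (LINT t|lebesgue. indicat_real {0<..} t *\<^sub>R (g t * jost k t))"

lemma pairing_integrable:
  assumes "L2_half g" "Im k > 0"
  shows "integrable lebesgue (\<lambda>t. indicat_real {0<..} t *\<^sub>R (g t * jost k t))"
  by (rule L2_half_mult_decay[OF assms(1,2) continuous_measurable_lebesgue[OF jost_continuous(1)[OF assms(2)]], of "exp (q_tail 0 / norm k)"])
     (use norm_jost[OF assms(2)] in simp)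

text \<open>The Wronskian of f and the Jost solution psi has a limit w at infinity. Since (f psi)' differs
  from it by the integrable function 2 f psi', the product f psi grows like w x. As f psi is
  integrable, w = 0.\<close>

lemma Lagrange_identity:
  assumes k: "Im k > 0" and sol: "solves q f u c"
  shows "c * jost k 0 = pairing k u - k\<^sup>2 * pairing k f"
proof -
  obtain f1 h where f: "ac_deriv f f1" "ac_deriv f1 h" "f1 0 = c" and ae: "AE x in lebesgue. x > 0 \<longrightarrow> u x = - h x + q x * f x"
    and f0: "f 0 = 0" and L: "L2_half f" "L2_half u"
    using sol unfolding solves_def by blast
  \<comment> \<open>The density of the Wronskian below: the equation u = -h + q f turns (h - (q -
    k^2) f) psi into (k^2 f - u) psi, which is integrable.\<close>
  define w where "w = (\<lambda>t. indicat_real {0<..} t *\<^sub>R ((k\<^sup>2 * f t + (- 1) * u t) * jost k t))"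
  have w: "integrable lebesgue w"
    unfolding w_def by (rule pairing_integrable[OF L2_half_lin[OF L] k])
  have wn: "integrable lebesgue (\<lambda>t. norm (w t))" using w by simp
  obtain C where C: "\<And>x. x \<ge> 0 \<Longrightarrow> norm (jost_deriv k x) \<le> C * exp (- Im k * x)" using norm_jost_deriv[OF k] by blast
  define v where "v = (\<lambda>t. indicat_real {0<..} t *\<^sub>R (f t * jost_deriv k t))"
  have v: "integrable lebesgue v"
    unfolding v_def
    by (rule L2_half_mult_decay[OF L(1) k continuous_measurable_lebesgue[OF jost_continuous(2)[OF k]], of C]) (use C in simp)
  define W where "W = (\<lambda>x. f1 x * jost k x - f x * jost_deriv k x)"
  have aW: "ac_deriv W (\<lambda>t. (h t * jost k t + f1 t * jost_deriv k t) - (f1 t * jost_deriv k t + f t * ((q t - k\<^sup>2) * jost k t)))"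
    unfolding W_def by (intro ac_deriv_diff ac_deriv_mult f ac_deriv_jost k)
  define Winf where "Winf = c * jost k 0 + tail_int w 0"
  have W: "W x = Winf - tail_int w x" if x: "x \<ge> 0" for x
  proof -
    have "(LINT t:{0..x}|lebesgue. (h t * jost k t + f1 t * jost_deriv k t) - (f1 t * jost_deriv k t + f t * ((q t - k\<^sup>2) * jost k t))) = (LINT t:{0..x}|lebesgue. w t)"
      unfolding set_lebesgue_integral_def
    proof (rule integral_cong_AE)
      show "(\<lambda>t. indicat_real {0..x} t *\<^sub>R ((h t * jost k t + f1 t * jost_deriv k t) - (f1 t * jost_deriv k t + f t * ((q t - k\<^sup>2) * jost k t)))) \<in> borel_measurable lebesgue"
        using ac_deriv_integrable[OF aW, of x] unfolding set_integrable_def by (rule borel_measurable_integrable)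
      show "(\<lambda>t. indicat_real {0..x} t *\<^sub>R w t) \<in> borel_measurable lebesgue"
        by (rule borel_measurable_integrable, rule integrable_mult_indicator[OF _ w]) simp
      show "AE t in lebesgue. indicat_real {0..x} t *\<^sub>R ((h t * jost k t + f1 t * jost_deriv k t) - (f1 t * jost_deriv k t + f t * ((q t - k\<^sup>2) * jost k t))) = indicat_real {0..x} t *\<^sub>R w t"
        using ae AE_lebesgue_neq[of 0]
      proof eventually_elim
        case (elim t)
        show ?case
        proof (cases "t > 0")
          case True
          have ut: "u t = - h t + q t * f t" using elim True by blast
          have "w t = (h t * jost k t + f1 t * jost_deriv k t) - (f1 t * jost_deriv k t + f t * ((q t - k\<^sup>2) * jost k t))"
            using True by (simp add: w_def ut algebra_simps)
          then show ?thesis by simp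
        qed (use elim(2) in \<open>auto simp: indicator_def\<close>)
      qed
    qed
    then show ?thesis using ac_deriv_eq[OF aW x] tail_int_split[OF w x] f(3) f0 by (simp add: Winf_def W_def)
  qed
  \<comment> \<open>Adding 2 f psi' to the Wronskian f' psi - f psi' gives (f psi)'. After
    subtraction of the limit only 2 f psi' minus a tail of \<open>w\<close> remains.\<close>
  have aP: "ac_deriv (\<lambda>x. f x * jost k x - Winf * of_real x) (\<lambda>t. (f1 t * jost k t + f t * jost_deriv k t) - Winf * 1)"
  proof (intro ac_deriv_diff ac_deriv_mult f ac_deriv_jost k ac_deriv_cmult ac_deriv_C1)
    show "(complex_of_real has_vector_derivative 1) (at t)" for t
      by (auto intro!: derivative_eq_intros simp: has_vector_derivative_def scaleR_conv_of_real fun_eq_iff)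
  qed (intro continuous_intros)
  have "Winf = 0"
  proof (rule ccontr)
    assume nz: "Winf \<noteq> 0"
    define T where "T = tail_int (\<lambda>t. norm (w t))"
    have "\<forall>\<^sub>F n in sequentially. T (real n) < norm Winf / 2"
      using order_tendstoD(2)[OF tail_int_tendsto_0[OF wn], of "norm Winf / 2"] nz by (simp add: T_def)
    then obtain N where N: "T (real N) < norm Winf / 2" unfolding eventually_sequentially by blast
    \<comment> \<open>Beyond N the tail of \<open>w\<close> is below |Winf|/2; on [0,N] it is at
      most \<open>T 0\<close>. Thus the density of f psi - Winf x is bounded by |Winf|/2 plus the
      integrable \<open>G\<close>.\<close>
    define G where "G = (\<lambda>t. T 0 * indicat_real {0..real N} t + 2 * norm (v t))"
    have T0: "T x \<ge> 0" for x unfolding T_def tail_int_def set_lebesgue_integral_def by (intro integral_nonneg_AE) auto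
    have G: "integrable lebesgue G" "\<And>t. G t \<ge> 0"
      unfolding G_def using v T0[of 0] by (auto intro!: Bochner_Integration.integrable_add integrable_mult_right simp: integrable_indicator_iff)
    define M where "M = integral\<^sup>L lebesgue G"
    have Gx: "integrable lebesgue (\<lambda>t. indicat_real {0..x} t *\<^sub>R G t)" for x
      by (rule integrable_mult_indicator[OF _ G(1)]) simp
    have one: "integrable lebesgue (\<lambda>t. indicat_real {0..x} t *\<^sub>R (norm Winf / 2))" for x :: real
      by (intro integrable_scaleR_left) (auto simp: integrable_indicator_iff emeasure_lborel_Icc_eq)
    have est: "norm (f x * jost k x - Winf * of_real x) \<le> norm Winf / 2 * x + M" if x: "x \<ge> 0" for x
    proof -
      note i = ac_deriv_integrable[OF aP, of x]
      have "norm (f x * jost k x - Winf * of_real x) \<le> (LINT t:{0..x}|lebesgue. norm ((f1 t * jost k t + f t * jost_deriv k t) - Winf * 1))"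
        using ac_deriv_eq[OF aP x] f0 set_integral_norm_bound[OF i] by simp
      also have "\<dots> \<le> (LINT t|lebesgue. indicat_real {0..x} t *\<^sub>R (norm Winf / 2) + indicat_real {0..x} t *\<^sub>R G t)"
        unfolding set_lebesgue_integral_def
      proof (rule integral_mono_AE)
        show "integrable lebesgue (\<lambda>t. indicat_real {0..x} t *\<^sub>R norm (f1 t * jost k t + f t * jost_deriv k t - Winf * 1))"
          using set_integrable_norm[OF i] unfolding set_integrable_def .
        show "integrable lebesgue (\<lambda>t. indicat_real {0..x} t *\<^sub>R (norm Winf / 2) + indicat_real {0..x} t *\<^sub>R G t)"
          by (intro Bochner_Integration.integrable_add Gx one)
        show "AE t in lebesgue. indicat_real {0..x} t *\<^sub>R norm (f1 t * jost k t + f t * jost_deriv k t - Winf * 1)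
           \<le> indicat_real {0..x} t *\<^sub>R (norm Winf / 2) + indicat_real {0..x} t *\<^sub>R G t"
          using AE_lebesgue_neq[of 0]
        proof eventually_elim
          case (elim t)
          have "norm (f1 t * jost k t + f t * jost_deriv k t - Winf * 1) \<le> norm Winf / 2 + G t" if t: "t > 0"
          proof -
            have "f1 t * jost k t + f t * jost_deriv k t - Winf * 1 = 2 * v t - tail_int w t"
              using W[of t] t by (simp add: W_def v_def algebra_simps)
            also have "norm \<dots> \<le> 2 * norm (v t) + norm (tail_int w t)"
              using norm_triangle_ineq4[of "2 * v t" "tail_int w t"] by (simp add: norm_mult)
            also have "norm (tail_int w t) \<le> T t" unfolding T_def by (rule norm_tail_int_le[OF w wn]) simp
            also have "T t \<le> norm Winf / 2 + T 0 * indicat_real {0..real N} t"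
            proof (cases "t \<le> real N")
              case True
              have "T t \<le> T 0" unfolding T_def using t by (intro tail_int_antimono wn) auto
              then show ?thesis using True t norm_ge_zero[of Winf] by (simp add: add_increasing)
            next
              case False
              then have "T t \<le> T (real N)" unfolding T_def by (intro tail_int_antimono wn) auto
              then show ?thesis using N T0[of 0] by (auto simp: indicator_def)
            qed
            finally show ?thesis by (simp add: G_def)
          qed
          then show ?case using elim by (auto simp: indicator_def)
        qed
      qed
      also have "\<dots> = norm Winf / 2 * x + (LINT t|lebesgue. indicat_real {0..x} t *\<^sub>R G t)"
        using x by (subst Bochner_Integration.integral_add[OF one Gx]) simp
      also have "(LINT t|lebesgue. indicat_real {0..x} t *\<^sub>R G t) \<le> M"
        unfolding M_def by (rule Bochner_Integration.integral_mono[OF Gx G(1)]) (use G(2) in \<open>auto simp: indicator_def\<close>)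
      finally show ?thesis by simp
    qed
    have M0: "M \<ge> 0" unfolding M_def using G(2) by (intro integral_nonneg_AE) auto
    \<comment> \<open>The error is at most |Winf| x / 2 + M, so |f psi| >= |Winf| x / 2 - M, and the
      threshold is where the right side reaches 1.\<close>
    have "norm (indicat_real {0<..} x *\<^sub>R (f x * jost k x)) \<ge> 1" if x: "x \<ge> 2 * (M + 1) / norm Winf" for x
    proof -
      have "2 * (M + 1) / norm Winf > 0" using M0 nz by simp
      then have x0: "x > 0" using x by linarith
      have "norm Winf * x = norm (Winf * of_real x)" using x0 by (simp add: norm_mult)
      also have "\<dots> \<le> norm (f x * jost k x) + norm (f x * jost k x - Winf * of_real x)"
        by (metis norm_triangle_sub norm_minus_commute)
      also have "\<dots> \<le> norm (f x * jost k x) + (norm Winf / 2 * x + M)" using est x0 by simp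
      finally have "norm Winf * x / 2 - M \<le> norm (f x * jost k x)" by simp
      moreover have "norm Winf * x \<ge> 2 * (M + 1)" using x nz by (simp add: divide_le_eq mult.commute)
      ultimately show ?thesis using x0 by simp
    qed
    then show False using not_integrable_if_bounded_below[OF pairing_integrable[OF L(1) k]] by blast
  qed
  then have "c * jost k 0 = - tail_int w 0" by (simp add: Winf_def eq_neg_iff_add_eq_0)
  moreover have "tail_int w 0 = k\<^sup>2 * pairing k f - pairing k u"
  proof -
    have "tail_int w 0 = (LINT t|lebesgue. k\<^sup>2 * (indicat_real {0<..} t *\<^sub>R (f t * jost k t)) - indicat_real {0<..} t *\<^sub>R (u t * jost k t))"
      unfolding tail_int_def set_lebesgue_integral_def
      by (intro Bochner_Integration.integral_cong) (auto simp: w_def indicator_def algebra_simps)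
    also have "\<dots> = (LINT t|lebesgue. k\<^sup>2 * (indicat_real {0<..} t *\<^sub>R (f t * jost k t))) - pairing k u"
      unfolding pairing_def
      by (rule Bochner_Integration.integral_diff[OF integrable_mult_right[OF pairing_integrable[OF L(1) k]] pairing_integrable[OF L(2) k]])
    also have "(LINT t|lebesgue. k\<^sup>2 * (indicat_real {0<..} t *\<^sub>R (f t * jost k t))) = k\<^sup>2 * pairing k f"
      unfolding pairing_def by (rule integral_mult_right_zero)
    finally show ?thesis .
  qed
  ultimately show ?thesis by simp
qed

end

section \<open>Algebraic multiplicity and zeros of the Jost function\<close>

context half_line_potential
begin

text \<open>On a small disc around k both |z| and Im z are at least some c > 0, so all the Jost
  solutions there are dominated by one exponential exp(-c t) up to a constant.\<close>

lemma pairing_bounded_near: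
  assumes g: "L2_half g" and k: "Im k > 0"
  shows "(\<lambda>z. pairing z g) \<in> O[at k](\<lambda>z. 1 :: complex)"
proof -
  obtain r c where r: "r > 0" "cball k r \<subseteq> upper" "c > 0" "\<And>z. z \<in> cball k r \<Longrightarrow> norm z \<ge> c \<and> Im z \<ge> c"
    using exists_cball_upper[OF k] by metis
  define w where "w = (\<lambda>t. complex_of_real (exp (q_tail 0 / c) * exp (- c * t)))"
  have wm: "w \<in> borel_measurable lebesgue"
    unfolding w_def by (intro continuous_measurable_lebesgue continuous_intros)
  have "integrable lebesgue (\<lambda>t. indicat_real {0<..} t *\<^sub>R (g t * w t))"
    by (rule L2_half_mult_decay[OF g r(3) wm, of "exp (q_tail 0 / c)"]) (simp add: w_def norm_mult)
  then have i: "integrable lebesgue (\<lambda>t. norm (indicat_real {0<..} t *\<^sub>R (g t * w t)))" by (rule integrable_norm)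
  define M where "M = (LINT t|lebesgue. norm (indicat_real {0<..} t *\<^sub>R (g t * w t)))"
  have b: "norm (pairing z g) \<le> M" if z: "z \<in> cball k r" for z
  proof -
    have Iz: "Im z > 0" using r z by auto
    have "norm (pairing z g) \<le> (LINT t|lebesgue. norm (indicat_real {0<..} t *\<^sub>R (g t * jost z t)))"
      unfolding pairing_def by (rule integral_norm_bound)
    also have "\<dots> \<le> M"
      unfolding M_def
    proof (rule Bochner_Integration.integral_mono[OF integrable_norm[OF pairing_integrable[OF g Iz]] i])
      fix t show "norm (indicat_real {0<..} t *\<^sub>R (g t * jost z t)) \<le> norm (indicat_real {0<..} t *\<^sub>R (g t * w t))"
      proof (cases "t > 0")
        case True
        have "norm (jost z t) \<le> exp (q_tail 0 / norm z) * exp (- Im z * t)" using norm_jost[OF Iz] True by simp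
        also have "\<dots> \<le> exp (q_tail 0 / c) * exp (- c * t)"
          using q_tail_nonneg[of 0] r(3) r(4)[OF z] True by (intro mult_mono) (auto intro!: frac_le mult_right_mono)
        also have "\<dots> = norm (w t)" by (simp add: w_def norm_mult)
        finally show ?thesis using True by (simp add: norm_mult mult_left_mono)
      qed simp
    qed
    finally show ?thesis .
  qed
  have "\<forall>\<^sub>F z in at k. z \<in> ball k r"
    using r(1) by (intro eventually_at_in_open') auto
  then show ?thesis
    by (intro bigoI[of _ M]) (auto elim!: eventually_mono intro!: b)
qed

text \<open>With mu = z^2 - k^2, the Lagrange identities for F 1, ..., F p weighted by 1, mu, mu^2, ...
  telescope, and only mu^p times the pairing with F p survives.\<close>

lemma chain_zero_order:
  assumes k: "Im k > 0" and F0: "F 0 = (\<lambda>x. 0)" and F1: "F 1 \<noteq> (\<lambda>x. 0)" and p: "p \<ge> 1"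
    and F: "\<And>j. j < p \<Longrightarrow> \<exists>c. solves q (F (Suc j)) (\<lambda>x. k\<^sup>2 * F (Suc j) x + F j x) c"
  shows "jost k 0 = 0" "(\<lambda>z. jost z 0) \<in> O[at k](\<lambda>z. (z - k) ^ p)"
proof -
  obtain c where c: "\<And>j. j < p \<Longrightarrow> solves q (F (Suc j)) (\<lambda>x. k\<^sup>2 * F (Suc j) x + F j x) (c j)"
    using F by metis
  have L: "L2_half (F j)" if "j \<le> p" for j
  proof (cases j)
    case 0 then show ?thesis by (simp add: F0 L2_half_iff)
  next
    case (Suc i) then show ?thesis using c[of i] that by (simp add: solves_def)
  qed
  have P0: "pairing z (F 0) = 0" for z by (simp add: F0 pairing_def)
  have id: "c j * jost z 0 = pairing z (F j) - (z\<^sup>2 - k\<^sup>2) * pairing z (F (Suc j))" if z: "Im z > 0" and j: "j < p" for z j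
  proof -
    have "pairing z (\<lambda>x. k\<^sup>2 * F (Suc j) x + F j x) = (LINT t|lebesgue. k\<^sup>2 * (indicat_real {0<..} t *\<^sub>R (F (Suc j) t * jost z t)) + indicat_real {0<..} t *\<^sub>R (F j t * jost z t))"
      unfolding pairing_def by (intro Bochner_Integration.integral_cong) (auto simp: indicator_def algebra_simps)
    also have "\<dots> = (LINT t|lebesgue. k\<^sup>2 * (indicat_real {0<..} t *\<^sub>R (F (Suc j) t * jost z t))) + pairing z (F j)"
      unfolding pairing_def
      by (rule Bochner_Integration.integral_add[OF integrable_mult_right[OF pairing_integrable[OF L z]] pairing_integrable[OF L z]]) (use j in auto)
    also have "(LINT t|lebesgue. k\<^sup>2 * (indicat_real {0<..} t *\<^sub>R (F (Suc j) t * jost z t))) = k\<^sup>2 * pairing z (F (Suc j))"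
      unfolding pairing_def by (rule integral_mult_right_zero)
    finally show ?thesis using Lagrange_identity[OF z c[OF j]] by (simp add: algebra_simps)
  qed
  \<comment> \<open>An eigenfunction with zero slope at 0 would vanish identically.\<close>
  have c0: "c 0 \<noteq> 0"
  proof
    assume "c 0 = 0"
    then have "solves q (F 1) (\<lambda>x. k\<^sup>2 * F 1 x) 0" using c[of 0] p F0 by simp
    then show False using solves_unique F1 by blast
  qed
  \<comment> \<open>At z = k and j = 0 both terms on the right of the identity vanish.\<close>
  show "jost k 0 = 0" using id[OF k, of 0] p c0 by (simp add: P0)
  define D where "D = (\<lambda>z. \<Sum>j<p. (z\<^sup>2 - k\<^sup>2) ^ j * c j)"
  have main: "D z * jost z 0 = - ((z\<^sup>2 - k\<^sup>2) ^ p * pairing z (F p))" if z: "Im z > 0" for z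
  proof -
    have "D z * jost z 0 = (\<Sum>j<p. (z\<^sup>2 - k\<^sup>2) ^ j * (c j * jost z 0))"
      unfolding D_def sum_distrib_right by (simp add: mult.assoc)
    also have "\<dots> = (\<Sum>j<p. (z\<^sup>2 - k\<^sup>2) ^ j * pairing z (F j) - (z\<^sup>2 - k\<^sup>2) ^ Suc j * pairing z (F (Suc j)))"
      by (intro sum.cong) (auto simp: id[OF z] algebra_simps)
    also have "\<dots> = (z\<^sup>2 - k\<^sup>2) ^ 0 * pairing z (F 0) - (z\<^sup>2 - k\<^sup>2) ^ p * pairing z (F p)"
      by (rule sum_lessThan_telescope')
    finally show ?thesis by (simp add: P0)
  qed
  \<comment> \<open>All terms with j > 0 carry a power of z^2 - k^2. So D is nonzero near k and can
    be divided out without affecting the order of the zero.\<close>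
  have Dk: "D k = c 0"
    using p by (cases p) (simp_all add: D_def sum.lessThan_Suc_shift del: sum.lessThan_Suc)
  have Dlim: "D \<midarrow>k\<rightarrow> c 0"
    unfolding Dk[symmetric] unfolding D_def by (intro tendsto_intros)
  have "\<forall>\<^sub>F z in at k. Im z > 0" using eventually_at_in_open[OF open_upper, of k] k by (auto elim: eventually_mono)
  moreover have "\<forall>\<^sub>F z in at k. D z \<noteq> 0" using Dlim c0 by (rule tendsto_imp_eventually_ne)
  ultimately have ev: "\<forall>\<^sub>F z in at k. (z - k) ^ p * ((z + k) ^ p * - (1 / D z)) * pairing z (F p) = jost z 0"
  proof eventually_elim
    case (elim z)
    have "(z - k) ^ p * (z + k) ^ p = (z\<^sup>2 - k\<^sup>2) ^ p"
      by (simp add: power2_eq_square algebra_simps flip: power_mult_distrib)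
    then have "(z - k) ^ p * ((z + k) ^ p * - (1 / D z)) * pairing z (F p) = (D z * jost z 0) / D z"
      unfolding main[OF elim(1)] by (simp add: field_simps)
    then show ?case using elim by simp
  qed
  have "(\<lambda>z. (z + k) ^ p * - (1 / D z)) \<midarrow>k\<rightarrow> (k + k) ^ p * - (1 / c 0)"
    by (intro tendsto_intros Dlim c0)
  then have "(\<lambda>z. (z + k) ^ p * - (1 / D z) / 1) \<midarrow>k\<rightarrow> (k + k) ^ p * - (1 / c 0)" by simp
  then have "(\<lambda>z. (z + k) ^ p * - (1 / D z)) \<in> O[at k](\<lambda>z. 1)"
    by (rule bigoI_tendsto) auto
  then have "(\<lambda>z. (z - k) ^ p * ((z + k) ^ p * - (1 / D z)) * pairing z (F p)) \<in> O[at k](\<lambda>z. (z - k) ^ p * 1 * 1)"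
    by (intro landau_o.big.mult pairing_bounded_near L k) auto
  then show "(\<lambda>z. jost z 0) \<in> O[at k](\<lambda>z. (z - k) ^ p)"
    using landau_o.big.in_cong[OF ev] by simp
qed

end

section \<open>Jordan chains and root spaces\<close>

lemma gen_ker_iff_chain:
  "f \<in> gen_ker q z p \<longleftrightarrow> (\<exists>F. F 0 = (\<lambda>x. 0) \<and> F p = f \<and> (\<forall>j<p. schr_op q (F (Suc j)) (\<lambda>x. z * F (Suc j) x + F j x)))"
proof (induction p arbitrary: f)
  case 0 then show ?case by auto
next
  case (Suc p)
  show ?case
  proof
    assume "f \<in> gen_ker q z (Suc p)"
    then obtain g where g: "g \<in> gen_ker q z p" "schr_op q f (\<lambda>x. z * f x + g x)" by auto
    then obtain F where F: "F 0 = (\<lambda>x. 0)" "F p = g" "\<forall>j<p. schr_op q (F (Suc j)) (\<lambda>x. z * F (Suc j) x + F j x)"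
      using Suc.IH by blast
    show "\<exists>F. F 0 = (\<lambda>x. 0) \<and> F (Suc p) = f \<and> (\<forall>j<Suc p. schr_op q (F (Suc j)) (\<lambda>x. z * F (Suc j) x + F j x))"
      by (rule exI[of _ "F(Suc p := f)"]) (use F g in \<open>auto simp: less_Suc_eq\<close>)
  next
    assume "\<exists>F. F 0 = (\<lambda>x. 0) \<and> F (Suc p) = f \<and> (\<forall>j<Suc p. schr_op q (F (Suc j)) (\<lambda>x. z * F (Suc j) x + F j x))"
    then obtain F where F: "F 0 = (\<lambda>x. 0)" "F (Suc p) = f" "\<forall>j<Suc p. schr_op q (F (Suc j)) (\<lambda>x. z * F (Suc j) x + F j x)" by blast
    then have "F p \<in> gen_ker q z p" using Suc.IH by (metis less_SucI)
    then show "f \<in> gen_ker q z (Suc p)" using F by auto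
  qed
qed

lemma schr_op_zero: "schr_op q (\<lambda>x. 0) (\<lambda>x. 0)"
  unfolding schr_op_def
  by (intro conjI exI[of _ 0] exI[of _ "\<lambda>x. 0"]) (auto simp: L2_half_iff)

lemma gen_ker_mono_Suc: "gen_ker q z p \<subseteq> gen_ker q z (Suc p)"
proof (induction p)
  case 0 then show ?case using schr_op_zero by auto
next
  case (Suc p)
  show ?case
  proof
    fix f assume "f \<in> gen_ker q z (Suc p)"
    then obtain g where "g \<in> gen_ker q z p" "schr_op q f (\<lambda>x. z * f x + g x)" by auto
    then show "f \<in> gen_ker q z (Suc (Suc p))" using Suc gen_ker.simps(2)[of q z "Suc p"] by blast
  qed
qed

lemma gen_ker_mono: "m \<le> n \<Longrightarrow> gen_ker q z m \<subseteq> gen_ker q z n"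
  using lift_Suc_mono_le[of "gen_ker q z"] gen_ker_mono_Suc by metis

text \<open>A Jordan chain numbered upward from its eigenfunction \<open>F 1\<close>. Requiring
  \<open>F 1\<close> to be nonzero excludes padding by zeros, so that the length p carries
  information.\<close>

definition eig_chain :: "(real \<Rightarrow> complex) \<Rightarrow> complex \<Rightarrow> nat \<Rightarrow> (nat \<Rightarrow> real \<Rightarrow> complex) \<Rightarrow> bool" where
  "eig_chain q z p F \<longleftrightarrow> F 0 = (\<lambda>x. 0) \<and> F 1 \<noteq> (\<lambda>x. 0) \<and> (\<forall>j<p. schr_op q (F (Suc j)) (\<lambda>x. z * F (Suc j) x + F j x))"

text \<open>Take the least level containing f: if the first vector of the chain were zero, shifting
  the indices would put f one level lower.\<close>

lemma gen_ker_eig_chain: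
  assumes "f \<in> gen_ker q z n" "f \<noteq> (\<lambda>x. 0)"
  obtains p F where "p \<ge> 1" "eig_chain q z p F" "F p = f"
proof -
  define p where "p = (LEAST n. f \<in> gen_ker q z n)"
  have p: "f \<in> gen_ker q z p" unfolding p_def using assms(1) by (rule LeastI)
  have p0: "p \<noteq> 0" using p assms(2) by (metis gen_ker.simps(1) singletonD)
  obtain F where F: "F 0 = (\<lambda>x. 0)" "F p = f" "\<forall>j<p. schr_op q (F (Suc j)) (\<lambda>x. z * F (Suc j) x + F j x)"
    using p unfolding gen_ker_iff_chain by blast
  have "F 1 \<noteq> (\<lambda>x. 0)"
  proof
    assume F1: "F 1 = (\<lambda>x. 0)"
    obtain p' where p': "p = Suc p'" using p0 not0_implies_Suc by blast
    have "f \<in> gen_ker q z p'"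
      unfolding gen_ker_iff_chain by (rule exI[of _ "\<lambda>j. F (Suc j)"]) (use F F1 p' in auto)
    then show False using not_less_Least[of p' "\<lambda>n. f \<in> gen_ker q z n"] p' by (simp add: p_def)
  qed
  then show thesis using that[of p F] p0 F by (simp add: eig_chain_def)
qed

lemma vector_space_cscale: "vector_space cscale"
  by standard (auto simp: cscale_def fun_eq_iff algebra_simps)

lemma sum_in_span_cscale:
  "(\<lambda>x. \<Sum>i<j. a i * F (Suc i) x) \<in> module.span cscale (F ` {1..j})"
proof -
  interpret vector_space cscale by (rule vector_space_cscale)
  have eq: "(\<lambda>x. \<Sum>i<j. a i * F (Suc i) x) = (\<Sum>i<j. cscale (a i) (F (Suc i)))"
    by (induction j) (auto simp: cscale_def fun_eq_iff)
  show ?thesis unfolding eq by (intro span_sum span_scale span_base) auto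
qed

context half_line_potential
begin

text \<open>If (H - z) g is a combination of the F i, shifting every index up by one gives a vector
  with the same image. The difference is annihilated by H - z, hence a multiple of
  \<open>F 1\<close>. The second potential \<open>q'\<close> allows kernels of the original operator
  to be compared with a chain for its truncation.\<close>

lemma gen_ker_subset_span:
  assumes ch: "F 0 = (\<lambda>x. 0)" "F 1 \<noteq> (\<lambda>x. 0)"
    and sol: "\<And>f u. schr_op q' f u \<Longrightarrow> \<exists>c. solves q f u c"
    and F: "\<And>j. j < p \<Longrightarrow> \<exists>c. solves q (F (Suc j)) (\<lambda>x. z * F (Suc j) x + F j x) c"
    and g: "g \<in> gen_ker q' z j" and j: "j \<le> p"
  shows "\<exists>a. g = (\<lambda>x. \<Sum>i<j. a i * F (Suc i) x)"
  using g j
proof (induction j arbitrary: g)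
  case 0 then show ?case by simp
next
  case (Suc j)
  obtain g' where "g' \<in> gen_ker q' z j" "schr_op q' g (\<lambda>x. z * g x + g' x)"
    using Suc.prems(1) unfolding gen_ker.simps by blast
  then obtain c where g': "g' \<in> gen_ker q' z j" "solves q g (\<lambda>x. z * g x + g' x) c"
    using sol by blast
  then obtain a where a: "g' = (\<lambda>x. \<Sum>i<j. a i * F (Suc i) x)" using Suc by force
  have F1: "\<exists>c. solves q (F 1) (\<lambda>x. z * F 1 x) c" using F[of 0] Suc.prems(2) ch by simp
  then obtain c1 where c1: "solves q (F 1) (\<lambda>x. z * F 1 x) c1" by blast
  have c1nz: "c1 \<noteq> 0" using c1 solves_unique ch(2) by blast
  have L0: "L2_half (\<lambda>x. 0)" by (simp add: L2_half_iff)
  have "\<exists>d. solves q (\<lambda>x. \<Sum>i<m. a i * F (Suc (Suc i)) x) (\<lambda>x. z * (\<Sum>i<m. a i * F (Suc (Suc i)) x) + (\<Sum>i<m. a i * F (Suc i) x)) d" if "m \<le> j" for m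
    using that
  proof (induction m)
    case 0
    have "solves q (\<lambda>x. 0) (\<lambda>x. 0) 0"
      unfolding solves_def using L0 by (auto intro!: exI[of _ "\<lambda>x. 0"] ac_deriv_const)
    then show ?case by auto
  next
    case (Suc m)
    then obtain d where d: "solves q (\<lambda>x. \<Sum>i<m. a i * F (Suc (Suc i)) x) (\<lambda>x. z * (\<Sum>i<m. a i * F (Suc (Suc i)) x) + (\<Sum>i<m. a i * F (Suc i) x)) d" by auto
    obtain e where e: "solves q (F (Suc (Suc m))) (\<lambda>x. z * F (Suc (Suc m)) x + F (Suc m) x) e"
      using F[of "Suc m"] Suc.prems \<open>Suc j \<le> p\<close> by auto
    from solves_lin[OF d e, of 1 "a m"] show ?case by (auto simp: algebra_simps)
  qed
  then obtain d where d: "solves q (\<lambda>x. \<Sum>i<j. a i * F (Suc (Suc i)) x) (\<lambda>x. z * (\<Sum>i<j. a i * F (Suc (Suc i)) x) + (\<Sum>i<j. a i * F (Suc i) x)) d"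
    by auto
  define r where "r = (\<lambda>x. g x - (\<Sum>i<j. a i * F (Suc (Suc i)) x))"
  have r: "solves q r (\<lambda>x. z * r x) (c - d)"
    using solves_lin[OF g'(2) d, of 1 "-1"] by (simp add: r_def a algebra_simps)
  \<comment> \<open>Chosen so that the remainder has zero slope at 0, which
    \<open>solves_unique\<close> turns into the zero function.\<close>
  define b where "b = (c - d) / c1"
  have bc: "1 * (c - d) + - b * c1 = 0" using c1nz by (simp add: b_def)
  have "solves q (\<lambda>x. r x - b * F 1 x) (\<lambda>x. z * (r x - b * F 1 x)) 0"
    using solves_lin[OF r c1, of 1 "- b"] unfolding bc by (simp add: algebra_simps)
  then have "(\<lambda>x. r x - b * F 1 x) = (\<lambda>x. 0)" by (rule solves_unique)
  then have "g x = b * F 1 x + (\<Sum>i<j. a i * F (Suc (Suc i)) x)" for x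
    by (simp add: r_def fun_eq_iff algebra_simps)
  then have "g = (\<lambda>x. \<Sum>i<Suc j. (case i of 0 \<Rightarrow> b | Suc m \<Rightarrow> a m) * F (Suc i) x)"
    by (intro ext) (simp add: sum.lessThan_Suc_shift del: sum.lessThan_Suc)
  then show ?case by (intro exI)
qed

end


section \<open>From energies to momenta, and the final summation\<close>

text \<open>The branch of the square root cut along the nonnegative half-line: rotating z to -z
  moves the cut of the principal branch there.\<close>

definition upper_root :: "complex \<Rightarrow> complex" where "upper_root z = \<i> * csqrt (- z)"

lemma upper_root:
  assumes "z \<notin> complex_of_real ` {0..}" shows "Im (upper_root z) > 0" "(upper_root z)\<^sup>2 = z"
proof -
  have n: "- z \<notin> \<real>\<^sub>\<le>\<^sub>0"
  proof
    assume "- z \<in> \<real>\<^sub>\<le>\<^sub>0"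
    then have "z = complex_of_real (Re z)" "Re z \<ge> 0" by (auto simp: complex_nonpos_Reals_iff complex_eq_iff)
    then show False using assms by (metis atLeast_iff imageI)
  qed
  show "Im (upper_root z) > 0" unfolding upper_root_def Im_i_times by (rule Re_csqrt_pos[OF n])
  show "(upper_root z)\<^sup>2 = z" by (simp add: upper_root_def power_mult_distrib)
qed

text \<open>If Re(k^2) >= 0, comparison with the real part gives |Im(k^2)| = 2 |Re k| Im k.
  Otherwise |Re k| < Im k, so |k| <= 2 Im k, and the distance to 0 is good enough.\<close>

lemma infdist_half_line:
  assumes "Im k > 0" shows "infdist (k\<^sup>2) (complex_of_real ` {0..}) \<le> 2 * norm k * Im k"
proof (cases "Re (k\<^sup>2) \<ge> 0")
  case True
  have "infdist (k\<^sup>2) (complex_of_real ` {0..}) \<le> dist (k\<^sup>2) (complex_of_real (Re (k\<^sup>2)))"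
    using True by (intro infdist_le) auto
  also have "\<dots> = \<bar>Im (k\<^sup>2)\<bar>"
  proof -
    have "k\<^sup>2 - complex_of_real (Re (k\<^sup>2)) = \<i> * complex_of_real (Im (k\<^sup>2))" by (simp add: complex_eq_iff)
    then show ?thesis by (simp only: dist_norm norm_mult norm_of_real norm_ii mult_1)
  qed
  also have "\<dots> = 2 * \<bar>Re k\<bar> * Im k" using assms by (simp add: power2_eq_square abs_mult)
  also have "\<dots> \<le> 2 * norm k * Im k" using assms abs_Re_le_cmod[of k] by (intro mult_right_mono mult_left_mono) auto
  finally show ?thesis .
next
  case False
  have "infdist (k\<^sup>2) (complex_of_real ` {0..}) \<le> dist (k\<^sup>2) (complex_of_real 0)" by (intro infdist_le) auto
  also have "\<dots> = norm k * norm k" by (simp add: norm_mult power2_eq_square)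
  also have "\<dots> \<le> norm k * (2 * Im k)"
  proof (intro mult_left_mono)
    have "(Re k)\<^sup>2 < (Im k)\<^sup>2" using False by (simp add: power2_eq_square)
    then have "\<bar>Re k\<bar> < \<bar>Im k\<bar>" using abs_le_square_iff[of "Im k" "Re k"] by linarith
    then show "norm k \<le> 2 * Im k" using cmod_le[of k] assms by simp
  qed auto
  finally show ?thesis by (simp add: mult_ac)
qed

text \<open>The bound on zeros limits the length of the chains; the root space is the kernel reached by a
  longest one, hence spanned by that chain.\<close>

lemma alg_mult_order:
  assumes hp: "half_line_potential q0" and q0: "\<And>x. x > 0 \<Longrightarrow> q0 x = q x" and z: "z \<in> disc_spec q"
  shows "half_line_potential.jost q0 (upper_root z) 0 = 0"
    "(\<lambda>w. half_line_potential.jost q0 w 0) \<in> O[at (upper_root z)](\<lambda>w. (w - upper_root z) ^ alg_mult q z)"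
proof -
  interpret half_line_potential q0 by fact
  have zn: "z \<notin> complex_of_real ` {0..}" and g1: "gen_ker q z 1 \<noteq> {\<lambda>x. 0}"
    using z by (auto simp: disc_spec_def)
  note k = upper_root[OF zn]
  have sol: "\<exists>c. solves q0 f u c" if "schr_op q f u" for f u
    using schr_op_solves[OF that] solves_cong[of q f u _ q0] q0 by metis
  have chs: "\<exists>c. solves q0 (F (Suc j)) (\<lambda>x. (upper_root z)\<^sup>2 * F (Suc j) x + F j x) c" if "eig_chain q z p F" "j < p" for F j p
    using that sol unfolding eig_chain_def k(2) by blast
  have ord: "jost (upper_root z) 0 = 0" "(\<lambda>w. jost w 0) \<in> O[at (upper_root z)](\<lambda>w. (w - upper_root z) ^ p)" if "eig_chain q z p F" "p \<ge> 1" for p F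
    using chain_zero_order[of "upper_root z" F p] k(1) chs[OF that(1)] that unfolding eig_chain_def by blast+
  obtain K where K: "\<And>Q F A n. zero_config Q F A n \<Longrightarrow>
     (\<Sum>a\<in>A. real (n a) * Im a * norm a powr 1) \<le> K * Q powr (1 + 1)"
    using zeros_weighted_sum[OF zero_less_one] by blast
  \<comment> \<open>A chain of length p makes k a zero of order p, so the weighted bound with eps =
    1 for this single zero reads p Im k |k| <= K (Q + 1)^2. Using Q + 1 keeps the parameter positive
    even for the zero potential.\<close>
  define N where "N = nat \<lceil>K * (q_tail 0 + 1) powr 2 / (Im (upper_root z) * norm (upper_root z))\<rceil>"
  have le1: "norm (jost w 0 - 1) \<le> exp ((q_tail 0 + 1) / norm w) - 1" if "Im w > 0" for w
    by (rule order_trans[OF norm_jost_0[OF that]]) (simp add: divide_right_mono)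
  have bound: "p \<le> N" if ch: "eig_chain q z p F" for p F
  proof (cases "p \<ge> 1")
    case True
    have "(\<Sum>a\<in>{upper_root z}. real p * Im a * norm a powr 1) \<le> K * (q_tail 0 + 1) powr (1 + 1)"
      by (rule K[where F="\<lambda>w. jost w 0" and n="\<lambda>_. p"], unfold zero_config_def)
         (use q_tail_nonneg[of 0] k(1) jost_0_holomorphic le1 ord[OF ch True] in auto)
    moreover have "norm (upper_root z) > 0" using k(1) by auto
    ultimately have "real p \<le> K * (q_tail 0 + 1) powr 2 / (Im (upper_root z) * norm (upper_root z))"
      using k(1) by (simp add: field_simps)
    then show ?thesis unfolding N_def by linarith
  qed simp
  have "(\<lambda>x. 0) \<in> gen_ker q z 1" using gen_ker_mono_Suc[of q z 0] by auto
  then obtain f where "f \<in> gen_ker q z 1" "f \<noteq> (\<lambda>x. 0)" using g1 by blast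
  then obtain p1 F1 where p1: "p1 \<ge> 1" "eig_chain q z p1 F1" by (rule gen_ker_eig_chain)
  \<comment> \<open>The maximum exists because lengths are bounded by N, and p >= 1 because an
    eigenfunction exists.\<close>
  define p where "p = (GREATEST p. \<exists>F. eig_chain q z p F)"
  have "\<exists>F. eig_chain q z p F" unfolding p_def by (rule GreatestI_nat[of _ p1 N]) (use p1 bound in auto)
  then obtain F where F: "eig_chain q z p F" by blast
  have max: "p' \<le> p" if "eig_chain q z p' F'" for p' F'
    unfolding p_def by (rule Greatest_le_nat[of _ _ N]) (use that bound in auto)
  have p: "p \<ge> 1" using max[OF p1(2)] p1(1) by simp
  have sub: "root_space q z \<subseteq> gen_ker q z p"
  proof
    fix f assume "f \<in> root_space q z"
    then obtain n where n: "f \<in> gen_ker q z n" by (auto simp: root_space_def)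
    show "f \<in> gen_ker q z p"
    proof (cases "f = (\<lambda>x. 0)")
      case True
      then show ?thesis using gen_ker_mono[of 0 p q z] by auto
    next
      case False
      then obtain p' F' where p': "eig_chain q z p' F'" "F' p' = f" using gen_ker_eig_chain[OF n] by metis
      then have "f \<in> gen_ker q z p'" unfolding gen_ker_iff_chain eig_chain_def by blast
      then show ?thesis using gen_ker_mono max[OF p'(1)] by blast
    qed
  qed
  interpret vs: vector_space cscale by (rule vector_space_cscale)
  have "root_space q z \<subseteq> vs.span (F ` {1..p})"
  proof
    fix f assume "f \<in> root_space q z"
    then have "f \<in> gen_ker q z p" using sub by blast
    then have "\<exists>a. f = (\<lambda>x. \<Sum>i<p. a i * F (Suc i) x)"
      using gen_ker_subset_span[of F q p z f p] F chs[OF F] sol unfolding eig_chain_def k(2) by blast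
    then show "f \<in> vs.span (F ` {1..p})" using sum_in_span_cscale by metis
  qed
  then have "alg_mult q z \<le> card (F ` {1..p})"
    unfolding alg_mult_def by (rule vs.dim_le_card) simp
  also have "\<dots> \<le> p" using card_image_le[of "{1..p}" F] by simp
  finally have le: "alg_mult q z \<le> p" .
  show "jost (upper_root z) 0 = 0" using ord(1)[OF F p] .
  \<comment> \<open>The zero has order at least p, which is at least the multiplicity; near the zero
    the higher power is dominated by the lower one.\<close>
  have "(\<lambda>w. (w - upper_root z) ^ p) \<in> O[at (upper_root z)](\<lambda>w. (w - upper_root z) ^ alg_mult q z)"
  proof -
    have "(\<lambda>w. (w - upper_root z) ^ (p - alg_mult q z)) \<midarrow>upper_root z\<rightarrow> (upper_root z - upper_root z) ^ (p - alg_mult q z)"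
      by (intro tendsto_intros)
    then have "(\<lambda>w. (w - upper_root z) ^ (p - alg_mult q z) / 1) \<midarrow>upper_root z\<rightarrow> (upper_root z - upper_root z) ^ (p - alg_mult q z)" by simp
    then have "(\<lambda>w. (w - upper_root z) ^ (p - alg_mult q z)) \<in> O[at (upper_root z)](\<lambda>w. 1)"
      by (rule bigoI_tendsto) auto
    from landau_o.big.mult[OF this landau_o.big_refl, of "\<lambda>w. (w - upper_root z) ^ alg_mult q z"]
    show ?thesis using le by (simp flip: power_add)
  qed
  with ord(2)[OF F p] show "(\<lambda>w. jost w 0) \<in> O[at (upper_root z)](\<lambda>w. (w - upper_root z) ^ alg_mult q z)"
    by (rule landau_o.big_trans)
qed

lemma q_tail_0_eq_L1_norm:
  assumes "q absolutely_integrable_on {0<..}"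
  defines "q0 \<equiv> \<lambda>t. indicat_real {0<..} t *\<^sub>R q t"
  shows "half_line_potential q0" "half_line_potential.q_tail q0 0 = L1_norm q"
proof -
  show hp: "half_line_potential q0"
    by standard (use assms(1) in \<open>auto simp: q0_def set_integrable_def\<close>)
  interpret half_line_potential q0 by (rule hp)
  have "q_tail 0 = tail_int (\<lambda>t. norm (q0 t)) 0" by (simp add: q_tail_def)
  also have "\<dots> = (LINT t:{0<..}|lebesgue. norm (q t))"
    unfolding tail_int_def set_lebesgue_integral_def q0_def
    by (intro Bochner_Integration.integral_cong) (auto simp: indicator_def)
  finally show "q_tail 0 = L1_norm q"
    unfolding L1_norm_def using set_lebesgue_integral_eq_integral(2)[OF set_integrable_norm[OF assms(1)]] by simp
qed

theorem theorem1p1: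
  shows "\<forall>\<epsilon>::real. \<epsilon> > 0 \<longrightarrow> (\<exists>K>0. \<forall>q::real \<Rightarrow> complex. q absolutely_integrable_on {0<..} \<longrightarrow>
     ((\<lambda>z. real (alg_mult q z) * infdist z (complex_of_real ` {0..}) / norm z powr ((1 - \<epsilon>) / 2))
        summable_on disc_spec q) \<and>
     (\<Sum>\<^sub>\<infinity>z\<in>disc_spec q. real (alg_mult q z) * infdist z (complex_of_real ` {0..}) / norm z powr ((1 - \<epsilon>) / 2))
        \<le> K * L1_norm q powr (1 + \<epsilon>))"
proof (intro allI impI)
  fix \<epsilon> :: real assume eps: "\<epsilon> > 0"
  obtain K where K: "K > 0" and zeros: "\<And>Q F A n. zero_config Q F A n \<Longrightarrow>
     (\<Sum>a\<in>A. real (n a) * Im a * norm a powr \<epsilon>) \<le> K * Q powr (1 + \<epsilon>)"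
    using zeros_weighted_sum[OF eps] by blast
  show "\<exists>K>0. \<forall>q::real \<Rightarrow> complex. q absolutely_integrable_on {0<..} \<longrightarrow>
     ((\<lambda>z. real (alg_mult q z) * infdist z (complex_of_real ` {0..}) / norm z powr ((1 - \<epsilon>) / 2))
        summable_on disc_spec q) \<and>
     (\<Sum>\<^sub>\<infinity>z\<in>disc_spec q. real (alg_mult q z) * infdist z (complex_of_real ` {0..}) / norm z powr ((1 - \<epsilon>) / 2))
        \<le> K * L1_norm q powr (1 + \<epsilon>)"
  \<comment> \<open>The factor 2 comes from \<open>infdist_half_line\<close>.\<close>
  proof (intro exI[of _ "2 * K"] conjI[of "2 * K > 0"] allI impI)
    show "2 * K > 0" using K by simp
    fix q :: "real \<Rightarrow> complex" assume q: "q absolutely_integrable_on {0<..}"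
    \<comment> \<open>Truncation to the open half-line gives a globally integrable potential without
      changing the operator.\<close>
    define q0 where "q0 = (\<lambda>t. indicat_real {0<..} t *\<^sub>R q t)"
    note hp = q_tail_0_eq_L1_norm[OF q, folded q0_def]
    interpret half_line_potential q0 by (rule hp)
    define T where "T = (\<lambda>z. real (alg_mult q z) * infdist z (complex_of_real ` {0..}) / norm z powr ((1 - \<epsilon>) / 2))"
    have T0: "T z \<ge> 0" for z unfolding T_def by (simp add: infdist_nonneg)
    have fin: "sum T Z \<le> 2 * K * L1_norm q powr (1 + \<epsilon>)" if Z: "finite Z" "Z \<subseteq> disc_spec q" for Z
    proof (cases "q_tail 0 > 0")
      case False
      then have R0: "q_tail 0 = 0" using q_tail_nonneg[of 0] by simp
      have "Z = {}"
      proof (rule ccontr)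
        assume "Z \<noteq> {}"
        then obtain z where "z \<in> disc_spec q" using Z by blast
        then have "jost (upper_root z) 0 = 0" "Im (upper_root z) > 0"
          using alg_mult_order(1)[OF hp(1)] upper_root(1) by (auto simp: q0_def disc_spec_def)
        then show False using norm_jost_0[of "upper_root z"] R0 by simp
      qed
      then show ?thesis using K by simp
    next
      case True
      have zn: "z \<notin> complex_of_real ` {0..}" if "z \<in> Z" for z using that Z by (auto simp: disc_spec_def)
      have ord: "jost (upper_root z) 0 = 0" "(\<lambda>w. jost w 0) \<in> O[at (upper_root z)](\<lambda>w. (w - upper_root z) ^ alg_mult q z)" if "z \<in> Z" for z
        using alg_mult_order[OF hp(1), of q z] that Z by (auto simp: q0_def)
      have "sum T Z \<le> (\<Sum>z\<in>Z. 2 * (real (alg_mult q z) * Im (upper_root z) * norm (upper_root z) powr \<epsilon>))"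
      proof (rule sum_mono)
        fix z assume z: "z \<in> Z"
        define k where "k = upper_root z"
        have k: "Im k > 0" "k\<^sup>2 = z" unfolding k_def using upper_root[OF zn[OF z]] by auto
        have kn: "norm k > 0" using k(1) by auto
        have "norm z powr ((1 - \<epsilon>) / 2) = norm k powr (1 - \<epsilon>)"
        proof -
          have "norm z = norm k powr 2" using kn by (simp add: k(2)[symmetric] norm_power)
          moreover have "2 * ((1 - \<epsilon>) / 2) = 1 - \<epsilon>" by simp
          ultimately show ?thesis by (simp only: powr_powr)
        qed
        then have "infdist z (complex_of_real ` {0..}) / norm z powr ((1 - \<epsilon>) / 2) \<le> 2 * norm k * Im k / norm k powr (1 - \<epsilon>)"
          using infdist_half_line[OF k(1)] by (simp add: k(2) divide_right_mono)
        also have "\<dots> = 2 * Im k * norm k powr \<epsilon>"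
          using kn by (simp add: powr_diff field_simps)
        finally have "real (alg_mult q z) * (infdist z (complex_of_real ` {0..}) / norm z powr ((1 - \<epsilon>) / 2)) \<le> real (alg_mult q z) * (2 * Im k * norm k powr \<epsilon>)"
          by (intro mult_left_mono) auto
        then show "T z \<le> 2 * (real (alg_mult q z) * Im (upper_root z) * norm (upper_root z) powr \<epsilon>)"
          by (simp add: T_def k_def mult_ac)
      qed
      also have "\<dots> = 2 * (\<Sum>z\<in>Z. real (alg_mult q z) * Im (upper_root z) * norm (upper_root z) powr \<epsilon>)"
        by (rule sum_distrib_left[symmetric])
      \<comment> \<open>Summation over momenta: \<open>upper_root\<close> is injective since
        squaring undoes it, and the multiplicities are carried over as a function of a^2.\<close>
      also have "(\<Sum>z\<in>Z. real (alg_mult q z) * Im (upper_root z) * norm (upper_root z) powr \<epsilon>) = (\<Sum>a\<in>upper_root ` Z. real (alg_mult q (a\<^sup>2)) * Im a * norm a powr \<epsilon>)"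
      proof (subst sum.reindex)
        show "inj_on upper_root Z" using upper_root(2)[OF zn] by (metis inj_onI)
      qed (auto intro!: sum.cong simp: upper_root(2)[OF zn])
      also have "\<dots> \<le> K * q_tail 0 powr (1 + \<epsilon>)"
        by (rule zeros[where F="\<lambda>w. jost w 0"], unfold zero_config_def)
           (use True jost_0_holomorphic norm_jost_0 Z(1) upper_root[OF zn] ord in auto)
      finally show ?thesis by (simp add: hp(2))
    qed
    \<comment> \<open>The terms are nonnegative, so the uniform bound on finite partial sums yields
      summability as well as the estimate.\<close>
    have sm: "T summable_on disc_spec q"
      by (rule nonneg_bdd_above_summable_on) (use T0 fin in \<open>auto simp: bdd_above_def\<close>)
    moreover have "infsum T (disc_spec q) \<le> 2 * K * L1_norm q powr (1 + \<epsilon>)"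
      by (rule infsum_le_finite_sums[OF sm fin])
    ultimately show "((\<lambda>z. real (alg_mult q z) * infdist z (complex_of_real ` {0..}) / norm z powr ((1 - \<epsilon>) / 2))
        summable_on disc_spec q) \<and>
     (\<Sum>\<^sub>\<infinity>z\<in>disc_spec q. real (alg_mult q z) * infdist z (complex_of_real ` {0..}) / norm z powr ((1 - \<epsilon>) / 2))
        \<le> 2 * K * L1_norm q powr (1 + \<epsilon>)"
      unfolding T_def by blast
  qed
qed

end
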